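(* Let $n\ge2$, $1<p<\infty$, $F$ as in the context, let $\Omega\subset\mathbb R^n$ be a bounded open set with $C^{1,\alpha}$ boundary ($\alpha\in\,]0,1[$), let $\mathcal W_R$ be a Wulff shape of radius $R$ with $\Omega\subset\mathcal W_R$, and let $\bar\beta$ be a positive constant. Then $\ell_1(\bar\beta,\mathcal W_R)\le\ell_1(\bar\beta,\Omega)$.
   Context: $F:\mathbb R^n\to[0,\infty)$ is convex, even, $F(t\xi)=|t|F(\xi)$, $a|\xi|\le F(\xi)\le b|\xi|$ ($0<a\le b$), $F\in C^2(\mathbb R^n\setminus\{0\})$, Hessian of $F^p$ positive definite off the origin. $F^o(v)=\sup_{\xi\ne0}\langle\xi,v\rangle/F(\xi)$; a Wulff shape of radius $R$ is a set $x_0+\{x:F^o(x)<R\}$. For a bounded open set $D$ with Lipschitz boundary and Euclidean outer normal $\nu$, $\ell_1(\bar\beta,D)=\inf_{v\in W^{1,p}(D),v\not\equiv0}\frac{\int_DF^p(\nabla v)dx+\bar\beta\int_{\partial D}|v|^pF(\nu)d\mathcal H^{n-1}}{\int_D|v|^pdx}$ (first Robin eigenvalue of $\mathcal Q_pu=\operatorname{div}(F^{p-1}(\nabla u)F_\xi(\nabla u))$). *)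

theory Defs
  imports "HOL-Analysis.Analysis"
begin

definition C2_grad_hess :: "'a::euclidean_space set \<Rightarrow> ('a \<Rightarrow> real) \<Rightarrow> ('a \<Rightarrow> 'a) \<Rightarrow> ('a \<Rightarrow> 'a \<Rightarrow> 'a) \<Rightarrow> bool" where
  "C2_grad_hess S f g H \<longleftrightarrow>
     (\<forall>x\<in>S. (f has_derivative (\<lambda>h. g x \<bullet> h)) (at x) \<and> (g has_derivative H x) (at x)) \<and>
     (\<forall>u. continuous_on S (\<lambda>x. H x u))"

definition finsler_norm :: "real \<Rightarrow> ('a::euclidean_space \<Rightarrow> real) \<Rightarrow> bool" where
  "finsler_norm p F \<longleftrightarrow>
     (\<forall>\<xi>. 0 \<le> F \<xi>) \<and>
     convex_on UNIV F \<and>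
     (\<forall>\<xi>. F (- \<xi>) = F \<xi>) \<and>
     (\<forall>t \<xi>. F (t *\<^sub>R \<xi>) = \<bar>t\<bar> * F \<xi>) \<and>
     (\<exists>a b. 0 < a \<and> a \<le> b \<and> (\<forall>\<xi>. a * norm \<xi> \<le> F \<xi> \<and> F \<xi> \<le> b * norm \<xi>)) \<and>
     (\<exists>g H. C2_grad_hess (- {0}) F g H) \<and>
     (\<exists>g H. C2_grad_hess (- {0}) (\<lambda>\<xi>. F \<xi> powr p) g H \<and>
        (\<forall>\<xi>. \<xi> \<noteq> 0 \<longrightarrow> (\<forall>v. v \<noteq> 0 \<longrightarrow> v \<bullet> H \<xi> v > 0)))"

definition polar :: "('a::euclidean_space \<Rightarrow> real) \<Rightarrow> 'a \<Rightarrow> real" where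
  "polar F v = (SUP \<xi>\<in>- {0}. (\<xi> \<bullet> v) / F \<xi>)"

definition wulff_shape :: "('a::euclidean_space \<Rightarrow> real) \<Rightarrow> 'a \<Rightarrow> real \<Rightarrow> 'a set" where
  "wulff_shape F x0 R = {x. polar F (x - x0) < R}"

definition C1alpha_boundary :: "real \<Rightarrow> 'a::euclidean_space set \<Rightarrow> bool" where
  "C1alpha_boundary \<alpha> D \<longleftrightarrow>
     (\<forall>x\<in>frontier D. \<exists>r>0. \<exists>e g Dg C. norm e = 1 \<and>
        (\<forall>y. (g has_derivative (\<lambda>h. Dg y \<bullet> h)) (at y)) \<and>
        (\<forall>y z. norm (Dg y - Dg z) \<le> C * norm (y - z) powr \<alpha>) \<and>
        D \<inter> ball x r = {y\<in>ball x r. y \<bullet> e < g (y - (y \<bullet> e) *\<^sub>R e)})"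

text \<open>Euclidean outer unit normal at a boundary point x (defined wherever D is
  asymptotically the half-space {y. (y - x)\<bullet>\<nu> < 0} near x; for Lipschitz domains this is
  H^{n-1}-a.e. on the boundary).\<close>
definition is_outer_normal :: "'a::euclidean_space set \<Rightarrow> 'a \<Rightarrow> 'a \<Rightarrow> bool" where
  "is_outer_normal D x \<nu> \<longleftrightarrow> norm \<nu> = 1 \<and>
     (\<forall>\<epsilon>>0. \<exists>r>0. \<forall>y\<in>ball x r.
        ((y - x) \<bullet> \<nu> < - \<epsilon> * norm (y - x) \<longrightarrow> y \<in> D) \<and>
        ((y - x) \<bullet> \<nu> > \<epsilon> * norm (y - x) \<longrightarrow> y \<notin> D))"

definition outer_normal :: "'a::euclidean_space set \<Rightarrow> 'a \<Rightarrow> 'a" where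
  "outer_normal D x = (SOME \<nu>. is_outer_normal D x \<nu>)"

definition hausdorff_const :: "real \<Rightarrow> real" where
  "hausdorff_const s = pi powr (s / 2) / Gamma (s / 2 + 1)"

definition hausdorff_pre :: "real \<Rightarrow> real \<Rightarrow> 'a::metric_space set \<Rightarrow> ennreal" where
  "hausdorff_pre s \<delta> A =
     (INF C\<in>{C :: nat \<Rightarrow> 'a set. A \<subseteq> (\<Union>i. C i) \<and> (\<forall>i. bounded (C i) \<and> diameter (C i) \<le> \<delta>)}.
        (\<Sum>i. ennreal (hausdorff_const s * (diameter (C i) / 2) powr s)))"

definition hausdorff_outer :: "real \<Rightarrow> 'a::metric_space set \<Rightarrow> ennreal" where
  "hausdorff_outer s A = (SUP \<delta>\<in>{0<..}. hausdorff_pre s \<delta> A)"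

definition hausdorff_measure :: "real \<Rightarrow> 'a::metric_space measure" where
  "hausdorff_measure s = measure_of UNIV (sets borel) (hausdorff_outer s)"

definition C1c_test :: "'a::euclidean_space set \<Rightarrow> ('a \<Rightarrow> real) \<Rightarrow> ('a \<Rightarrow> 'a) \<Rightarrow> bool" where
  "C1c_test D \<phi> d\<phi> \<longleftrightarrow>
     (\<forall>x. (\<phi> has_derivative (\<lambda>h. d\<phi> x \<bullet> h)) (at x)) \<and> continuous_on UNIV d\<phi> \<and>
     compact (closure {x. \<phi> x \<noteq> 0}) \<and> closure {x. \<phi> x \<noteq> 0} \<subseteq> D"

definition sobolev_W1p :: "real \<Rightarrow> 'a::euclidean_space set \<Rightarrow> ('a \<Rightarrow> real) \<Rightarrow> ('a \<Rightarrow> 'a) \<Rightarrow> bool" where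
  "sobolev_W1p p D v G \<longleftrightarrow>
     v \<in> borel_measurable (lebesgue_on D) \<and> G \<in> borel_measurable (lebesgue_on D) \<and>
     set_nn_integral lebesgue D (\<lambda>x. ennreal (\<bar>v x\<bar> powr p)) < \<infinity> \<and>
     set_nn_integral lebesgue D (\<lambda>x. ennreal (norm (G x) powr p)) < \<infinity> \<and>
     (\<forall>\<phi> d\<phi>. C1c_test D \<phi> d\<phi> \<longrightarrow>
        set_lebesgue_integral lebesgue D (\<lambda>x. v x *\<^sub>R d\<phi> x) =
          - set_lebesgue_integral lebesgue D (\<lambda>x. \<phi> x *\<^sub>R G x))"

definition sobolev_trace :: "real \<Rightarrow> 'a::euclidean_space set \<Rightarrow> ('a \<Rightarrow> real) \<Rightarrow> ('a \<Rightarrow> 'a) \<Rightarrow> ('a \<Rightarrow> real) \<Rightarrow> bool" where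
  "sobolev_trace p D v G w \<longleftrightarrow>
     w \<in> borel_measurable borel \<and>
     (\<exists>u :: nat \<Rightarrow> 'a \<Rightarrow> real. \<exists>du :: nat \<Rightarrow> 'a \<Rightarrow> 'a.
        (\<forall>k x. (u k has_derivative (\<lambda>h. du k x \<bullet> h)) (at x)) \<and> (\<forall>k. continuous_on UNIV (du k)) \<and>
        (\<lambda>k. set_nn_integral lebesgue D (\<lambda>x. ennreal (\<bar>u k x - v x\<bar> powr p))) \<longlonglongrightarrow> 0 \<and>
        (\<lambda>k. set_nn_integral lebesgue D (\<lambda>x. ennreal (norm (du k x - G x) powr p))) \<longlonglongrightarrow> 0 \<and>
        (\<lambda>k. set_nn_integral (hausdorff_measure (real (DIM('a) - 1))) (frontier D)
               (\<lambda>x. ennreal (\<bar>u k x - w x\<bar> powr p))) \<longlonglongrightarrow> 0)"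

definition robin_eig :: "('a::euclidean_space \<Rightarrow> real) \<Rightarrow> real \<Rightarrow> real \<Rightarrow> 'a set \<Rightarrow> ennreal" where
  "robin_eig F p \<beta> D =
     Inf {(set_nn_integral lebesgue D (\<lambda>x. ennreal (F (G x) powr p))
           + ennreal \<beta> * set_nn_integral (hausdorff_measure (real (DIM('a) - 1))) (frontier D)
               (\<lambda>x. ennreal (\<bar>w x\<bar> powr p * F (outer_normal D x))))
          / set_nn_integral lebesgue D (\<lambda>x. ennreal (\<bar>v x\<bar> powr p))
        | v G w. sobolev_W1p p D v G \<and> sobolev_trace p D v G w \<and>
                 \<not> (AE x in lebesgue_on D. v x = 0)}"

end

theory Submission
  imports Defs
begin

text \<open>A Barta-type argument. On the Wulff shape the first eigenfunction \<open>v\<close> is radial, and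
  \<open>h = (F(\<nabla>v) / v)\<^bsup>p-1\<^esup>\<close>, as a function of \<open>r = F\<^sup>o(x - x0)\<close>, solves the Riccati equation
  \<open>h' + (n-1) h/r = l + (p-1) h\<^bsup>p/(p-1)\<^esup>\<close> with \<open>h(0) = 0\<close> and \<open>h(R) = \<beta>\<close>. The field
  \<open>Z = h(r) (x - x0) / r\<close> is continuously differentiable, has divergence \<open>l + (p-1) h\<^bsup>p/(p-1)\<^esup>\<close>, and
  \<open>Z \<bullet> \<nu> \<le> h F(\<nu>) \<le> \<beta> F(\<nu>)\<close> throughout the Wulff shape, because \<open>h\<close> is nondecreasing. Applying the
  divergence theorem to \<open>\<bar>u\<bar>\<^sup>p Z\<close> on any domain inside the Wulff shape and estimating
  \<open>\<nabla>(\<bar>u\<bar>\<^sup>p) \<bullet> Z\<close> by Young's inequality bounds the Robin quotient of \<open>u\<close> below by \<open>l\<close>; on the Wulff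
  shape itself all inequalities are equalities for \<open>u = v\<close>.

  The divergence theorem for the Hausdorff surface measure is needed only up to a constant factor
  that does not depend on the domain, since such a factor can be absorbed into \<open>\<beta>\<close>. This avoids
  the isodiametric inequality: the product of the Hausdorff measure of a hyperplane with
  the length measure of its normal is translation invariant, hence a multiple of Lebesgue measure,
  and reflections show that the multiple is the same for all directions.\<close>

section \<open>Hausdorff measure\<close>

text \<open>The Riccati equation is singular at the origin. Its unknown is therefore encoded through
  the divergence \<open>q\<close> of the field: \<open>h\<close> is r times a weighted mean of
  \<open>q\<close> over [0, r]. The equation then becomes an integral equation that is regular at 0,
  and h(r) / r extends continuously to the centre, which makes the field C1 there. The parameter l
  is found by shooting for the value of \<open>h\<close> at R. That value is
  \<open>c * \<beta>\<close>, where c is the factor in the divergence theorem, so that c cancels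
  from the Robin inequality.

  The surface side has to work with the measure and normal of the definitions: a Hausdorff measure
  is a bare \<open>measure_of\<close> until Caratheodory's criterion applies, and the outer normal
  is a chosen vector. Graph domains and Wulff shapes are both reduced to the cone condition
  \<open>C1_domain\<close>; the flux through a small flat piece is then estimated from line
  integrals in all transversal directions. Sobolev functions enter only at the end:
  \<open>sobolev_trace\<close> supplies C1 approximants, so the inequality is proved for C1
  functions and passed to the limit.\<close>

lemma borel_subset_lambda_system:
  fixes \<mu> :: "'a::metric_space set \<Rightarrow> ennreal"
  assumes om: "outer_measure_space (Pow UNIV) \<mu>"
    and metric: "\<And>A B d. 0 < d \<Longrightarrow> (\<And>a b. a \<in> A \<Longrightarrow> b \<in> B \<Longrightarrow> d \<le> dist a b) \<Longrightarrow> \<mu> A + \<mu> B \<le> \<mu> (A \<union> B)"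
  shows "sets borel \<subseteq> lambda_system UNIV (Pow UNIV) \<mu>"
proof -
  interpret P: sigma_algebra UNIV "Pow UNIV :: 'a set set" by (rule sigma_algebra_Pow)
  have mono: "\<mu> A \<le> \<mu> B" if "A \<subseteq> B" for A B
    using om that by (auto simp: outer_measure_space_def increasing_def)
  have \<mu>0: "\<mu> {} = 0" using om by (auto simp: outer_measure_space_def positive_def)
  have csub: "countably_subadditive (Pow UNIV) \<mu>" "positive (Pow UNIV) \<mu>"
    using om by (auto simp: outer_measure_space_def)
  have sub2: "\<mu> (A \<union> B) \<le> \<mu> A + \<mu> B" for A B
  proof -
    have *: "\<And>A B. A \<inter> B = {} \<Longrightarrow> \<mu> (A \<union> B) \<le> \<mu> A + \<mu> B"
      using P.countably_subadditive_subadditive[OF csub(2,1)] by (auto simp: subadditive_def)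
    have "\<mu> (A \<union> B) = \<mu> (A \<union> (B - A))" by simp
    also have "\<dots> \<le> \<mu> A + \<mu> (B - A)" by (rule *) auto
    also have "\<dots> \<le> \<mu> A + \<mu> B" by (intro add_left_mono mono) auto
    finally show ?thesis .
  qed
  have subU: "\<mu> (\<Union>i. A i) \<le> (\<Sum>i. \<mu> (A i))" for A :: "nat \<Rightarrow> 'a set"
  proof -
    have "\<mu> (\<Union>i. disjointed A i) \<le> (\<Sum>i. \<mu> (disjointed A i))"
      using csub(1) disjoint_family_disjointed[of A] by (auto simp: countably_subadditive_def)
    also have "\<dots> \<le> (\<Sum>i. \<mu> (A i))"
      by (intro suminf_le mono disjointed_subset) auto
    finally show ?thesis by (simp add: UN_disjointed_eq)
  qed
  have closed: "E \<in> lambda_system UNIV (Pow UNIV) \<mu>" if E: "closed E" for E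
  proof (cases "E = {}")
    case True then show ?thesis by (auto simp: lambda_system_def \<mu>0)
  next
    case ne: False
    have "\<mu> (X \<inter> E) + \<mu> (X - E) \<le> \<mu> X" for X
    proof (cases "\<mu> X = \<infinity>")
      case fin: False
      \<comment> \<open>Caratheodory's criterion for metric outer measures. Each \<open>A k\<close>
        has positive distance from E, so additivity holds for \<open>A k\<close> and
        \<open>X \<inter> E\<close>; what remains is that \<open>A k\<close> exhausts X - E in
        measure. The rings \<open>D k\<close> measure the loss.\<close>
      define A where "A k = {x \<in> X. infdist x E \<ge> 1 / real (k + 1)}" for k
      define D where "D k = A (Suc k) - A k" for k
      have sep: "\<mu> S + \<mu> T \<le> \<mu> (S \<union> T)"
        if S: "\<And>x. x \<in> S \<Longrightarrow> infdist x E \<ge> a" and T: "\<And>x. x \<in> T \<Longrightarrow> infdist x E \<le> b" and "b < a" for S T a b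
      proof (rule metric[of "a - b"])
        fix x y assume "x \<in> S" "y \<in> T"
        then show "a - b \<le> dist x y"
          using S[of x] T[of y] infdist_triangle[of x E y] by simp
      qed (use that in auto)
      have Amono: "A i \<subseteq> A j" if "i \<le> j" for i j
      proof -
        have "1 / real (j+1) \<le> 1 / real (i+1)" using that by (intro divide_left_mono) auto
        then show ?thesis by (auto simp: A_def)
      qed
      have AX: "A i \<subseteq> X" for i by (auto simp: A_def)
      have DX: "D i \<subseteq> X" for i by (auto simp: A_def D_def)
      \<comment> \<open>Rings whose indices have the same parity are at positive distance from each
        other, so their measures add up to at most that of X. Treating even and odd indices
        separately makes the series of all rings converge.\<close>
      have part: "(\<Sum>j<m. \<mu> (D (2*j+i))) \<le> \<mu> (\<Union>j<m. D (2*j+i))" for m i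
      proof (induction m)
        case (Suc m)
        have "\<mu> (\<Union>j<m. D (2*j+i)) + \<mu> (D (2*m+i)) \<le> \<mu> ((\<Union>j<m. D (2*j+i)) \<union> D (2*m+i))"
        proof (cases "m = 0")
          case False
          show ?thesis
          proof (rule sep)
            fix x assume "x \<in> (\<Union>j<m. D (2*j+i))"
            then obtain j where "j < m" "x \<in> A (Suc (2*j+i))" by (auto simp: D_def)
            moreover have "A (Suc (2*j+i)) \<subseteq> A (2*m+i-1)" using \<open>j < m\<close> by (intro Amono) auto
            moreover have "2*m+i-1 + 1 = 2*m+i" using \<open>j < m\<close> by auto
            ultimately show "1 / real (2*m+i) \<le> infdist x E" unfolding A_def by force
          next
            fix x assume "x \<in> D (2*m+i)"
            then show "infdist x E \<le> 1 / real (2*m+i+1)" using DX by (force simp: D_def A_def)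
          qed (use False in \<open>auto intro!: divide_strict_left_mono\<close>)
        qed (simp add: \<mu>0)
        also have "(\<Union>j<m. D (2*j+i)) \<union> D (2*m+i) = (\<Union>j<Suc m. D (2*j+i))"
          by (auto simp: lessThan_Suc)
        finally show ?case using Suc by (simp add: order_trans[OF add_right_mono])
      qed (simp add: \<mu>0)
      have "(\<Sum>j<2*m. \<mu> (D j)) \<le> \<mu> X + \<mu> X" for m
      proof -
        have "(\<Sum>j<2*m. \<mu> (D j)) = (\<Sum>j<m. \<mu> (D (2*j+0))) + (\<Sum>j<m. \<mu> (D (2*j+1)))"
          by (induction m) (simp_all add: algebra_simps)
        also have "\<dots> \<le> \<mu> X + \<mu> X"
          by (intro add_mono order_trans[OF part] mono) (use DX in auto)
        finally show ?thesis .
      qed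
      moreover have "(\<Sum>j<m. \<mu> (D j)) \<le> (\<Sum>j<2*m. \<mu> (D j))" for m
        by (intro sum_mono2) auto
      ultimately have "(\<Sum>j<m. \<mu> (D j)) \<le> \<mu> X + \<mu> X" for m
        by (rule order_trans[rotated])
      then have "(\<Sum>j. \<mu> (D j)) \<le> \<mu> X + \<mu> X"
        by (intro suminf_le_const) auto
      then have sum_lt: "(\<Sum>j. \<mu> (D j)) < \<infinity>"
        using fin by (auto simp: less_top intro: order_le_less_trans)
      then have "\<mu> (D j) < \<infinity>" for j by (rule ennreal_suminf_lessD)
      then have "\<exists>g. \<forall>j. 0 \<le> g j \<and> \<mu> (D j) = ennreal (g j)"
        by (intro choice allI) (metis enn2real_nonneg ennreal_enn2real infinity_ennreal_def)
      then obtain g where g: "\<And>j. 0 \<le> g j" "\<And>j. \<mu> (D j) = ennreal (g j)" by blast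
      have sg: "summable g" using sum_lt g by (intro summable_suminf_not_top) auto
      \<comment> \<open>Because E is closed, every point of X - E has positive distance from it and
        lies in \<open>A k\<close> or in a later ring. The excess is thus the tail of a convergent
        series.\<close>
      have main: "\<mu> (X \<inter> E) + \<mu> (X - E) \<le> \<mu> X + ennreal (\<Sum>j. g (j + k))" for k
      proof -
        have "X - E \<subseteq> A k \<union> (\<Union>j. D (j + k))"
        proof
          fix x assume x: "x \<in> X - E"
          then have "infdist x E > 0"
            using E ne by (metis DiffD2 in_closed_iff_infdist_zero infdist_nonneg le_less)
          then obtain m where "1 / real (m + 1) < infdist x E"
            by (metis Suc_eq_plus1 nat_approx_posE)
          then have ex: "\<exists>m. x \<in> A m" using x by (auto simp: A_def intro!: exI[of _ m])
          define m where "m = (LEAST m. x \<in> A m)"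
          have m: "x \<in> A m" unfolding m_def using ex by (rule LeastI_ex)
          show "x \<in> A k \<union> (\<Union>j. D (j + k))"
          proof (cases "m \<le> k")
            case True then show ?thesis using m Amono by auto
          next
            case False
            then have "x \<notin> A (m - 1)" unfolding m_def by (intro not_less_Least) (auto simp: m_def)
            then have "x \<in> D ((m - 1 - k) + k)" using False m by (auto simp: D_def)
            then show ?thesis by blast
          qed
        qed
        then have "\<mu> (X - E) \<le> \<mu> (A k \<union> (\<Union>j. D (j + k)))" by (rule mono)
        also have "\<dots> \<le> \<mu> (A k) + \<mu> (\<Union>j. D (j + k))" by (rule sub2)
        also have "\<dots> \<le> \<mu> (A k) + (\<Sum>j. \<mu> (D (j + k)))" by (intro add_left_mono subU)
        also have "(\<Sum>j. \<mu> (D (j + k))) = ennreal (\<Sum>j. g (j + k))"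
          unfolding g(2) by (rule suminf_ennreal2) (use g sg in \<open>auto simp: summable_iff_shift\<close>)
        finally have "\<mu> (X \<inter> E) + \<mu> (X - E) \<le> \<mu> (A k) + \<mu> (X \<inter> E) + ennreal (\<Sum>j. g (j + k))"
          by (metis add.assoc add.commute add_left_mono)
        also have "\<mu> (A k) + \<mu> (X \<inter> E) \<le> \<mu> (A k \<union> (X \<inter> E))"
          by (rule sep[of _ "1 / real (k+1)" _ 0]) (auto simp: A_def)
        also have "\<dots> \<le> \<mu> X" by (rule mono) (use AX in auto)
        finally show ?thesis by (simp add: add_right_mono)
      qed
      have "(\<lambda>k. \<mu> X + ennreal (\<Sum>j. g (j + k))) \<longlonglongrightarrow> \<mu> X + ennreal 0"
        by (intro tendsto_add tendsto_const tendsto_ennrealI suminf_exist_split2 sg)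
      then show ?thesis
        using main by (intro LIMSEQ_le_const[of _ "\<mu> X"]) auto
    qed auto
    moreover have "\<mu> X \<le> \<mu> (X \<inter> E) + \<mu> (X - E)" for X
      using sub2[of "X \<inter> E" "X - E"] by (simp add: Un_Diff_Int Un_commute Int_Un_distrib)
    ultimately show ?thesis
      by (subst P.lambda_system_eq) (auto intro: antisym)
  qed
  interpret L: sigma_algebra UNIV "lambda_system UNIV (Pow UNIV) \<mu>"
    using P.caratheodory_lemma[OF om] by (simp add: measure_space_def)
  have "sets (sigma UNIV (Collect closed :: 'a set set)) \<subseteq> lambda_system UNIV (Pow UNIV) \<mu>"
    using closed L.sigma_sets_subset[of "Collect closed"] by auto
  then show ?thesis by (simp add: borel_eq_closed)
qed

section \<open>Covers at a fixed scale and the Hausdorff outer measure\<close>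

lemma hausdorff_pre_le:
  assumes "A \<subseteq> (\<Union>i. C i)" "\<And>i::nat. bounded (C i)" "\<And>i. diameter (C i) \<le> \<delta>"
  shows "hausdorff_pre s \<delta> A \<le> (\<Sum>i. ennreal (hausdorff_const s * (diameter (C i) / 2) powr s))"
  unfolding hausdorff_pre_def using assms by (intro INF_lower) auto

lemma hausdorff_pre_less:
  assumes "hausdorff_pre s \<delta> A < e"
  obtains C where "A \<subseteq> (\<Union>i. C i)" "\<And>i::nat. bounded (C i)" "\<And>i. diameter (C i) \<le> \<delta>"
    "(\<Sum>i. ennreal (hausdorff_const s * (diameter (C i) / 2) powr s)) < e"
  using assms unfolding hausdorff_pre_def INF_less_iff by auto

lemma hausdorff_pre_mono: "A \<subseteq> B \<Longrightarrow> hausdorff_pre s \<delta> A \<le> hausdorff_pre s \<delta> B"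
  unfolding hausdorff_pre_def by (intro INF_superset_mono) auto

lemma hausdorff_pre_antimono: "\<delta> \<le> \<delta>' \<Longrightarrow> hausdorff_pre s \<delta>' A \<le> hausdorff_pre s \<delta> A"
  unfolding hausdorff_pre_def by (intro INF_superset_mono) (auto intro: order_trans)

lemma hausdorff_pre_empty: "0 \<le> \<delta> \<Longrightarrow> hausdorff_pre s \<delta> {} = 0"
  using hausdorff_pre_le[of "{}" "\<lambda>_. {}" \<delta> s] by simp

lemma hausdorff_pre_UN:
  fixes A :: "nat \<Rightarrow> 'a::metric_space set"
  shows "hausdorff_pre s \<delta> (\<Union>i. A i) \<le> (\<Sum>i. hausdorff_pre s \<delta> (A i))"
proof (rule ennreal_le_epsilon)
  let ?f = "\<lambda>C::'a set. ennreal (hausdorff_const s * (diameter C / 2) powr s)"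
  let ?O = "hausdorff_pre s \<delta>"
  fix e :: real assume "0 < e" "(\<Sum>n. ?O (A n)) < top"
  then have *: "\<And>n. ?O (A n) < ?O (A n) + e * (1/2)^Suc n"
    by (auto simp add: less_top dest!: ennreal_suminf_lessD)
  have "\<exists>B. \<forall>n. A n \<subseteq> (\<Union>i. B n i) \<and> (\<forall>i::nat. bounded (B n i) \<and> diameter (B n i) \<le> \<delta>) \<and>
      (\<Sum>i. ?f (B n i)) \<le> ?O (A n) + e * (1/2)^Suc n"
    by (intro choice allI) (metis hausdorff_pre_less[OF *] less_imp_le)
  then obtain B where B: "\<And>n. A n \<subseteq> (\<Union>i. B n i)" "\<And>n i. bounded (B n i)" "\<And>n i. diameter (B n i) \<le> \<delta>"
      and Ble: "\<And>n. (\<Sum>i. ?f (B n i)) \<le> ?O (A n) + e * (1/2)^Suc n" by blast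
  define C where "C = case_prod B o prod_decode"
  have A_C: "(\<Union>i. A i) \<subseteq> (\<Union>i. C i)"
    using B(1) by (auto simp add: C_def subset_eq) (metis prod.case prod_encode_inverse)
  have "?O (\<Union>i. A i) \<le> (\<Sum>i. ?f (C i))"
    by (rule hausdorff_pre_le[OF A_C]) (auto simp: C_def B split: prod.splits)
  also have "\<dots> = (\<Sum>n. \<Sum>i. ?f (B n i))"
    unfolding C_def comp_def by (subst suminf_ennreal_2dimen[symmetric, of _ "\<lambda>x. ?f (case_prod B x)"]) auto
  also have "\<dots> \<le> (\<Sum>n. ?O (A n) + e * (1/2) ^ Suc n)"
    by (intro suminf_le allI Ble) auto
  also have "... = (\<Sum>n. ?O (A n)) + (\<Sum>n. ennreal e * ennreal ((1/2) ^ Suc n))"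
    using \<open>0 < e\<close> by (subst suminf_add[symmetric])
                     (auto simp del: ennreal_suminf_cmult simp add: ennreal_mult[symmetric])
  also have "\<dots> = (\<Sum>n. ?O (A n)) + e"
    unfolding ennreal_suminf_cmult
    by (subst suminf_ennreal_eq[OF zero_le_power power_half_series]) auto
  finally show "?O (\<Union>i. A i) \<le> (\<Sum>n. ?O (A n)) + e" .
qed

text \<open>A covering set of diameter below d cannot meet both A and B, so every cover of the union
  splits into a cover of A and a disjointly indexed cover of B.\<close>

lemma hausdorff_pre_separated:
  assumes d: "\<And>a b. a \<in> A \<Longrightarrow> b \<in> B \<Longrightarrow> d \<le> dist a b" and "\<delta> < d" "0 \<le> \<delta>"
  shows "hausdorff_pre s \<delta> A + hausdorff_pre s \<delta> B \<le> hausdorff_pre s \<delta> (A \<union> B)"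
proof (rule dense_ge)
  fix e assume "hausdorff_pre s \<delta> (A \<union> B) < e"
  then obtain C where C: "A \<union> B \<subseteq> (\<Union>i. C i)" "\<And>i::nat. bounded (C i)" "\<And>i. diameter (C i) \<le> \<delta>"
    "(\<Sum>i. ennreal (hausdorff_const s * (diameter (C i) / 2) powr s)) < e"
    by (rule hausdorff_pre_less) blast
  let ?f = "\<lambda>C::'a set. ennreal (hausdorff_const s * (diameter C / 2) powr s)"
  let ?A = "\<lambda>i. if C i \<inter> A = {} then {} else C i" and ?B = "\<lambda>i. if C i \<inter> B = {} then {} else C i"
  have "hausdorff_pre s \<delta> A \<le> (\<Sum>i. ?f (?A i))"
    using C \<open>0 \<le> \<delta>\<close> by (intro hausdorff_pre_le) (auto split: if_splits, blast?)
  moreover have "hausdorff_pre s \<delta> B \<le> (\<Sum>i. ?f (?B i))"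
    using C \<open>0 \<le> \<delta>\<close> by (intro hausdorff_pre_le) (auto split: if_splits, blast?)
  ultimately have "hausdorff_pre s \<delta> A + hausdorff_pre s \<delta> B \<le> (\<Sum>i. ?f (?A i)) + (\<Sum>i. ?f (?B i))"
    by (rule add_mono)
  also have "\<dots> = (\<Sum>i. ?f (?A i) + ?f (?B i))"
    by (intro suminf_add) auto
  also have "\<dots> \<le> (\<Sum>i. ?f (C i))"
  proof (intro suminf_le allI)
    fix i
    have "C i \<inter> A = {} \<or> C i \<inter> B = {}"
    proof (rule ccontr)
      assume "\<not> ?thesis"
      then obtain a b where "a \<in> C i" "b \<in> C i" "a \<in> A" "b \<in> B" by auto
      then show False using d[of a b] diameter_bounded_bound[OF C(2)[of i], of a b] C(3)[of i] \<open>\<delta> < d\<close> by linarith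
    qed
    then show "?f (?A i) + ?f (?B i) \<le> ?f (C i)" by auto
  qed auto
  finally show "hausdorff_pre s \<delta> A + hausdorff_pre s \<delta> B \<le> e" using C(4) by (rule order.trans[OF _ less_imp_le])
qed

lemma hausdorff_pre_le_outer: "0 < \<delta> \<Longrightarrow> hausdorff_pre s \<delta> A \<le> hausdorff_outer s A"
  unfolding hausdorff_outer_def by (intro SUP_upper) auto

lemma hausdorff_outer_le:
  "(\<And>\<delta>. 0 < \<delta> \<Longrightarrow> hausdorff_pre s \<delta> A \<le> c) \<Longrightarrow> hausdorff_outer s A \<le> c"
  unfolding hausdorff_outer_def by (intro SUP_least) auto

lemma hausdorff_outer_mono: "A \<subseteq> B \<Longrightarrow> hausdorff_outer s A \<le> hausdorff_outer s B"
  unfolding hausdorff_outer_def by (intro SUP_mono' hausdorff_pre_mono)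

lemma outer_measure_space_hausdorff: "outer_measure_space (Pow UNIV) (hausdorff_outer s)"
  unfolding outer_measure_space_def
proof (intro conjI)
  show "positive (Pow UNIV) (hausdorff_outer s)"
    by (auto simp: positive_def hausdorff_pre_empty intro!: antisym hausdorff_outer_le)
  show "increasing (Pow UNIV) (hausdorff_outer s)"
    by (auto simp: increasing_def hausdorff_outer_mono)
  show "countably_subadditive (Pow UNIV) (hausdorff_outer s)"
    unfolding countably_subadditive_def
  proof (intro allI impI)
    fix A :: "nat \<Rightarrow> _"
    show "hausdorff_outer s (\<Union>i. A i) \<le> (\<Sum>i. hausdorff_outer s (A i))"
    proof (rule hausdorff_outer_le)
      fix \<delta> :: real assume "0 < \<delta>"
      have "hausdorff_pre s \<delta> (\<Union>i. A i) \<le> (\<Sum>i. hausdorff_pre s \<delta> (A i))" by (rule hausdorff_pre_UN)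
      also have "\<dots> \<le> (\<Sum>i. hausdorff_outer s (A i))"
        by (intro suminf_le allI hausdorff_pre_le_outer \<open>0 < \<delta>\<close>) auto
      finally show "hausdorff_pre s \<delta> (\<Union>i. A i) \<le> \<dots>" .
    qed
  qed
qed

lemma hausdorff_outer_separated:
  assumes "0 < d" and d: "\<And>a b. a \<in> A \<Longrightarrow> b \<in> B \<Longrightarrow> d \<le> dist a b"
  shows "hausdorff_outer s A + hausdorff_outer s B \<le> hausdorff_outer s (A \<union> B)"
proof -
  have "hausdorff_pre s \<delta> A + hausdorff_pre s \<delta>' B \<le> hausdorff_outer s (A \<union> B)" if "0 < \<delta>" "0 < \<delta>'" for \<delta> \<delta>'
  proof -
    \<comment> \<open>A common scale finer than both given scales and finer than the separation. The
      two suprema are then taken one after the other.\<close>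
    define e where "e = min (min \<delta> \<delta>') (d/2)"
    have e: "e \<le> \<delta>" "e \<le> \<delta>'" "e < d" "0 < e" using \<open>0 < d\<close> that by (auto simp: e_def)
    have "hausdorff_pre s \<delta> A + hausdorff_pre s \<delta>' B \<le> hausdorff_pre s e A + hausdorff_pre s e B"
      using e by (intro add_mono hausdorff_pre_antimono)
    also have "\<dots> \<le> hausdorff_pre s e (A \<union> B)"
      using e d by (intro hausdorff_pre_separated[of _ _ d]) auto
    also have "\<dots> \<le> hausdorff_outer s (A \<union> B)" using e by (intro hausdorff_pre_le_outer)
    finally show ?thesis .
  qed
  then have "hausdorff_outer s A + hausdorff_pre s \<delta>' B \<le> hausdorff_outer s (A \<union> B)" if "0 < \<delta>'" for \<delta>'
    unfolding hausdorff_outer_def[of s A]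
    by (subst ennreal_SUP_add_left[symmetric]) (auto intro!: SUP_least that)
  then have "hausdorff_pre s \<delta>' B + hausdorff_outer s A \<le> hausdorff_outer s (A \<union> B)" if "0 < \<delta>'" for \<delta>'
    using that by (simp add: add.commute)
  then have "hausdorff_outer s B + hausdorff_outer s A \<le> hausdorff_outer s (A \<union> B)"
    unfolding hausdorff_outer_def[of s B]
    by (subst ennreal_SUP_add_left[symmetric]) (auto intro!: SUP_least)
  then show ?thesis by (simp add: add.commute)
qed

section \<open>Hausdorff measure on Borel sets and under Lipschitz maps\<close>

lemma sets_hausdorff_measure [simp, measurable_cong]: "sets (hausdorff_measure s) = sets borel"
  by (simp add: hausdorff_measure_def) (metis sets.sigma_sets_eq space_borel)

lemma space_hausdorff_measure [simp]: "space (hausdorff_measure s) = UNIV"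
  by (simp add: hausdorff_measure_def)

text \<open>\<open>measure_of\<close> returns the given set function only where it is countably
  additive. Caratheodory's theorem provides this on a sigma-algebra that contains the Borel sets,
  and from here on the measure can be computed by covers.\<close>

lemma emeasure_hausdorff_measure:
  assumes "A \<in> sets borel"
  shows "emeasure (hausdorff_measure s) A = hausdorff_outer s A"
proof -
  interpret P: sigma_algebra UNIV "Pow UNIV :: 'a set set" by (rule sigma_algebra_Pow)
  have "measure_space UNIV (lambda_system UNIV (Pow UNIV) (hausdorff_outer s)) (hausdorff_outer s :: 'a set \<Rightarrow> _)"
    by (rule P.caratheodory_lemma) (rule outer_measure_space_hausdorff)
  moreover have "sets borel \<subseteq> lambda_system UNIV (Pow UNIV) (hausdorff_outer s :: 'a set \<Rightarrow> _)"
    by (intro borel_subset_lambda_system outer_measure_space_hausdorff hausdorff_outer_separated)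
  moreover have "sigma_algebra UNIV (sets borel :: 'a set set)"
    by (metis sets.sigma_algebra_axioms space_borel)
  ultimately have "measure_space UNIV (sets borel) (hausdorff_outer s :: 'a set \<Rightarrow> _)"
    by (blast intro: measure_down)
  then show ?thesis
    unfolding hausdorff_measure_def
    by (intro emeasure_measure_of_sigma) (auto simp: measure_space_def assms)
qed

lemma hausdorff_const_pos: "0 \<le> s \<Longrightarrow> 0 < hausdorff_const s"
  unfolding hausdorff_const_def by (intro divide_pos_pos Gamma_real_pos) auto

text \<open>A cover of A at scale \<delta> / L, intersected with A and mapped by T, is a cover of
  the image at scale \<delta>, and each summand grows by at most the factor
  \<open>L powr s\<close>.\<close>

lemma hausdorff_outer_Lipschitz_image:
  assumes L: "0 < L" and T: "\<And>x y. x \<in> A \<Longrightarrow> y \<in> A \<Longrightarrow> dist (T x) (T y) \<le> L * dist x y" and "0 \<le> s"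
  shows "hausdorff_outer s (T ` A) \<le> ennreal (L powr s) * hausdorff_outer s A"
proof (rule hausdorff_outer_le)
  fix \<delta> :: real assume "0 < \<delta>"
  let ?f = "\<lambda>C. ennreal (hausdorff_const s * (diameter C / 2) powr s)"
  have "hausdorff_pre s \<delta> (T ` A) \<le> ennreal (L powr s) * hausdorff_pre s (\<delta> / L) A"
  proof -
    have "hausdorff_pre s \<delta> (T ` A) / ennreal (L powr s) \<le> hausdorff_pre s (\<delta> / L) A"
    proof (rule dense_ge)
      fix e assume "hausdorff_pre s (\<delta> / L) A < e"
      then obtain C where C: "A \<subseteq> (\<Union>i. C i)" "\<And>i::nat. bounded (C i)" "\<And>i. diameter (C i) \<le> \<delta> / L"
        "(\<Sum>i. ?f (C i)) < e"
        by (rule hausdorff_pre_less) blast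
      have TC: "dist (T x) (T y) \<le> L * diameter (C i)" if "x \<in> C i" "y \<in> C i" "x \<in> A" "y \<in> A" for x y i
        using T[OF that(3,4)] diameter_bounded_bound[OF C(2) that(1,2)] L
        by (meson mult_left_mono order_trans less_imp_le)
      have bd: "bounded (T ` (C i \<inter> A))" for i
        unfolding bounded_two_points using TC by blast
      have diam: "diameter (T ` (C i \<inter> A)) \<le> L * diameter (C i)" for i
      proof (cases "C i \<inter> A = {}")
        case True then show ?thesis using diameter_ge_0[OF C(2)[of i]] L by simp
      next
        case False
        then have "(SUP (x, y)\<in>T ` (C i \<inter> A) \<times> T ` (C i \<inter> A). dist x y) \<le> L * diameter (C i)"
          by (intro cSUP_least) (auto intro: TC)
        then show ?thesis using False by (simp add: diameter_def[of "T ` (C i \<inter> A)"])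
      qed
      have "hausdorff_pre s \<delta> (T ` A) \<le> (\<Sum>i. ?f (T ` (C i \<inter> A)))"
      proof (rule hausdorff_pre_le)
        show "T ` A \<subseteq> (\<Union>i. T ` (C i \<inter> A))" using C(1) by blast
        show "diameter (T ` (C i \<inter> A)) \<le> \<delta>" for i
          using diam[of i] C(3)[of i] L by (simp add: field_simps)
      qed (use C bd in auto)
      also have "\<dots> \<le> (\<Sum>i. ennreal (L powr s) * ?f (C i))"
      proof (intro suminf_le allI)
        fix i
        have "hausdorff_const s * (diameter (T ` (C i \<inter> A)) / 2) powr s \<le> hausdorff_const s * (L * diameter (C i) / 2) powr s"
          using diam[of i] bd[of i] hausdorff_const_pos[OF \<open>0 \<le> s\<close>] diameter_ge_0[OF bd]
          by (intro mult_left_mono powr_mono2 \<open>0 \<le> s\<close>) auto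
        also have "\<dots> = L powr s * (hausdorff_const s * (diameter (C i) / 2) powr s)"
          using L diameter_ge_0[OF C(2)[of i]] by (simp add: powr_mult[symmetric] mult_ac)
        finally show "?f (T ` (C i \<inter> A)) \<le> ennreal (L powr s) * ?f (C i)"
          using hausdorff_const_pos[OF \<open>0 \<le> s\<close>] by (simp add: ennreal_mult[symmetric] ennreal_leI)
      qed auto
      also have "\<dots> = ennreal (L powr s) * (\<Sum>i. ?f (C i))" by simp
      also have "\<dots> \<le> ennreal (L powr s) * e" using C(4) by (intro mult_left_mono) auto
      finally show "hausdorff_pre s \<delta> (T ` A) / ennreal (L powr s) \<le> e"
        using L by (intro divide_le_posI_ennreal) (auto simp: mult.commute)
    qed
    then have "ennreal (L powr s) * (hausdorff_pre s \<delta> (T ` A) / ennreal (L powr s)) \<le> ennreal (L powr s) * hausdorff_pre s (\<delta> / L) A"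
      by (rule mult_left_mono) simp
    moreover have "ennreal (L powr s) \<noteq> 0" "ennreal (L powr s) \<noteq> top" using L by auto
    ultimately show ?thesis by (metis ennreal_times_divide mult.commute mult_divide_eq_ennreal)
  qed
  also have "\<dots> \<le> ennreal (L powr s) * hausdorff_outer s A"
    using \<open>0 < \<delta>\<close> L by (intro mult_left_mono hausdorff_pre_le_outer) auto
  finally show "hausdorff_pre s \<delta> (T ` A) \<le> ennreal (L powr s) * hausdorff_outer s A" .
qed

section \<open>Slicing Lebesgue measure by hyperplanes\<close>

lemma hausdorff_outer_isometry:
  assumes T: "\<And>x y. x \<in> A \<Longrightarrow> y \<in> A \<Longrightarrow> dist (T x) (T y) = dist x y" and s: "0 \<le> s"
  shows "hausdorff_outer s (T ` A) = hausdorff_outer s A"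
proof (rule antisym)
  show "hausdorff_outer s (T ` A) \<le> hausdorff_outer s A"
    using hausdorff_outer_Lipschitz_image[of 1 A T s] T s by simp
  have inj: "inj_on T A" using T by (auto simp: inj_on_def) (metis dist_eq_0_iff)
  have "hausdorff_outer s (inv_into A T ` (T ` A)) \<le> hausdorff_outer s (T ` A)"
  proof -
    have "hausdorff_outer s (inv_into A T ` (T ` A)) \<le> ennreal (1 powr s) * hausdorff_outer s (T ` A)"
      by (rule hausdorff_outer_Lipschitz_image) (use inj T s in auto)
    then show ?thesis by simp
  qed
  then show "hausdorff_outer s A \<le> hausdorff_outer s (T ` A)"
    using inj by (simp add: inv_into_image_cancel)
qed

text \<open>The uniqueness argument for Haar measure: the double integral of
  \<open>indicator A x * indicator ?B (- x + y)\<close> against M and Lebesgue measure is evaluated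
  in both orders. Integrating over y first gives one side of the identity; shifting x by y first
  gives the other, with the ball reproduced because it is symmetric.\<close>

lemma translation_invariant_measure_unique:
  fixes M :: "'a::euclidean_space measure"
  assumes sets[measurable_cong]: "sets M = sets borel" and "sigma_finite_measure M"
    and inv: "\<And>z. distr M borel ((+) z) = M" and A[measurable]: "A \<in> sets borel"
  shows "emeasure M A * emeasure lborel (ball 0 1 :: 'a set) = emeasure lborel A * emeasure M (ball 0 1)"
proof -
  interpret M: sigma_finite_measure M by fact
  interpret P: pair_sigma_finite M lborel ..
  let ?B = "ball 0 1 :: 'a set"
  have [measurable]: "?B \<in> sets borel" by simp
  have lb: "(\<integral>\<^sup>+y. f (x + y) \<partial>lborel) = (\<integral>\<^sup>+y. f y \<partial>lborel)" if [measurable]: "f \<in> borel_measurable borel" for f :: "'a \<Rightarrow> ennreal" and x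
    by (subst lborel_distr_plus[of x, symmetric], subst nn_integral_distr) auto
  have Mb: "(\<integral>\<^sup>+y. f (x + y) \<partial>M) = (\<integral>\<^sup>+y. f y \<partial>M)" if [measurable]: "f \<in> borel_measurable borel" for f :: "'a \<Rightarrow> ennreal" and x
    by (subst inv[of x, symmetric], subst nn_integral_distr) auto
  have "emeasure M A * emeasure lborel ?B = (\<integral>\<^sup>+x. indicator A x * (\<integral>\<^sup>+y. indicator ?B (- x + y) \<partial>lborel) \<partial>M)"
    by (subst lb) (auto simp: nn_integral_multc sets intro!: borel_measurable_indicator)
  also have "\<dots> = (\<integral>\<^sup>+x. (\<integral>\<^sup>+y. indicator A x * indicator ?B (- x + y) \<partial>lborel) \<partial>M)"
    by (intro nn_integral_cong nn_integral_cmult[symmetric]) measurable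
  also have "\<dots> = (\<integral>\<^sup>+y. (\<integral>\<^sup>+x. indicator A x * indicator ?B (- x + y) \<partial>M) \<partial>lborel)"
    by (rule P.Fubini'[symmetric]) measurable
  also have "\<dots> = (\<integral>\<^sup>+y. (\<integral>\<^sup>+x. indicator A (y + x) * indicator ?B (- x) \<partial>M) \<partial>lborel)"
  \<comment> \<open>Invariance of M moves the variable y from the ball to A, so that the next
    exchange of integrals isolates the Lebesgue measure of A.\<close>
  proof (rule nn_integral_cong)
    fix y :: 'a
    show "(\<integral>\<^sup>+x. indicator A x * indicator ?B (- x + y) \<partial>M) = (\<integral>\<^sup>+x. indicator A (y + x) * indicator ?B (- x) \<partial>M)"
      using Mb[of "\<lambda>x. indicator A x * indicator ?B (- x + y)" y] by (simp add: algebra_simps)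
  qed
  also have "\<dots> = (\<integral>\<^sup>+x. (\<integral>\<^sup>+y. indicator A (y + x) * indicator ?B (- x) \<partial>lborel) \<partial>M)"
    by (rule P.Fubini') measurable
  also have "\<dots> = (\<integral>\<^sup>+x. (\<integral>\<^sup>+y. indicator A (x + y) \<partial>lborel) * indicator ?B (- x) \<partial>M)"
    by (intro nn_integral_cong) (simp add: nn_integral_multc add.commute)
  also have "\<dots> = (\<integral>\<^sup>+x. emeasure lborel A * indicator ?B x \<partial>M)"
    by (subst lb) (auto intro!: nn_integral_cong split: split_indicator)
  also have "\<dots> = emeasure lborel A * emeasure M ?B"
    by (subst nn_integral_cmult) (auto simp: sets)
  finally show ?thesis .
qed

section \<open>Hyperplanes and the reflections that exchange them\<close>

definition hyperplane :: "'a::euclidean_space \<Rightarrow> 'a set" where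
  "hyperplane e = {y. y \<bullet> e = 0}"

lemma closed_hyperplane_zero [simp]: "closed (hyperplane e)"
  unfolding hyperplane_def inner_commute[of _ e] by (rule closed_hyperplane)

lemma sets_hyperplane [measurable, simp]: "hyperplane e \<in> sets borel"
  by simp

text \<open>The orthogonal reflection in the hyperplane perpendicular to e - e', which exchanges
  unit vectors e and e'. For e = e' the convention on division by zero turns it into the
  identity.\<close>

definition reflect :: "'a::euclidean_space \<Rightarrow> 'a \<Rightarrow> 'a \<Rightarrow> 'a" where
  "reflect e e' x = x - (2 * (x \<bullet> (e - e')) / ((e - e') \<bullet> (e - e'))) *\<^sub>R (e - e')"

lemma linear_reflect: "linear (reflect e e')"
proof -
  define w where "w = e - e'"
  show ?thesis
    unfolding reflect_def w_def[symmetric]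
    by (intro linearI) (simp_all add: inner_add_left algebra_simps add_divide_distrib)
qed

lemma reflect_inner: "reflect e e' x \<bullet> reflect e e' y = x \<bullet> y"
proof (cases "e = e'")
  case False
  define w where "w = e - e'"
  have w: "w \<bullet> w \<noteq> 0" using False by (simp add: w_def)
  show ?thesis unfolding reflect_def w_def[symmetric]
    using w by (simp add: inner_diff_left inner_diff_right inner_commute field_simps)
qed (simp add: reflect_def)

lemma norm_reflect: "norm (reflect e e' x) = norm x"
  by (simp add: norm_eq_sqrt_inner reflect_inner)

lemma reflect_reflect: "reflect e e' (reflect e e' x) = x"
proof (cases "e = e'")
  case False
  define w where "w = e - e'"
  have w: "w \<bullet> w \<noteq> 0" using False by (simp add: w_def)
  show ?thesis unfolding reflect_def w_def[symmetric]
    using w by (simp add: inner_diff_left algebra_simps)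
qed (simp add: reflect_def)

lemma reflect_unit:
  assumes "norm e = 1" "norm e' = 1"
  shows "reflect e e' e = e'"
proof (cases "e = e'")
  case False
  have 1: "e \<bullet> e = 1" "e' \<bullet> e' = 1" using assms by (simp_all add: norm_eq_1)
  have "(e - e') \<bullet> (e - e') \<noteq> 0" using False by simp
  moreover have "(e - e') \<bullet> (e - e') = 2 * (e \<bullet> (e - e'))"
    using 1 by (simp add: inner_diff_left inner_diff_right inner_commute)
  ultimately show ?thesis by (simp add: reflect_def)
qed (simp add: reflect_def)

lemma reflect_hyperplane:
  assumes "norm e = 1" "norm e' = 1"
  shows "reflect e e' x \<in> hyperplane e' \<longleftrightarrow> x \<in> hyperplane e"
  using reflect_inner[of e e' x e] by (simp add: hyperplane_def reflect_unit[OF assms])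

section \<open>Finiteness and positivity for coordinate hyperplanes\<close>

lemma hausdorff_pre_single:
  assumes "bounded C" "diameter C \<le> \<delta>"
  shows "hausdorff_pre s \<delta> C \<le> ennreal (hausdorff_const s * (diameter C / 2) powr s)"
proof -
  have "0 \<le> \<delta>" using diameter_ge_0[OF assms(1)] assms(2) by linarith
  then have "hausdorff_pre s \<delta> C \<le> (\<Sum>i::nat. ennreal (hausdorff_const s * (diameter (if i = 0 then C else {}) / 2) powr s))"
    using assms by (intro hausdorff_pre_le) auto
  also have "\<dots> = (\<Sum>i\<in>{0::nat}. ennreal (hausdorff_const s * (diameter (if i = 0 then C else {}) / 2) powr s))"
    by (rule suminf_finite) auto
  finally show ?thesis by simp
qed

lemma hausdorff_pre_finite_UN:
  assumes "finite I" "0 \<le> \<delta>"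
  shows "hausdorff_pre s \<delta> (\<Union>i\<in>I. C i) \<le> (\<Sum>i\<in>I. hausdorff_pre s \<delta> (C i))"
  using assms(1)
proof induction
  case (insert j I)
  have "hausdorff_pre s \<delta> (A \<union> B) \<le> hausdorff_pre s \<delta> A + hausdorff_pre s \<delta> B" for A B :: "'b set"
  proof -
    have "hausdorff_pre s \<delta> (\<Union>i. binaryset A B i) \<le> (\<Sum>i. hausdorff_pre s \<delta> (binaryset A B i))"
      by (rule hausdorff_pre_UN)
    also have "\<dots> = hausdorff_pre s \<delta> A + hausdorff_pre s \<delta> B"
      by (rule suminf_binaryset_eq) (simp add: hausdorff_pre_empty assms)
    finally show ?thesis by (simp add: UN_binaryset_eq)
  qed
  from order_trans[OF this[of "C j" "\<Union>i\<in>I. C i"] add_left_mono[OF insert.IH]] show ?case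
    using insert.hyps by simp
qed (simp add: hausdorff_pre_empty assms)

text \<open>The disc is covered by a grid of cubes with k cells per direction. The resulting cover
  sum does not depend on k, hence it bounds the measure at every scale.\<close>

lemma hausdorff_outer_coordinate_plane_finite:
  fixes b :: "'a::euclidean_space"
  assumes b: "b \<in> Basis" and r: "0 < r"
  shows "hausdorff_outer (real (DIM('a) - 1)) (hyperplane b \<inter> ball 0 r) < \<infinity>"
proof -
  define m where "m = DIM('a) - 1"
  define s where "s = real m"
  \<comment> \<open>There are k ^ m cells of diameter at most 2 m r / k, so each contributes the
    constant times (m r / k) ^ m and the powers of k cancel.\<close>
  define K where "K = hausdorff_const s * (real m * r) powr s"
  have cardB: "card (Basis - {b}) = m" using b by (simp add: m_def card_Diff_singleton)
  have "hausdorff_outer s (hyperplane b \<inter> ball 0 r) \<le> ennreal K"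
  proof (rule hausdorff_outer_le)
    fix \<delta> :: real assume "0 < \<delta>"
    obtain k :: nat where k: "real m * (2 * r) / \<delta> < real k" "0 < k"
    proof -
      obtain k :: nat where "real m * (2 * r) / \<delta> < real k" using reals_Archimedean2 by blast
      then show ?thesis using that[of "Suc k"] by simp
    qed
    define c where "c f i = - r + 2 * r * real (f i) / real k" for f :: "'a \<Rightarrow> nat" and i
    define C where "C f = {y. y \<bullet> b = 0 \<and> (\<forall>i\<in>Basis - {b}. c f i \<le> y \<bullet> i \<and> y \<bullet> i \<le> c f i + 2 * r / k)}" for f
    define I where "I = (\<Pi>\<^sub>E i\<in>Basis - {b}. {..<k})"
    have finI: "finite I" unfolding I_def by (intro finite_PiE) auto
    have cardI: "card I = k ^ m" unfolding I_def by (simp add: card_PiE cardB)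
    have dC: "norm (x - y) \<le> real m * (2 * r / k)" if "x \<in> C f" "y \<in> C f" for x y f
    proof -
      have "norm (x - y) \<le> (\<Sum>i\<in>Basis. \<bar>(x - y) \<bullet> i\<bar>)" by (rule norm_le_l1)
      also have "\<dots> = (\<Sum>i\<in>Basis - {b}. \<bar>(x - y) \<bullet> i\<bar>)"
        using that b by (subst sum.remove[of _ b]) (auto simp: C_def inner_diff_left)
      also have "\<dots> \<le> (\<Sum>i\<in>Basis - {b}. 2 * r / k)"
      proof (intro sum_mono)
        fix i assume "i \<in> Basis - {b}"
        then have "c f i \<le> x \<bullet> i \<and> x \<bullet> i \<le> c f i + 2 * r / k" "c f i \<le> y \<bullet> i \<and> y \<bullet> i \<le> c f i + 2 * r / k"
          using that unfolding C_def by blast+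
        then show "\<bar>(x - y) \<bullet> i\<bar> \<le> 2 * r / k" by (simp add: inner_diff_left abs_le_iff)
      qed
      finally show ?thesis by (simp add: cardB)
    qed
    have bC: "bounded (C f)" for f unfolding bounded_two_points dist_norm using dC by blast
    have dmC: "diameter (C f) \<le> real m * (2 * r / k)" for f
      by (rule diameter_le) (use dC r in auto)
    have dmd: "real m * (2 * r / k) \<le> \<delta>" using k \<open>0 < \<delta>\<close> by (simp add: field_simps)
    have "hyperplane b \<inter> ball 0 r \<subseteq> (\<Union>f\<in>I. C f)"
    proof
      fix y assume y: "y \<in> hyperplane b \<inter> ball 0 r"
      define f where "f = restrict (\<lambda>i. nat \<lfloor>(y \<bullet> i + r) * k / (2 * r)\<rfloor>) (Basis - {b})"
      have yi: "- r < y \<bullet> i \<and> y \<bullet> i < r" if "i \<in> Basis" for i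
        using Basis_le_norm[OF that, of y] y by auto
      have fl: "real (f i) \<le> (y \<bullet> i + r) * k / (2 * r)" "(y \<bullet> i + r) * k / (2 * r) < real (f i) + 1" "f i < k"
        if "i \<in> Basis - {b}" for i
      proof -
        have *: "0 \<le> (y \<bullet> i + r) * k / (2 * r)" using yi[of i] that r by auto
        have fi: "real (f i) = of_int \<lfloor>(y \<bullet> i + r) * k / (2 * r)\<rfloor>" using * that by (simp add: f_def)
        show "real (f i) \<le> (y \<bullet> i + r) * k / (2 * r)" "(y \<bullet> i + r) * k / (2 * r) < real (f i) + 1"
          unfolding fi by linarith+
        have "(y \<bullet> i + r) * k / (2 * r) < k" using yi[of i] that r k by (simp add: field_simps)
        then show "f i < k" using fi by linarith
      qed
      have "f \<in> I" unfolding I_def using fl by (auto simp: f_def)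
      moreover have "y \<in> C f"
      proof -
        have "c f i \<le> y \<bullet> i \<and> y \<bullet> i \<le> c f i + 2 * r / k" if "i \<in> Basis - {b}" for i
          using fl(1,2)[OF that] r k by (simp add: c_def field_simps)
        then show ?thesis using y by (simp add: C_def hyperplane_def)
      qed
      ultimately show "y \<in> (\<Union>f\<in>I. C f)" by blast
    qed
    then have "hausdorff_pre s \<delta> (hyperplane b \<inter> ball 0 r) \<le> hausdorff_pre s \<delta> (\<Union>f\<in>I. C f)"
      by (rule hausdorff_pre_mono)
    also have "\<dots> \<le> (\<Sum>f\<in>I. hausdorff_pre s \<delta> (C f))"
      using finI \<open>0 < \<delta>\<close> by (intro hausdorff_pre_finite_UN) auto
    also have "\<dots> \<le> (\<Sum>f\<in>I. ennreal (hausdorff_const s * (real m * r / k) powr s))"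
    proof (intro sum_mono)
      fix f
      have "hausdorff_pre s \<delta> (C f) \<le> ennreal (hausdorff_const s * (diameter (C f) / 2) powr s)"
        using bC dmC dmd by (intro hausdorff_pre_single) (auto intro: order_trans)
      also have "\<dots> \<le> ennreal (hausdorff_const s * (real m * r / k) powr s)"
        using dmC[of f] diameter_ge_0[OF bC[of f]] hausdorff_const_pos[of s]
        by (intro ennreal_leI mult_left_mono powr_mono2) (auto simp: s_def mult_ac)
      finally show "hausdorff_pre s \<delta> (C f) \<le> \<dots>" .
    qed
    also have "\<dots> = ennreal (real (k ^ m) * (hausdorff_const s * (real m * r / k) powr s))"
      using hausdorff_const_pos[of s] by (simp only: sum_constant cardI ennreal_of_nat_eq_real_of_nat) (subst ennreal_mult, auto simp: s_def)
    also have "real (k ^ m) * (hausdorff_const s * (real m * r / k) powr s) = K"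
      using k r by (simp add: K_def s_def powr_divide powr_realpow)
    finally show "hausdorff_pre s \<delta> (hyperplane b \<inter> ball 0 r) \<le> ennreal K" .
  qed
  then show ?thesis unfolding s_def m_def by (auto intro: order_le_less_trans)
qed

text \<open>Every cover of the unit face, thickened to unit length in direction b, yields boxes that
  cover the unit cube. Comparing volumes bounds the cover sum away from zero.\<close>

lemma hausdorff_outer_coordinate_plane_pos:
  fixes b :: "'a::euclidean_space"
  assumes b: "b \<in> Basis" and dim: "2 \<le> DIM('a)"
  shows "0 < hausdorff_outer (real (DIM('a) - 1)) {y \<in> hyperplane b. \<forall>i\<in>Basis. 0 \<le> y \<bullet> i \<and> y \<bullet> i \<le> 1}"
    (is "0 < hausdorff_outer _ ?Q")
proof -
  define m where "m = DIM('a) - 1"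
  define s where "s = real m"
  have m: "0 < m" using dim by (simp add: m_def)
  have cardB: "card (Basis - {b}) = m" using b by (simp add: m_def card_Diff_singleton)
  \<comment> \<open>A set of diameter d is enclosed in a box with m sides of length 2 d and one of
    length 1; its volume (2 d) ^ m equals 4 ^ m times (d / 2) ^ m.\<close>
  define \<kappa> where "\<kappa> = 4 ^ m / hausdorff_const s"
  have hc: "0 < hausdorff_const s" by (simp add: hausdorff_const_pos s_def)
  have "1 \<le> ennreal \<kappa> * e" if e: "hausdorff_pre s 1 ?Q < e" for e
  proof -
    obtain C where C: "?Q \<subseteq> (\<Union>i. C i)" "\<And>i::nat. bounded (C i)"
      "(\<Sum>i. ennreal (hausdorff_const s * (diameter (C i) / 2) powr s)) < e"
      using e by (rule hausdorff_pre_less) blast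
    define d where "d i = diameter (C i)" for i
    have d0: "0 \<le> d i" for i using diameter_ge_0[OF C(2)] by (simp add: d_def)
    define a where "a i = (SOME x. x \<in> C i \<inter> ?Q)" for i
    define l where "l i = (\<Sum>j\<in>Basis. (if j = b then 0 else a i \<bullet> j - d i) *\<^sub>R j)" for i
    define u where "u i = (\<Sum>j\<in>Basis. (if j = b then 1 else a i \<bullet> j + d i) *\<^sub>R j)" for i
    have "cbox 0 One \<subseteq> (\<Union>i. cbox (l i) (u i))"
    proof
      fix x :: 'a assume x: "x \<in> cbox 0 One"
      define y where "y = x - (x \<bullet> b) *\<^sub>R b"
      have yj: "y \<bullet> j = (if j = b then 0 else x \<bullet> j)" if "j \<in> Basis" for j
        using that b by (auto simp: y_def inner_diff_left inner_Basis)
      have "y \<in> ?Q" using x yj b by (auto simp: hyperplane_def cbox_def)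
      then obtain i where i: "y \<in> C i" using C(1) by blast
      then have ai: "a i \<in> C i \<inter> ?Q" using \<open>y \<in> ?Q\<close> unfolding a_def
        by (metis (no_types, lifting) IntI someI)
      have "x \<in> cbox (l i) (u i)"
      proof -
        have "\<bar>x \<bullet> j - a i \<bullet> j\<bar> \<le> d i" if "j \<in> Basis" "j \<noteq> b" for j
        proof -
          have "\<bar>(y - a i) \<bullet> j\<bar> \<le> norm (y - a i)" by (rule Basis_le_norm) fact
          also have "\<dots> \<le> d i" unfolding d_def dist_norm[symmetric]
            using C(2) i ai by (intro diameter_bounded_bound) auto
          finally show ?thesis using yj that by (simp add: inner_diff_left)
        qed
        then show ?thesis using x b
          by (auto simp: cbox_def l_def u_def abs_le_iff) (smt (verit) inner_sum_left_Basis)+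
      qed
      then show "x \<in> (\<Union>i. cbox (l i) (u i))" by blast
    qed
    then have "emeasure lborel (cbox 0 One :: 'a set) \<le> emeasure lborel (\<Union>i. cbox (l i) (u i))"
      by (intro emeasure_mono) auto
    also have "\<dots> \<le> (\<Sum>i. emeasure lborel (cbox (l i) (u i)))"
      by (intro emeasure_subadditive_countably) auto
    also have "\<dots> = (\<Sum>i. ennreal ((2 * d i) ^ m))"
    proof (intro suminf_cong)
      fix i
      have "(\<Prod>j\<in>Basis. (u i - l i) \<bullet> j) = (\<Prod>j\<in>Basis. if j = b then 1 else 2 * d i)"
        by (intro prod.cong) (auto simp: l_def u_def inner_diff_left)
      also have "\<dots> = (\<Prod>j\<in>Basis - {b}. 2 * d i)"
        using b by (subst prod.remove[of _ b]) (auto intro!: prod.cong)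
      finally have "(\<Prod>j\<in>Basis. (u i - l i) \<bullet> j) = (2 * d i) ^ m" by (simp add: cardB)
      moreover have "l i \<bullet> j \<le> u i \<bullet> j" if "j \<in> Basis" for j
        using that d0[of i] by (simp add: l_def u_def)
      ultimately show "emeasure lborel (cbox (l i) (u i)) = ennreal ((2 * d i) ^ m)"
        by simp
    qed
    also have "\<dots> = (\<Sum>i. ennreal \<kappa> * ennreal (hausdorff_const s * (d i / 2) powr s))"
    proof (intro suminf_cong)
      fix i
      \<comment> \<open>For \<open>d i = 0\<close> both sides are 0 because m is positive. In
        dimension one they would differ, as \<open>0 powr 0 = 0\<close> whereas
        \<open>0 ^ 0 = 1\<close>.\<close>
      have "(d i / 2) powr s = (d i / 2) ^ m"
        using d0[of i] m by (cases "d i = 0") (auto simp: s_def powr_realpow)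
      then have "(2 * d i) ^ m = \<kappa> * (hausdorff_const s * (d i / 2) powr s)"
        using hc power_mult_distrib[of 4 "d i / 2" m] by (simp add: \<kappa>_def)
      then show "ennreal ((2 * d i) ^ m) = ennreal \<kappa> * ennreal (hausdorff_const s * (d i / 2) powr s)"
        using hc by (simp add: ennreal_mult[symmetric] \<kappa>_def)
    qed
    also have "\<dots> \<le> ennreal \<kappa> * e"
      using C(3) by (simp add: d_def mult_left_mono less_imp_le)
    finally show ?thesis by simp
  qed
  then have "hausdorff_pre s 1 ?Q \<noteq> 0"
    using hc
  proof (intro notI)
    assume *: "\<And>e. hausdorff_pre s 1 ?Q < e \<Longrightarrow> 1 \<le> ennreal \<kappa> * e" and 0: "hausdorff_pre s 1 ?Q = 0"
    have k: "0 < \<kappa>" using hc by (simp add: \<kappa>_def)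
    have "1 \<le> ennreal \<kappa> * ennreal (1 / (2 * \<kappa>))" by (rule *) (use k 0 in simp)
    also have "\<dots> = ennreal (1/2)" using k by (simp add: ennreal_mult[symmetric])
    also have "\<dots> < ennreal 1" by (rule ennreal_lessI) auto
    finally show False by simp
  qed
  then have "0 < hausdorff_pre s 1 ?Q" by (simp add: zero_less_iff_neq_zero)
  also have "\<dots> \<le> hausdorff_outer s ?Q" by (rule hausdorff_pre_le_outer) simp
  finally show ?thesis by (simp add: s_def m_def)
qed

section \<open>Sweeping a hyperplane along its normal\<close>

definition hyperplane_measure :: "'a::euclidean_space \<Rightarrow> 'a measure" where
  "hyperplane_measure e = restrict_space (hausdorff_measure (real (DIM('a) - 1))) (hyperplane e)"

lemma space_hyperplane_measure [simp]: "space (hyperplane_measure e) = hyperplane e"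
  by (simp add: hyperplane_measure_def space_restrict_space)

lemma sets_hyperplane_measure [measurable_cong]:
  "sets (hyperplane_measure e) = sets (restrict_space borel (hyperplane e))"
  by (simp add: hyperplane_measure_def sets_restrict_space)

lemma emeasure_hyperplane_measure:
  fixes e :: "'a::euclidean_space"
  assumes "A \<in> sets borel"
  shows "emeasure (hyperplane_measure e) (hyperplane e \<inter> A) = hausdorff_outer (real (DIM('a) - 1)) (hyperplane e \<inter> A)"
  using assms by (simp add: hyperplane_measure_def emeasure_restrict_space emeasure_hausdorff_measure sets.Int)

lemma emeasure_hyperplane_measure_sets:
  fixes e :: "'a::euclidean_space"
  assumes "A \<in> sets (hyperplane_measure e)"
  shows "emeasure (hyperplane_measure e) A = hausdorff_outer (real (DIM('a) - 1)) A"
  using assms emeasure_hyperplane_measure[of _ e] by (auto simp: sets_hyperplane_measure sets_restrict_space)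

lemma reflect_image_hyperplane_Int:
  assumes "norm e = 1" "norm e' = 1"
  shows "reflect e e' ` (hyperplane e \<inter> A) = hyperplane e' \<inter> reflect e e' -` A"
proof -
  have "x \<in> reflect e e' ` (hyperplane e \<inter> A)" if "x \<in> hyperplane e'" "reflect e e' x \<in> A" for x
    using that reflect_hyperplane[OF assms, of "reflect e e' x"]
    by (intro image_eqI[of _ _ "reflect e e' x"]) (auto simp: reflect_reflect)
  then show ?thesis using reflect_hyperplane[OF assms] by (auto simp: reflect_reflect)
qed

lemma dist_reflect: "dist (reflect e e' x) (reflect e e' y) = dist x y"
  by (metis dist_norm linear_diff linear_reflect norm_reflect)

lemma hausdorff_outer_hyperplane_ball_finite:
  fixes e :: "'a::euclidean_space"
  assumes e: "norm e = 1" and r: "0 < r"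
  shows "hausdorff_outer (real (DIM('a) - 1)) (hyperplane e \<inter> ball 0 r) < \<infinity>"
proof -
  obtain b :: 'a where b: "b \<in> Basis" using nonempty_Basis by blast
  have "reflect e b ` (hyperplane e \<inter> ball 0 r) = hyperplane b \<inter> ball 0 r"
    using b e by (subst reflect_image_hyperplane_Int) (auto simp: norm_reflect)
  then have "hausdorff_outer (real (DIM('a) - 1)) (hyperplane e \<inter> ball 0 r)
    = hausdorff_outer (real (DIM('a) - 1)) (hyperplane b \<inter> ball 0 r)"
    using hausdorff_outer_isometry[of "hyperplane e \<inter> ball 0 r" "reflect e b" "real (DIM('a) - 1)"]
    by (simp add: dist_reflect)
  then show ?thesis using hausdorff_outer_coordinate_plane_finite[OF b r] by simp
qed

lemma sigma_finite_hyperplane_measure: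
  fixes e :: "'a::euclidean_space"
  assumes e: "norm e = 1"
  shows "sigma_finite_measure (hyperplane_measure e)"
proof
  have "emeasure (hyperplane_measure e) (hyperplane e \<inter> ball 0 (real n)) \<noteq> \<infinity>" for n
    using hausdorff_outer_hyperplane_ball_finite[OF e, of "real n"]
    by (cases "n = 0") (auto simp: emeasure_hyperplane_measure)
  moreover have "(\<Union>n. hyperplane e \<inter> ball 0 (real n)) = hyperplane e"
    by (auto simp: reals_Archimedean2)
  ultimately show "\<exists>A. countable A \<and> A \<subseteq> sets (hyperplane_measure e) \<and> \<Union> A = space (hyperplane_measure e)
      \<and> (\<forall>a\<in>A. emeasure (hyperplane_measure e) a \<noteq> \<infinity>)"
    by (intro exI[of _ "range (\<lambda>n. hyperplane e \<inter> ball 0 (real n))"])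
       (auto simp: sets_hyperplane_measure sets_restrict_space)
qed

definition sweep :: "'a::euclidean_space \<Rightarrow> 'a \<times> real \<Rightarrow> 'a" where
  "sweep e = (\<lambda>(y, s). y + s *\<^sub>R e)"

lemma measurable_sweep [measurable]:
  "sweep e \<in> borel_measurable (hyperplane_measure e \<Otimes>\<^sub>M lborel)"
proof -
  have [measurable]: "(\<lambda>x. x) \<in> borel_measurable (hyperplane_measure e)"
    by (simp add: measurable_cong_sets[OF sets_hyperplane_measure refl] measurable_restrict_space1)
  show ?thesis unfolding sweep_def by measurable
qed

definition swept_measure :: "'a::euclidean_space \<Rightarrow> 'a measure" where
  "swept_measure e = distr (hyperplane_measure e \<Otimes>\<^sub>M lborel) borel (sweep e)"

lemma sets_swept_measure [simp, measurable_cong]: "sets (swept_measure e) = sets borel"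
  and space_swept_measure [simp]: "space (swept_measure e) = UNIV"
  by (simp_all add: swept_measure_def)

lemma emeasure_swept_measure:
  fixes e :: "'a::euclidean_space"
  assumes e: "norm e = 1" and A[measurable]: "A \<in> sets borel"
  shows "emeasure (swept_measure e) A =
    (\<integral>\<^sup>+s. hausdorff_outer (real (DIM('a) - 1)) (hyperplane e \<inter> (\<lambda>y. y + s *\<^sub>R e) -` A) \<partial>lborel)"
proof -
  interpret P: pair_sigma_finite "hyperplane_measure e" lborel
    using sigma_finite_hyperplane_measure[OF e] lborel.sigma_finite_measure_axioms by (simp add: pair_sigma_finite_def)
  have "emeasure (swept_measure e) A = emeasure (hyperplane_measure e \<Otimes>\<^sub>M lborel) (sweep e -` A \<inter> space (hyperplane_measure e \<Otimes>\<^sub>M lborel))"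
    unfolding swept_measure_def by (rule emeasure_distr) auto
  also have "\<dots> = (\<integral>\<^sup>+s. emeasure (hyperplane_measure e) ((\<lambda>y. (y, s)) -` (sweep e -` A \<inter> space (hyperplane_measure e \<Otimes>\<^sub>M lborel))) \<partial>lborel)"
    by (rule P.emeasure_pair_measure_alt2) measurable
  also have "\<dots> = (\<integral>\<^sup>+s. emeasure (hyperplane_measure e) (hyperplane e \<inter> (\<lambda>y. y + s *\<^sub>R e) -` A) \<partial>lborel)"
    by (intro nn_integral_cong arg_cong[of _ _ "emeasure _"]) (auto simp: sweep_def space_pair_measure)
  also have "\<dots> = (\<integral>\<^sup>+s. hausdorff_outer (real (DIM('a) - 1)) (hyperplane e \<inter> (\<lambda>y. y + s *\<^sub>R e) -` A) \<partial>lborel)"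
  proof (intro nn_integral_cong emeasure_hyperplane_measure)
    fix s :: real
    have "(\<lambda>y. y + s *\<^sub>R e) -` A \<inter> space borel \<in> sets borel" by (rule measurable_sets[OF _ A]) measurable
    then show "(\<lambda>y. y + s *\<^sub>R e) -` A \<in> sets borel" by simp
  qed
  finally show ?thesis .
qed

text \<open>The component of z along e shifts the height of the slices, which Lebesgue measure on
  the line ignores; the component in the hyperplane acts on each slice as an isometry, which
  Hausdorff measure ignores.\<close>

lemma swept_measure_translate:
  fixes e :: "'a::euclidean_space"
  assumes e: "norm e = 1"
  shows "distr (swept_measure e) borel ((+) z) = swept_measure e"
proof (rule measure_eqI)
  fix A assume "A \<in> sets (distr (swept_measure e) borel ((+) z))"
  then have A[measurable]: "A \<in> sets borel" by simp
  define t where "t = z \<bullet> e"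
  define w where "w = z - t *\<^sub>R e"
  have ee: "e \<bullet> e = 1" using e by (simp add: norm_eq_1)
  have w: "w \<bullet> e = 0" using ee by (simp add: w_def t_def inner_diff_left)
  let ?H = "hausdorff_outer (real (DIM('a) - 1)) :: 'a set \<Rightarrow> ennreal"
  define g where "g s = ?H (hyperplane e \<inter> (\<lambda>y. y + s *\<^sub>R e) -` A)" for s
  \<comment> \<open>The substitution s to t + s under the integral requires the measure of the slice
    to depend measurably on its height.\<close>
  have gm: "g \<in> borel_measurable borel"
  proof -
    interpret P: pair_sigma_finite lborel "hyperplane_measure e"
      using sigma_finite_hyperplane_measure[OF e] lborel.sigma_finite_measure_axioms by (simp add: pair_sigma_finite_def)
    have [measurable]: "(\<lambda>x. x) \<in> borel_measurable (hyperplane_measure e)"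
      by (simp add: measurable_cong_sets[OF sets_hyperplane_measure refl] measurable_restrict_space1)
    have "(\<lambda>s. \<integral>\<^sup>+y. indicator A (y + s *\<^sub>R e) \<partial>hyperplane_measure e) \<in> borel_measurable lborel"
      by measurable
    also have "(\<lambda>s. \<integral>\<^sup>+y. indicator A (y + s *\<^sub>R e) \<partial>hyperplane_measure e) = g"
    proof
      fix s :: real
      have *: "(\<lambda>y. y + s *\<^sub>R e) -` A \<in> sets borel"
        using measurable_sets[of "\<lambda>y. y + s *\<^sub>R e" borel borel A] by simp
      have "(\<integral>\<^sup>+y. indicator A (y + s *\<^sub>R e) \<partial>hyperplane_measure e)
        = (\<integral>\<^sup>+y. indicator (hyperplane e \<inter> (\<lambda>y. y + s *\<^sub>R e) -` A) y \<partial>hyperplane_measure e)"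
        by (intro nn_integral_cong) (auto split: split_indicator)
      also have "\<dots> = emeasure (hyperplane_measure e) (hyperplane e \<inter> (\<lambda>y. y + s *\<^sub>R e) -` A)"
        using * by (intro nn_integral_indicator) (auto simp: sets_hyperplane_measure sets_restrict_space)
      finally show "(\<integral>\<^sup>+y. indicator A (y + s *\<^sub>R e) \<partial>hyperplane_measure e) = g s"
        using * by (simp add: g_def emeasure_hyperplane_measure)
    qed
    finally show ?thesis by simp
  qed
  have sh: "?H (hyperplane e \<inter> (\<lambda>y. y + s *\<^sub>R e) -` ((+) z -` A)) = g (t + s)" for s
  proof -
    have "(+) w ` (hyperplane e \<inter> (\<lambda>y. y + s *\<^sub>R e) -` ((+) z -` A)) = hyperplane e \<inter> (\<lambda>y. y + (t + s) *\<^sub>R e) -` A"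
      (is "?L = ?R")
    proof
      show "?L \<subseteq> ?R" by (auto simp: hyperplane_def inner_add_left w) (simp add: w_def algebra_simps)
      show "?R \<subseteq> ?L"
      proof
        fix x assume x: "x \<in> ?R"
        then have "z + (x - w + s *\<^sub>R e) \<in> A" by (simp add: w_def algebra_simps)
        then show "x \<in> ?L" using x
          by (intro image_eqI[of _ _ "x - w"]) (auto simp: hyperplane_def inner_diff_left w)
      qed
    qed
    then show ?thesis unfolding g_def
      by (metis (no_types, lifting) dist_add_cancel hausdorff_outer_isometry of_nat_0_le_iff)
  qed
  have zA: "(+) z -` A \<in> sets borel" using measurable_sets[of "(+) z" borel borel A] by simp
  have "emeasure (distr (swept_measure e) borel ((+) z)) A = emeasure (swept_measure e) ((+) z -` A)"
    by (subst emeasure_distr) (auto simp: swept_measure_def)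
  also have "\<dots> = (\<integral>\<^sup>+s. g (t + s) \<partial>lborel)"
    by (simp only: emeasure_swept_measure[OF e zA] sh)
  also have "\<dots> = (\<integral>\<^sup>+s. g s \<partial>lborel)"
    by (subst (2) lborel_distr_plus[of t, symmetric], subst nn_integral_distr) (use gm in auto)
  also have "\<dots> = emeasure (swept_measure e) A"
    by (simp add: emeasure_swept_measure[OF e A] g_def)
  finally show "emeasure (distr (swept_measure e) borel ((+) z)) A = emeasure (swept_measure e) A" .
qed (simp add: swept_measure_def)

text \<open>By Pythagoras each slice of the ball is contained in the central one and is empty at
  heights beyond r, so the central slice times the length 2 r is an upper bound.\<close>

lemma emeasure_swept_measure_ball_finite:
  fixes e :: "'a::euclidean_space"
  assumes e: "norm e = 1"
  shows "emeasure (swept_measure e) (ball 0 r) < \<infinity>"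
proof (cases "0 < r")
  case r: True
  let ?H = "hausdorff_outer (real (DIM('a) - 1)) :: 'a set \<Rightarrow> ennreal"
  have "emeasure (swept_measure e) (ball 0 r) \<le> (\<integral>\<^sup>+s. ?H (hyperplane e \<inter> ball 0 r) * indicator {-r..r} s \<partial>lborel)"
    unfolding emeasure_swept_measure[OF e borel_open[OF open_ball]]
  proof (intro nn_integral_mono)
    fix s :: real
    have *: "norm y \<le> norm (y + s *\<^sub>R e) \<and> \<bar>s\<bar> \<le> norm (y + s *\<^sub>R e)" if "y \<in> hyperplane e" for y
    proof -
      have "(norm (y + s *\<^sub>R e))\<^sup>2 = (norm y)\<^sup>2 + s\<^sup>2"
        using that e unfolding power2_norm_eq_inner
        by (simp add: inner_add_left inner_add_right hyperplane_def inner_commute norm_eq_1 power2_eq_square)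
      then have "(norm y)\<^sup>2 \<le> (norm (y + s *\<^sub>R e))\<^sup>2" "\<bar>s\<bar>\<^sup>2 \<le> (norm (y + s *\<^sub>R e))\<^sup>2" by auto
      then show ?thesis using abs_le_square_iff power2_le_imp_le norm_ge_zero by blast
    qed
    have sub: "hyperplane e \<inter> (\<lambda>y. y + s *\<^sub>R e) -` ball 0 r \<subseteq> (if \<bar>s\<bar> \<le> r then hyperplane e \<inter> ball 0 r else {})"
      using * by (auto split: if_splits) (smt (verit))+
    have "?H {} = 0" by (auto intro!: antisym hausdorff_outer_le simp: hausdorff_pre_empty)
    then show "?H (hyperplane e \<inter> (\<lambda>y. y + s *\<^sub>R e) -` ball 0 r) \<le> ?H (hyperplane e \<inter> ball 0 r) * indicator {-r..r} s"
      using hausdorff_outer_mono[OF sub, of "real (DIM('a) - 1)"] by (auto split: split_indicator if_splits simp: abs_le_iff)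
  qed
  also have "\<dots> = ?H (hyperplane e \<inter> ball 0 r) * ennreal (2 * r)"
    using r by (simp add: nn_integral_cmult_indicator)
  also have "\<dots> < \<infinity>"
    using hausdorff_outer_hyperplane_ball_finite[OF e r] by (simp add: ennreal_mult_less_top)
  finally show ?thesis .
qed (simp add: ball_empty)

lemma emeasure_swept_measure_ball_eq:
  fixes e e' :: "'a::euclidean_space"
  assumes e: "norm e = 1" "norm e' = 1"
  shows "emeasure (swept_measure e) (ball 0 r) = emeasure (swept_measure e') (ball 0 r)"
proof -
  have "hausdorff_outer (real (DIM('a) - 1)) (hyperplane e \<inter> (\<lambda>y. y + s *\<^sub>R e) -` ball 0 r)
      = hausdorff_outer (real (DIM('a) - 1)) (hyperplane e' \<inter> (\<lambda>y. y + s *\<^sub>R e') -` ball 0 r)" for s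
  proof -
    have "reflect e e' y + s *\<^sub>R e = reflect e e' (y + s *\<^sub>R e')" for y
    proof -
      have "reflect e e' e' = e" using reflect_reflect[of e e' e] reflect_unit[OF e] by simp
      then show ?thesis by (simp add: linear_add[OF linear_reflect] linear_scale[OF linear_reflect])
    qed
    then have "reflect e e' ` (hyperplane e \<inter> (\<lambda>y. y + s *\<^sub>R e) -` ball 0 r) = hyperplane e' \<inter> (\<lambda>y. y + s *\<^sub>R e') -` ball 0 r"
      by (subst reflect_image_hyperplane_Int[OF e]) (auto simp: norm_reflect)
    then show ?thesis
      using hausdorff_outer_isometry[of "hyperplane e \<inter> (\<lambda>y. y + s *\<^sub>R e) -` ball 0 r" "reflect e e'" "real (DIM('a) - 1)"]
      by (simp add: dist_reflect)
  qed
  then show ?thesis by (simp add: emeasure_swept_measure e)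
qed

lemma sigma_finite_swept_measure:
  fixes e :: "'a::euclidean_space"
  assumes e: "norm e = 1"
  shows "sigma_finite_measure (swept_measure e)"
proof
  have "(\<Union>n. ball 0 (real n)) = (UNIV :: 'a set)"
    by (auto simp: reals_Archimedean2)
  then show "\<exists>A. countable A \<and> A \<subseteq> sets (swept_measure e) \<and> \<Union> A = space (swept_measure e) \<and> (\<forall>a\<in>A. emeasure (swept_measure e) a \<noteq> \<infinity>)"
    using emeasure_swept_measure_ball_finite[OF e]
    by (intro exI[of _ "range (\<lambda>n. ball 0 (real n))"]) (auto simp: swept_measure_def less_top[symmetric])
qed

text \<open>The constant is in fact 1 (isodiametric inequality), but only its independence of the
  direction matters.\<close>

proposition swept_measure_eq:
  assumes dim: "2 \<le> DIM('a::euclidean_space)"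
  obtains c :: real where "0 < c" "\<And>e :: 'a. norm e = 1 \<Longrightarrow> swept_measure e = density lborel (\<lambda>_. ennreal c)"
proof -
  obtain b :: 'a where b: "b \<in> Basis" using nonempty_Basis by blast
  let ?B = "ball 0 1 :: 'a set"
  \<comment> \<open>The ratio to Lebesgue measure is read off on the unit ball for one coordinate
    direction; balls are preserved by the reflections, so all directions share it.\<close>
  define c where "c = enn2real (emeasure (swept_measure b) ?B) / measure lborel ?B"
  have lB: "0 < measure lborel ?B" by (rule content_ball_pos) simp
  have eB: "emeasure lborel ?B = ennreal (measure lborel ?B)"
    using emeasure_lborel_ball_finite[of "0::'a" 1] by (simp add: emeasure_eq_ennreal_measure less_top)
  have sb: "emeasure (swept_measure b) ?B = ennreal (c * measure lborel ?B)"
    using emeasure_swept_measure_ball_finite[of b 1] b lB by (simp add: c_def)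
  have c0: "0 \<le> c" by (simp add: c_def)
  have eq: "emeasure (swept_measure e) A = ennreal c * emeasure lborel A" if e: "norm e = 1" and A: "A \<in> sets borel" for e :: 'a and A
  proof -
    have "emeasure (swept_measure e) A * emeasure lborel ?B = emeasure lborel A * emeasure (swept_measure e) ?B"
      by (rule translation_invariant_measure_unique)
         (use A e in \<open>auto simp: swept_measure_translate sigma_finite_swept_measure\<close>)
    also have "emeasure (swept_measure e) ?B = ennreal c * emeasure lborel ?B"
      using emeasure_swept_measure_ball_eq[of e b 1] e b c0 lB by (simp add: sb eB ennreal_mult)
    finally have "emeasure (swept_measure e) A * emeasure lborel ?B = (ennreal c * emeasure lborel A) * emeasure lborel ?B"
      by (simp add: mult_ac)
    then show ?thesis using lB unfolding eB
      by (metis ennreal_eq_0_iff ennreal_neq_top linorder_not_less mult_divide_eq_ennreal)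
  qed
  \<comment> \<open>The unit cube contains every translate of its face along b by a length in
    [0, 1]. A vanishing constant would therefore make the face a null set.\<close>
  have "c \<noteq> 0"
  proof
    assume "c = 0"
    let ?Q = "{y \<in> hyperplane b. \<forall>i\<in>Basis. 0 \<le> y \<bullet> i \<and> y \<bullet> i \<le> 1}"
    let ?H = "hausdorff_outer (real (DIM('a) - 1)) :: 'a set \<Rightarrow> ennreal"
    have "?H ?Q = (\<integral>\<^sup>+s. ?H ?Q * indicator {0..1::real} s \<partial>lborel)"
      by (simp add: nn_integral_cmult_indicator)
    also have "\<dots> \<le> emeasure (swept_measure b) (cbox 0 One)"
    proof (subst emeasure_swept_measure)
      show "(\<integral>\<^sup>+s. ?H ?Q * indicator {0..1::real} s \<partial>lborel) \<le> (\<integral>\<^sup>+s. ?H (hyperplane b \<inter> (\<lambda>y. y + s *\<^sub>R b) -` cbox 0 One) \<partial>lborel)"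
      proof (intro nn_integral_mono)
        fix s :: real
        have "?Q \<subseteq> hyperplane b \<inter> (\<lambda>y. y + s *\<^sub>R b) -` cbox 0 One" if "0 \<le> s" "s \<le> 1"
          using that b by (auto simp: cbox_def inner_add_left inner_Basis hyperplane_def)
        then show "?H ?Q * indicator {0..1::real} s \<le> ?H (hyperplane b \<inter> (\<lambda>y. y + s *\<^sub>R b) -` cbox 0 One)"
          using hausdorff_outer_mono[of ?Q _ "real (DIM('a) - 1)"] by (simp add: indicator_def del: Int_subset_iff le_inf_iff)
      qed
    qed (use b in auto)
    also have "\<dots> = 0" using b \<open>c = 0\<close> by (subst eq) auto
    finally show False using hausdorff_outer_coordinate_plane_pos[OF b dim] by simp
  qed
  with c0 have "0 < c" by simp
  moreover have "swept_measure e = density lborel (\<lambda>_. ennreal c)" if "norm e = 1" for e :: 'a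
    by (rule measure_eqI) (auto simp: eq[OF that] emeasure_density_const)
  ultimately show ?thesis by (rule that)
qed

section \<open>Domains with continuous normal\<close>

text \<open>Both integrals are integrals over t > 0 of the measures of the superlevel sets. This
  carries comparisons of Hausdorff measures of sets under projections over to integrals, in place of
  a change of variables formula.\<close>

lemma nn_integral_mono_superlevel:
  fixes f :: "'a \<Rightarrow> real" and g :: "'b \<Rightarrow> real" and C :: ennreal
  assumes M: "sigma_finite_measure M" and N: "sigma_finite_measure N"
    and f[measurable]: "f \<in> borel_measurable M" and g[measurable]: "g \<in> borel_measurable N"
    and le: "\<And>t. 0 < t \<Longrightarrow> emeasure M {x \<in> space M. t < f x} \<le> C * emeasure N {x \<in> space N. t < g x}"
  shows "(\<integral>\<^sup>+x. ennreal (f x) \<partial>M) \<le> C * (\<integral>\<^sup>+x. ennreal (g x) \<partial>N)"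
proof -
  have layer: "(\<integral>\<^sup>+x. ennreal (h x) \<partial>K) = (\<integral>\<^sup>+t. indicator {0<..} t * emeasure K {x \<in> space K. t < h x} \<partial>lborel)"
    and meas: "(\<lambda>t::real. indicator {0<..} t * emeasure K {x \<in> space K. t < h x}) \<in> borel_measurable lborel"
    if K: "sigma_finite_measure K" and h[measurable]: "h \<in> borel_measurable K" for h :: "'c \<Rightarrow> real" and K
  proof -
    interpret P: pair_sigma_finite K lborel
      using K lborel.sigma_finite_measure_axioms by (simp add: pair_sigma_finite_def)
    have inner: "(\<integral>\<^sup>+x. indicator {0<..} t * indicator {x \<in> space K. t < h x} x \<partial>K) = indicator {0<..} t * emeasure K {x \<in> space K. t < h x}" for t
      by (subst nn_integral_cmult) auto
    have m: "(\<lambda>(x, t). indicator {0<..} t * indicator {x \<in> space K. t < h x} x :: ennreal) \<in> borel_measurable (K \<Otimes>\<^sub>M lborel)"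
      by (simp add: indicator_def case_prod_beta) measurable
    have "(\<integral>\<^sup>+x. ennreal (h x) \<partial>K) = (\<integral>\<^sup>+x. (\<integral>\<^sup>+t. indicator {0<..} t * indicator {x \<in> space K. t < h x} x \<partial>lborel) \<partial>K)"
    proof (rule nn_integral_cong)
      fix x assume x: "x \<in> space K"
      have "(\<integral>\<^sup>+t. indicator {0<..} t * indicator {x \<in> space K. t < h x} x \<partial>lborel) = (\<integral>\<^sup>+t. indicator {0<..<h x} t \<partial>lborel)"
        using x by (intro nn_integral_cong) (auto split: split_indicator)
      also have "\<dots> = ennreal (h x)"
        by (cases "0 \<le> h x") (auto simp: ennreal_neg)
      finally show "ennreal (h x) = (\<integral>\<^sup>+t. indicator {0<..} t * indicator {x \<in> space K. t < h x} x \<partial>lborel)" by simp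
    qed
    also have "\<dots> = (\<integral>\<^sup>+t. (\<integral>\<^sup>+x. indicator {0<..} t * indicator {x \<in> space K. t < h x} x \<partial>K) \<partial>lborel)"
      using P.Fubini'[OF m] by simp
    finally show "(\<integral>\<^sup>+x. ennreal (h x) \<partial>K) = (\<integral>\<^sup>+t. indicator {0<..} t * emeasure K {x \<in> space K. t < h x} \<partial>lborel)"
      unfolding inner .
    interpret K: sigma_finite_measure K by fact
    have [measurable]: "(\<lambda>(t, x). indicator {0<..} t * indicator {x \<in> space K. t < h x} x :: ennreal) \<in> borel_measurable (lborel \<Otimes>\<^sub>M K)"
      by (simp add: indicator_def case_prod_beta) measurable
    have "(\<lambda>t. \<integral>\<^sup>+x. indicator {0<..} t * indicator {x \<in> space K. t < h x} x \<partial>K) \<in> borel_measurable lborel"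
      by measurable
    then show "(\<lambda>t::real. indicator {0<..} t * emeasure K {x \<in> space K. t < h x}) \<in> borel_measurable lborel"
      unfolding inner .
  qed
  show ?thesis
    unfolding layer[OF M f] layer[OF N g]
    by (subst nn_integral_cmult[symmetric, OF meas[OF N g]]) (auto intro!: nn_integral_mono le split: split_indicator)
qed

section \<open>C1 functions with explicit gradient\<close>

text \<open>Regularity is asked on the whole space, the form in which \<open>sobolev_trace\<close>
  provides its approximants, so no extension across the boundary is ever made.\<close>

definition C1_fun :: "('a::euclidean_space \<Rightarrow> real) \<Rightarrow> ('a \<Rightarrow> 'a) \<Rightarrow> bool" where
  "C1_fun f df \<longleftrightarrow> (\<forall>x. (f has_derivative (\<lambda>h. df x \<bullet> h)) (at x)) \<and> continuous_on UNIV df"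

lemma C1_fun_continuous: "C1_fun f df \<Longrightarrow> continuous_on A f"
  unfolding C1_fun_def by (meson continuous_at_imp_continuous_on has_derivative_continuous)

lemma C1_fun_continuous_grad: "C1_fun f df \<Longrightarrow> continuous_on A df"
  unfolding C1_fun_def by (meson continuous_on_subset subset_UNIV)

lemma C1_fun_measurable [measurable_dest]: "C1_fun f df \<Longrightarrow> f \<in> borel_measurable borel"
  by (simp add: borel_measurable_continuous_onI C1_fun_continuous)

lemma C1_fun_measurable_grad [measurable_dest]: "C1_fun f df \<Longrightarrow> df \<in> borel_measurable borel"
  by (simp add: borel_measurable_continuous_onI C1_fun_continuous_grad)

lemma C1_fun_const: "C1_fun (\<lambda>_. k) (\<lambda>_. 0)"
  by (auto simp: C1_fun_def)

lemma C1_fun_add: "C1_fun f df \<Longrightarrow> C1_fun g dg \<Longrightarrow> C1_fun (\<lambda>x. f x + g x) (\<lambda>x. df x + dg x)"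
  by (auto simp: C1_fun_def inner_add_left intro!: has_derivative_add continuous_on_add)

lemma C1_fun_diff: "C1_fun f df \<Longrightarrow> C1_fun g dg \<Longrightarrow> C1_fun (\<lambda>x. f x - g x) (\<lambda>x. df x - dg x)"
  by (auto simp: C1_fun_def inner_diff_left intro!: has_derivative_diff continuous_on_diff)

lemma C1_fun_mult:
  assumes "C1_fun f df" "C1_fun g dg"
  shows "C1_fun (\<lambda>x. f x * g x) (\<lambda>x. g x *\<^sub>R df x + f x *\<^sub>R dg x)"
proof -
  have "((\<lambda>x. f x * g x) has_derivative (\<lambda>h. f x * (dg x \<bullet> h) + (df x \<bullet> h) * g x)) (at x)" for x
    using assms unfolding C1_fun_def by (intro has_derivative_mult) auto
  moreover have "(\<lambda>h. f x * (dg x \<bullet> h) + (df x \<bullet> h) * g x) = (\<lambda>h. (g x *\<^sub>R df x + f x *\<^sub>R dg x) \<bullet> h)" for x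
    by (auto simp: inner_add_left)
  ultimately show ?thesis
    using C1_fun_continuous[OF assms(1)] C1_fun_continuous[OF assms(2)] assms unfolding C1_fun_def
    by (auto intro!: continuous_intros)
qed

lemma C1_fun_compose:
  assumes f: "C1_fun f df" and \<phi>: "\<And>t. (\<phi> has_real_derivative \<phi>' t) (at t)" "continuous_on UNIV \<phi>'"
  shows "C1_fun (\<lambda>x. \<phi> (f x)) (\<lambda>x. \<phi>' (f x) *\<^sub>R df x)"
proof -
  have "((\<lambda>x. \<phi> (f x)) has_derivative (\<lambda>h. (\<phi>' (f x) *\<^sub>R df x) \<bullet> h)) (at x)" for x
  proof -
    have 1: "(f has_derivative (\<lambda>h. df x \<bullet> h)) (at x)" using f by (simp add: C1_fun_def)
    have "(\<lambda>h. (\<phi>' (f x) *\<^sub>R df x) \<bullet> h) = (\<lambda>h. (df x \<bullet> h) * \<phi>' (f x))" by (auto simp: mult.commute)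
    then show ?thesis using DERIV_compose_FDERIV[OF \<phi>(1) 1] by simp
  qed
  moreover have "continuous_on UNIV (\<lambda>x. \<phi>' (f x))"
    using continuous_on_compose2[OF \<phi>(2) C1_fun_continuous[OF f]] by auto
  then have "continuous_on UNIV (\<lambda>x. \<phi>' (f x) *\<^sub>R df x)"
    using C1_fun_continuous_grad[OF f] by (intro continuous_on_scaleR)
  ultimately show ?thesis unfolding C1_fun_def by blast
qed

lemma C1_fun_zero_grad:
  assumes "C1_fun f df" "\<And>x. 0 \<le> f x" "f x = 0"
  shows "df x = 0"
proof -
  have "(\<lambda>h. df x \<bullet> h) = (\<lambda>h. 0)"
    by (rule differential_zero_maxmin[of x UNIV f "\<lambda>h. df x \<bullet> h"]) (use assms in \<open>auto simp: C1_fun_def\<close>)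
  then show ?thesis by (metis inner_eq_zero_iff)
qed

section \<open>Flat boundary pieces and the outer normal\<close>

text \<open>One vector n serves all boundary vertices in B, and only one opening \<epsilon> is
  involved. The local flux estimate uses the boundary through this finite-scale condition
  alone.\<close>

definition flat_on :: "'a::euclidean_space set \<Rightarrow> 'a \<Rightarrow> real \<Rightarrow> 'a set \<Rightarrow> bool" where
  "flat_on D n \<epsilon> B \<longleftrightarrow> (\<forall>x\<in>frontier D \<inter> B. \<forall>z\<in>B.
     ((z - x) \<bullet> n < - \<epsilon> * norm (z - x) \<longrightarrow> z \<in> D) \<and> ((z - x) \<bullet> n > \<epsilon> * norm (z - x) \<longrightarrow> z \<notin> D))"

text \<open>A chart-free form of a continuously differentiable boundary: near each boundary point the
  two-sided cone condition holds with one normal for all nearby vertices.\<close>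

definition C1_domain :: "'a::euclidean_space set \<Rightarrow> bool" where
  "C1_domain D \<longleftrightarrow> (\<forall>y\<in>frontier D. \<exists>n. norm n = 1 \<and> (\<forall>\<epsilon>>0. \<exists>r>0. flat_on D n \<epsilon> (ball y r)))"

text \<open>This makes the choice in \<open>outer_normal\<close> determinate. A short step along n'
  - n would enter D according to n and stay outside according to n'.\<close>

lemma is_outer_normal_unique:
  fixes x :: "'a::euclidean_space"
  assumes "is_outer_normal D x n" "is_outer_normal D x n'"
  shows "n = n'"
proof (rule ccontr)
  assume ne: "n \<noteq> n'"
  have 1: "n \<bullet> n = 1" "n' \<bullet> n' = 1" using assms by (auto simp: is_outer_normal_def norm_eq_1)
  define w where "w = n' - n"
  have w0: "w \<noteq> 0" using ne by (simp add: w_def)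
  \<comment> \<open>The inner products of w with the two unit normals are minus and plus half its
    squared norm, so a quarter of the norm is a cone opening that both slopes exceed.\<close>
  define \<epsilon> where "\<epsilon> = norm w / 4"
  have wn: "w \<bullet> n = - (norm w)\<^sup>2 / 2" "w \<bullet> n' = (norm w)\<^sup>2 / 2"
    using 1 by (simp_all add: w_def power2_norm_eq_inner inner_diff_left inner_diff_right inner_commute)
  have e: "0 < \<epsilon>" using w0 by (simp add: \<epsilon>_def)
  obtain r where r: "r > 0" "\<And>y. y \<in> ball x r \<Longrightarrow> (y - x) \<bullet> n < - \<epsilon> * norm (y - x) \<Longrightarrow> y \<in> D"
    using assms(1) e unfolding is_outer_normal_def by blast
  obtain r' where r': "r' > 0" "\<And>y. y \<in> ball x r' \<Longrightarrow> (y - x) \<bullet> n' > \<epsilon> * norm (y - x) \<Longrightarrow> y \<notin> D"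
    using assms(2) e unfolding is_outer_normal_def by blast
  define t where "t = min r r' / (2 * norm w)"
  have t: "0 < t" "t * norm w < r" "t * norm w < r'" using r(1) r'(1) w0 by (auto simp: t_def)
  have "x + t *\<^sub>R w \<in> D"
    using t w0 by (intro r(2)) (auto simp: dist_norm wn \<epsilon>_def power2_eq_square)
  moreover have "x + t *\<^sub>R w \<notin> D"
    using t w0 by (intro r'(2)) (auto simp: dist_norm wn \<epsilon>_def power2_eq_square)
  ultimately show False by simp
qed

lemma is_outer_normal_imp_outer_normal: "is_outer_normal D x n \<Longrightarrow> outer_normal D x = n"
  unfolding outer_normal_def by (rule some_equality) (auto intro: is_outer_normal_unique)

lemma flat_on_imp_is_outer_normal:
  assumes y: "y \<in> frontier D" and "norm n = 1" and f: "\<And>\<epsilon>. 0 < \<epsilon> \<Longrightarrow> \<exists>r>0. flat_on D n \<epsilon> (ball y r)"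
  shows "is_outer_normal D y n"
  unfolding is_outer_normal_def
proof (intro conjI allI impI)
  fix \<epsilon> :: real assume "\<epsilon> > 0"
  then obtain r where r: "r > 0" "flat_on D n \<epsilon> (ball y r)" using f by blast
  then show "\<exists>r>0. \<forall>z\<in>ball y r. ((z - y) \<bullet> n < - \<epsilon> * norm (z - y) \<longrightarrow> z \<in> D) \<and> ((z - y) \<bullet> n > \<epsilon> * norm (z - y) \<longrightarrow> z \<notin> D)"
    using y unfolding flat_on_def by (intro exI[of _ r]) auto
qed fact

lemma C1_domain_outer_normal:
  assumes "C1_domain D" "y \<in> frontier D"
  shows is_outer_normal_outer_normal: "is_outer_normal D y (outer_normal D y)"
    and norm_outer_normal: "norm (outer_normal D y) = 1"
    and flat_on_outer_normal: "0 < \<epsilon> \<Longrightarrow> \<exists>r>0. flat_on D (outer_normal D y) \<epsilon> (ball y r)"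
proof -
  obtain n where n: "norm n = 1" "\<And>\<epsilon>. 0 < \<epsilon> \<Longrightarrow> \<exists>r>0. flat_on D n \<epsilon> (ball y r)"
    using assms unfolding C1_domain_def by blast
  then have *: "is_outer_normal D y n" using assms(2) by (intro flat_on_imp_is_outer_normal)
  then have "outer_normal D y = n" by (rule is_outer_normal_imp_outer_normal)
  with n * show "is_outer_normal D y (outer_normal D y)" "norm (outer_normal D y) = 1"
     "0 < \<epsilon> \<Longrightarrow> \<exists>r>0. flat_on D (outer_normal D y) \<epsilon> (ball y r)" by auto
qed

text \<open>The displacement along n' - n again: if the vectors differed by more than 2 \<epsilon>,
  flatness would put the displaced point inside D and the normal at x would put it outside.
  Continuity of the normal follows.\<close>

lemma flat_on_normal_close:
  assumes "flat_on D n \<epsilon> (ball y r)" "norm n = 1" and x: "x \<in> frontier D \<inter> ball y r" and N: "is_outer_normal D x n'" and "0 < \<epsilon>"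
  shows "norm (n' - n) \<le> 2 * \<epsilon>"
proof (rule ccontr)
  assume "\<not> ?thesis"
  then have big: "2 * \<epsilon> < norm (n' - n)" by simp
  have 1: "n \<bullet> n = 1" "n' \<bullet> n' = 1" using assms by (auto simp: is_outer_normal_def norm_eq_1)
  define w where "w = n' - n"
  have w0: "0 < norm w" "2 * \<epsilon> < norm w" using big \<open>0 < \<epsilon>\<close> by (auto simp: w_def)
  have wn: "w \<bullet> n = - (norm w)\<^sup>2 / 2" "w \<bullet> n' = (norm w)\<^sup>2 / 2"
    using 1 by (simp_all add: w_def power2_norm_eq_inner inner_diff_left inner_diff_right inner_commute)
  obtain r' where r': "r' > 0" "\<And>y. y \<in> ball x r' \<Longrightarrow> (y - x) \<bullet> n' > \<epsilon> * norm (y - x) \<Longrightarrow> y \<notin> D"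
    using N \<open>0 < \<epsilon>\<close> unfolding is_outer_normal_def by blast
  define \<rho> where "\<rho> = min r' (r - dist y x)"
  define t where "t = \<rho> / (2 * norm w)"
  have \<rho>: "0 < \<rho>" using x r'(1) by (auto simp: \<rho>_def)
  have t: "0 < t" "t * norm w < \<rho>" using \<rho> w0 by (auto simp: t_def)
  have in_ball: "x + t *\<^sub>R w \<in> ball y r"
  proof -
    have "dist y (x + t *\<^sub>R w) \<le> dist y x + dist x (x + t *\<^sub>R w)" by (rule dist_triangle)
    also have "dist x (x + t *\<^sub>R w) = t * norm w" using t by (simp add: dist_norm)
    finally show ?thesis using t by (auto simp: \<rho>_def)
  qed
  have "\<epsilon> * (t * norm w) < t * ((norm w)\<^sup>2 / 2)"
    using t w0 by (simp add: power2_eq_square)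
  then have "x + t *\<^sub>R w \<in> D" "x + t *\<^sub>R w \<notin> D"
    using assms(1) in_ball x t r'(2)[of "x + t *\<^sub>R w"] wn unfolding flat_on_def \<rho>_def
    by (auto simp: dist_norm)
  then show False by simp
qed

lemma continuous_on_outer_normal:
  assumes "C1_domain D"
  shows "continuous_on (frontier D) (outer_normal D)"
  unfolding continuous_on_iff
proof (intro ballI allI impI)
  fix y and e :: real assume y: "y \<in> frontier D" and "0 < e"
  then obtain r where r: "r > 0" "flat_on D (outer_normal D y) (e/4) (ball y r)"
    using flat_on_outer_normal[OF assms y, of "e/4"] by auto
  show "\<exists>d>0. \<forall>x\<in>frontier D. dist x y < d \<longrightarrow> dist (outer_normal D x) (outer_normal D y) < e"
  proof (intro exI[of _ r] conjI ballI impI)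
    fix x assume x: "x \<in> frontier D" "dist x y < r"
    then have "norm (outer_normal D x - outer_normal D y) \<le> 2 * (e/4)"
      using \<open>0 < e\<close> by (intro flat_on_normal_close[OF r(2)] norm_outer_normal is_outer_normal_outer_normal assms y)
        (use assms in \<open>auto simp: dist_commute intro!: is_outer_normal_outer_normal\<close>)
    then show "dist (outer_normal D x) (outer_normal D y) < e" using \<open>0 < e\<close> by (simp add: dist_norm)
  qed fact
qed

text \<open>Neither endpoint belongs to the open set D, so neither lies in the interior cone whose
  vertex is the other one.\<close>

lemma flat_on_chord:
  assumes "open D" "flat_on D n \<epsilon> B" "x \<in> frontier D \<inter> B" "z \<in> frontier D \<inter> B"
  shows "\<bar>(z - x) \<bullet> n\<bar> \<le> \<epsilon> * norm (z - x)"
proof -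
  have nD: "x \<notin> D" "z \<notin> D" using assms by (auto simp: frontier_def interior_open)
  have "\<not> (z - x) \<bullet> n < - \<epsilon> * norm (z - x)" "\<not> (x - z) \<bullet> n < - \<epsilon> * norm (x - z)"
    using assms nD unfolding flat_on_def by blast+
  then show ?thesis by (simp add: norm_minus_commute inner_diff_left abs_le_iff)
qed

section \<open>Projections and the flux through a flat piece of boundary\<close>

definition proj_along :: "'a::euclidean_space \<Rightarrow> 'a \<Rightarrow> 'a" where
  "proj_along e x = x - (x \<bullet> e) *\<^sub>R e"

lemma proj_along_add [simp]: "proj_along e x + (x \<bullet> e) *\<^sub>R e = x"
  by (simp add: proj_along_def)

lemma proj_along_hyperplane: "norm e = 1 \<Longrightarrow> proj_along e x \<in> hyperplane e"
  by (simp add: proj_along_def hyperplane_def inner_diff_left norm_eq_1)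

lemma norm_proj_along:
  assumes "norm e = 1"
  shows "(norm x)\<^sup>2 = (norm (proj_along e x))\<^sup>2 + (x \<bullet> e)\<^sup>2"
proof -
  have "e \<bullet> e = 1" using assms by (simp add: norm_eq_1)
  then show ?thesis unfolding power2_norm_eq_inner proj_along_def
    by (simp add: inner_diff_left inner_diff_right inner_commute power2_eq_square)
qed

lemma norm_proj_along_le: "norm e = 1 \<Longrightarrow> norm (proj_along e x) \<le> norm x"
proof (rule power2_le_imp_le)
  assume "norm e = 1"
  from norm_proj_along[OF this, of x] show "(norm (proj_along e x))\<^sup>2 \<le> (norm x)\<^sup>2"
    using zero_le_power2[of "x \<bullet> e"] by linarith
qed simp

lemma proj_along_diff: "proj_along e x - proj_along e y = proj_along e (x - y)"
  by (simp add: proj_along_def inner_diff_left algebra_simps)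

lemma dist_proj_along: "dist (proj_along e x) (proj_along e y) = norm (proj_along e (x - y))"
  by (simp add: dist_norm proj_along_diff)

lemma hausdorff_outer_le_expanding_image:
  assumes "0 < L" and T: "\<And>x y. x \<in> A \<Longrightarrow> y \<in> A \<Longrightarrow> dist x y \<le> L * dist (T x) (T y)" and "0 \<le> s"
  shows "hausdorff_outer s A \<le> ennreal (L powr s) * hausdorff_outer s (T ` A)"
proof -
  have inj: "inj_on T A"
  proof (rule inj_onI)
    fix x y assume "x \<in> A" "y \<in> A" "T x = T y"
    then show "x = y" using T[of x y] by simp
  qed
  have "hausdorff_outer s (inv_into A T ` (T ` A)) \<le> ennreal (L powr s) * hausdorff_outer s (T ` A)"
    by (rule hausdorff_outer_Lipschitz_image) (use inj assms in auto)
  then show ?thesis using inj by (simp add: inv_into_image_cancel)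
qed

lemma hausdorff_outer_proj_le:
  assumes "norm e = 1" "0 \<le> s"
  shows "hausdorff_outer s (proj_along e ` A) \<le> hausdorff_outer s A"
proof -
  have "dist (proj_along e x) (proj_along e y) \<le> 1 * dist x y" for x y
    using norm_proj_along_le[OF assms(1), of "x - y"] unfolding dist_proj_along by (simp add: dist_norm)
  then have "hausdorff_outer s (proj_along e ` A) \<le> ennreal (1 powr s) * hausdorff_outer s A"
    using assms by (intro hausdorff_outer_Lipschitz_image) auto
  then show ?thesis by simp
qed

text \<open>By the chord bound and Pythagoras the projection keeps at least the fraction 1 -
  \<epsilon>^2 of a squared chord. Projection along the normal is thus injective on the piece, with
  almost isometric inverse.\<close>

lemma flat_on_expanding:
  assumes "open D" "flat_on D n \<epsilon> B" "norm n = 1" "0 \<le> \<epsilon>" "\<epsilon> < 1" "x \<in> frontier D \<inter> B" "y \<in> frontier D \<inter> B"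
  shows "dist x y \<le> (1 / sqrt (1 - \<epsilon>\<^sup>2)) * dist (proj_along n x) (proj_along n y)"
proof -
  have "\<bar>(x - y) \<bullet> n\<bar> \<le> \<epsilon> * norm (x - y)"
    using assms by (intro flat_on_chord[of D n \<epsilon> B]) auto
  then have "((x - y) \<bullet> n)\<^sup>2 \<le> \<epsilon>\<^sup>2 * (norm (x - y))\<^sup>2"
    by (metis power_mono power_mult_distrib power2_abs abs_ge_zero)
  then have "(1 - \<epsilon>\<^sup>2) * (norm (x - y))\<^sup>2 \<le> (norm (proj_along n (x - y)))\<^sup>2"
    using norm_proj_along[OF assms(3), of "x - y"] by (simp add: algebra_simps)
  then have "sqrt ((1 - \<epsilon>\<^sup>2) * (norm (x - y))\<^sup>2) \<le> sqrt ((norm (proj_along n (x - y)))\<^sup>2)"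
    by (rule real_sqrt_le_mono)
  then have "sqrt (1 - \<epsilon>\<^sup>2) * norm (x - y) \<le> norm (proj_along n (x - y))"
    by (simp add: real_sqrt_mult)
  moreover have "0 < sqrt (1 - \<epsilon>\<^sup>2)" using assms by (simp add: power_less_one_iff abs_square_less_1)
  ultimately show ?thesis unfolding dist_proj_along by (simp add: dist_norm field_simps)
qed

text \<open>Near each boundary point the inverse of the projection along the normal is Lipschitz on
  a bounded subset of a hyperplane; compactness of the frontier leaves finitely many such
  pieces.\<close>

lemma hausdorff_outer_frontier_finite:
  fixes D :: "'a::euclidean_space set"
  assumes D: "open D" "bounded D" "C1_domain D"
  shows "hausdorff_outer (real (DIM('a) - 1)) (frontier D) < \<infinity>"
proof -
  let ?s = "real (DIM('a) - 1)"
  have loc: "\<exists>r>0. hausdorff_outer ?s (frontier D \<inter> ball y r) < \<infinity>" if y: "y \<in> frontier D" for y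
  proof -
    define n where "n = outer_normal D y"
    have n: "norm n = 1" unfolding n_def by (rule norm_outer_normal[OF D(3) y])
    obtain r where r: "r > 0" "flat_on D n (1/2) (ball y r)"
      unfolding n_def using flat_on_outer_normal[OF D(3) y, of "1/2"] by auto
    let ?A = "frontier D \<inter> ball y r" and ?L = "1 / sqrt (1 - (1/2)\<^sup>2)"
    have "hausdorff_outer ?s ?A \<le> ennreal (?L powr ?s) * hausdorff_outer ?s (proj_along n ` ?A)"
      by (rule hausdorff_outer_le_expanding_image)
         (use flat_on_expanding[OF D(1) r(2) n] in \<open>auto simp: power2_eq_square\<close>)
    also have "\<dots> \<le> ennreal (?L powr ?s) * hausdorff_outer ?s (hyperplane n \<inter> ball 0 (norm y + r))"
    proof (intro mult_left_mono hausdorff_outer_mono)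
      show "proj_along n ` ?A \<subseteq> hyperplane n \<inter> ball 0 (norm y + r)"
      proof (intro image_subsetI IntI proj_along_hyperplane n)
        fix x assume "x \<in> ?A"
        then have "norm x < norm y + r" using norm_triangle_sub[of x y] by (auto simp: dist_norm norm_minus_commute)
        then show "proj_along n x \<in> ball 0 (norm y + r)" using norm_proj_along_le[OF n, of x] by simp
      qed
    qed simp
    also have "\<dots> < \<infinity>"
    proof -
      have "0 < norm y + r" using r(1) norm_ge_zero[of y] by linarith
      then show ?thesis using hausdorff_outer_hyperplane_ball_finite[OF n] by (simp add: ennreal_mult_less_top)
    qed
    finally show ?thesis using r(1) by blast
  qed
  then obtain r where r: "\<And>y. y \<in> frontier D \<Longrightarrow> 0 < r y"
     "\<And>y. y \<in> frontier D \<Longrightarrow> hausdorff_outer ?s (frontier D \<inter> ball y (r y)) < \<infinity>"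
    by metis
  have "compact (frontier D)" using D(2) by (rule compact_frontier_bounded)
  then obtain Y where Y: "Y \<subseteq> frontier D" "finite Y" "frontier D \<subseteq> (\<Union>y\<in>Y. ball y (r y))"
    by (rule compactE_image[of _ "frontier D" "\<lambda>y. ball y (r y)"]) (use r(1) in auto)
  have "hausdorff_outer ?s (frontier D) = emeasure (hausdorff_measure ?s) (frontier D)"
    by (simp add: emeasure_hausdorff_measure)
  also have "\<dots> \<le> emeasure (hausdorff_measure ?s) (\<Union>y\<in>Y. frontier D \<inter> ball y (r y))"
  proof (rule emeasure_mono)
    have "(\<Union>y\<in>Y. frontier D \<inter> ball y (r y)) \<in> sets borel"
      by (intro sets.finite_UN sets.Int Y(2)) auto
    then show "(\<Union>y\<in>Y. frontier D \<inter> ball y (r y)) \<in> sets (hausdorff_measure ?s)" by simp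
  qed (use Y in auto)
  also have "\<dots> \<le> (\<Sum>y\<in>Y. emeasure (hausdorff_measure ?s) (frontier D \<inter> ball y (r y)))"
    using Y by (intro emeasure_subadditive_finite) auto
  also have "\<dots> < \<infinity>"
    using Y r(2) by (auto simp: emeasure_hausdorff_measure)
  finally show ?thesis .
qed

section \<open>Surface measure\<close>

definition surface_measure :: "'a::euclidean_space set \<Rightarrow> 'a measure" where
  "surface_measure D = restrict_space (hausdorff_measure (real (DIM('a) - 1))) (frontier D)"

lemma space_surface_measure [simp]: "space (surface_measure D) = frontier D"
  by (simp add: surface_measure_def space_restrict_space)

lemma sets_surface_measure [measurable_cong]:
  "sets (surface_measure D) = sets (restrict_space borel (frontier D))"
  by (simp add: surface_measure_def sets_restrict_space)

lemma emeasure_surface_measure: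
  fixes D :: "'a::euclidean_space set"
  assumes "A \<in> sets borel" "A \<subseteq> frontier D"
  shows "emeasure (surface_measure D) A = hausdorff_outer (real (DIM('a) - 1)) A"
  using assms by (simp add: surface_measure_def emeasure_restrict_space emeasure_hausdorff_measure sets.Int)

lemma finite_surface_measure:
  assumes "open D" "bounded D" "C1_domain D"
  shows "finite_measure (surface_measure D)"
  using hausdorff_outer_frontier_finite[OF assms]
  by (intro finite_measureI) (simp add: emeasure_surface_measure)

lemma borel_measurable_surface_measure:
  "f \<in> borel_measurable borel \<Longrightarrow> f \<in> borel_measurable (surface_measure D)"
  by (simp add: measurable_cong_sets[OF sets_surface_measure refl] measurable_restrict_space1)

lemma continuous_on_borel_measurable_surface_measure:
  "continuous_on (frontier D) f \<Longrightarrow> f \<in> borel_measurable (surface_measure D)"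
  by (simp add: measurable_cong_sets[OF sets_surface_measure refl] borel_measurable_continuous_on_restrict)

section \<open>Line integrals through a flat boundary piece\<close>

context
  fixes D :: "'a::euclidean_space set" and y n :: 'a and r \<epsilon> :: real and f :: "'a \<Rightarrow> real" and df :: "'a \<Rightarrow> 'a"
  assumes D: "open D" and n: "norm n = 1" and r: "0 < r" and eps: "0 < \<epsilon>"
    and flat: "flat_on D n \<epsilon> (ball y r)"
    and f: "C1_fun f df" "\<And>x. 0 \<le> f x" "\<And>x. x \<notin> ball y r \<Longrightarrow> f x = 0"
begin

lemma local_grad_zero: "x \<notin> ball y r \<Longrightarrow> df x = 0"
  using C1_fun_zero_grad[OF f(1,2)] f(3) by blast

lemma local_integrable: "integrable lborel (\<lambda>x. indicator D x *\<^sub>R df x)"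
proof -
  have "integrable lborel (\<lambda>x. indicator (cball y r) x *\<^sub>R df x)"
    by (rule borel_integrable_compact) (auto intro: C1_fun_continuous_grad[OF f(1)])
  then have "integrable lborel (\<lambda>x. indicator D x *\<^sub>R (indicator (cball y r) x *\<^sub>R df x))"
    by (rule integrable_mult_indicator[rotated]) (use D in simp)
  moreover have "indicator D x *\<^sub>R (indicator (cball y r) x *\<^sub>R df x) = (indicator D x *\<^sub>R df x :: 'a)" for x
    using local_grad_zero[of x] by (auto split: split_indicator)
  ultimately show ?thesis by (simp only:)
qed

definition line_integral :: "'a \<Rightarrow> 'a \<Rightarrow> real" where
  "line_integral e p = (\<integral>s. indicator D (p + s *\<^sub>R e) * (df (p + s *\<^sub>R e) \<bullet> e) \<partial>lborel)"

lemma line_far: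
  assumes e: "norm e = 1" and s: "r + norm (p - y) \<le> \<bar>s\<bar>"
  shows "p + s *\<^sub>R e \<notin> ball y r"
proof -
  have "\<bar>s\<bar> = norm (s *\<^sub>R e)" using e by simp
  also have "s *\<^sub>R e = (p + s *\<^sub>R e - y) - (p - y)" by simp
  also have "norm \<dots> \<le> norm (p + s *\<^sub>R e - y) + norm (p - y)" by (rule norm_triangle_ineq4)
  finally show ?thesis using s by (simp add: dist_norm norm_minus_commute)
qed

lemma line_FTC:
  assumes "norm e = 1" "a \<le> b"
  shows "(\<integral>s. indicator {a..b} s * (df (p + s *\<^sub>R e) \<bullet> e) \<partial>lborel) = f (p + b *\<^sub>R e) - f (p + a *\<^sub>R e)"
proof -
  have "(\<integral>s. indicator {a..b} s *\<^sub>R (df (p + s *\<^sub>R e) \<bullet> e) \<partial>lborel) = f (p + b *\<^sub>R e) - f (p + a *\<^sub>R e)"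
  proof (rule integral_FTC_Icc[OF \<open>a \<le> b\<close>])
    fix s assume "a \<le> s" "s \<le> b"
    have 1: "(f has_derivative (\<lambda>h. df (p + s *\<^sub>R e) \<bullet> h)) (at (p + s *\<^sub>R e))" using f(1) by (simp add: C1_fun_def)
    have 2: "((\<lambda>s. p + s *\<^sub>R e) has_derivative (\<lambda>h. h *\<^sub>R e)) (at s within {a..b})"
      by (auto intro!: derivative_eq_intros)
    have "((\<lambda>s. f (p + s *\<^sub>R e)) has_derivative (\<lambda>h. df (p + s *\<^sub>R e) \<bullet> (h *\<^sub>R e))) (at s within {a..b})"
      using has_derivative_compose[OF 2 1] by simp
    then show "((\<lambda>s. f (p + s *\<^sub>R e)) has_vector_derivative (df (p + s *\<^sub>R e) \<bullet> e)) (at s within {a..b})"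
      by (simp add: has_vector_derivative_def)
  next
    have "continuous_on {a..b} (\<lambda>s. df (p + s *\<^sub>R e))"
      by (rule continuous_on_compose2[OF C1_fun_continuous_grad[OF f(1), of UNIV]]) (auto intro!: continuous_intros)
    then show "continuous_on {a..b} (\<lambda>s. df (p + s *\<^sub>R e) \<bullet> e)" by (intro continuous_intros)
  qed
  then show ?thesis by simp
qed

text \<open>Transversality and the cone condition force the line, within the ball, to be in D before
  the crossing and outside afterwards. The fundamental theorem then leaves only the value at the
  crossing, since f vanishes far out.\<close>

lemma line_integral_crossing:
  assumes e: "norm e = 1" "e \<bullet> n > \<epsilon>" and a: "p + s0 *\<^sub>R e \<in> frontier D \<inter> ball y r"
  shows "line_integral e p = f (p + s0 *\<^sub>R e)"
proof -
  \<comment> \<open>Large enough that the parameter -T is outside the ball, by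
    \<open>line_far\<close>, and not beyond the crossing parameter.\<close>
  define T where "T = r + norm (p - y) + \<bar>s0\<bar>"
  have T: "r + norm (p - y) \<le> T" "- T \<le> s0" by (auto simp: T_def) (use r norm_ge_zero[of "p - y"] in linarith)
  have T0: "0 \<le> T" using r norm_ge_zero[of "p - y"] unfolding T_def by linarith
  have side: "(s < s0 \<longrightarrow> p + s *\<^sub>R e \<in> D) \<and> (s0 < s \<longrightarrow> p + s *\<^sub>R e \<notin> D)" if "p + s *\<^sub>R e \<in> ball y r" for s
  proof -
    have *: "(p + s *\<^sub>R e) - (p + s0 *\<^sub>R e) = (s - s0) *\<^sub>R e" by (simp add: algebra_simps)
    have F: "((s - s0) * (e \<bullet> n) < - \<epsilon> * \<bar>s - s0\<bar> \<longrightarrow> p + s *\<^sub>R e \<in> D) \<and> ((s - s0) * (e \<bullet> n) > \<epsilon> * \<bar>s - s0\<bar> \<longrightarrow> p + s *\<^sub>R e \<notin> D)"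
      using flat[unfolded flat_on_def, rule_format, OF a that] e(1) unfolding * by simp
    show ?thesis
    proof (intro conjI impI)
      assume "s < s0"
      then have "(s0 - s) * \<epsilon> < (s0 - s) * (e \<bullet> n)" using e(2) by (intro mult_strict_left_mono) auto
      then show "p + s *\<^sub>R e \<in> D" using F \<open>s < s0\<close> by (simp add: algebra_simps)
    next
      assume "s0 < s"
      then have "(s - s0) * \<epsilon> < (s - s0) * (e \<bullet> n)" using e(2) by (intro mult_strict_left_mono) auto
      then show "p + s *\<^sub>R e \<notin> D" using F \<open>s0 < s\<close> by (simp add: algebra_simps)
    qed
  qed
  have "line_integral e p = (\<integral>s. indicator {- T..s0} s * (df (p + s *\<^sub>R e) \<bullet> e) \<partial>lborel)"
    unfolding line_integral_def
  proof (rule integral_cong_AE)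
    have [measurable]: "D \<in> sets borel" "df \<in> borel_measurable borel"
      using D f(1) by (auto intro: C1_fun_measurable_grad)
    show "(\<lambda>s. indicator D (p + s *\<^sub>R e) * (df (p + s *\<^sub>R e) \<bullet> e)) \<in> borel_measurable lborel"
      "(\<lambda>s. indicator {- T..s0} s * (df (p + s *\<^sub>R e) \<bullet> e)) \<in> borel_measurable lborel"
      by measurable
    have "AE s in lborel. s \<noteq> s0" by (rule AE_lborel_singleton)
    then show "AE s in lborel. indicator D (p + s *\<^sub>R e) * (df (p + s *\<^sub>R e) \<bullet> e) = indicator {- T..s0} s * (df (p + s *\<^sub>R e) \<bullet> e)"
    proof eventually_elim
      case (elim s)
      show ?case
      proof (cases "p + s *\<^sub>R e \<in> ball y r")
        case True
        then have "- T \<le> s" using line_far[OF e(1), of p s] T by force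
        then show ?thesis using side[OF True] elim by (auto split: split_indicator)
      qed (simp add: local_grad_zero)
    qed
  qed
  also have "\<dots> = f (p + s0 *\<^sub>R e) - f (p + (- T) *\<^sub>R e)"
    by (rule line_FTC[OF e(1) T(2)])
  also have "f (p + (- T) *\<^sub>R e) = 0"
    using T T0 by (intro f(3) line_far e) auto
  finally show ?thesis by simp
qed

text \<open>The part of the line in the ball is connected and misses the frontier, so it lies wholly
  outside or wholly inside D. In the second case f vanishes at both ends.\<close>

lemma line_integral_no_crossing:
  assumes e: "norm e = 1" and a: "\<And>s. p + s *\<^sub>R e \<notin> frontier D \<inter> ball y r"
  shows "line_integral e p = 0"
proof -
  define T where "T = r + norm (p - y)"
  have T0: "0 \<le> T" using r norm_ge_zero[of "p - y"] unfolding T_def by linarith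
  let ?X = "range (\<lambda>s. p + s *\<^sub>R e) \<inter> ball y r"
  have "convex ?X"
  proof (intro convex_Int convex_ball)
    have "range (\<lambda>s. p + s *\<^sub>R e) = (+) p ` ((\<lambda>s. s *\<^sub>R e) ` UNIV)" by auto
    also have "convex \<dots>"
      by (intro convex_translation convex_linear_image) (auto intro!: bounded_linear.linear bounded_linear_scaleR_left)
    finally show "convex (range (\<lambda>s. p + s *\<^sub>R e))" .
  qed
  then have "connected ?X" by (rule convex_connected)
  moreover have "?X \<inter> frontier D = {}" using a by auto
  ultimately have "?X \<inter> D = {} \<or> ?X - D = {}" using connected_Int_frontier[of ?X D] by blast
  then show ?thesis
  proof
    assume X: "?X \<inter> D = {}"
    then have "indicator D (p + s *\<^sub>R e) * (df (p + s *\<^sub>R e) \<bullet> e) = 0" for s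
    proof (cases "p + s *\<^sub>R e \<in> ball y r")
      case True
      then have "p + s *\<^sub>R e \<notin> D" using X by blast
      then show ?thesis by simp
    qed (simp add: local_grad_zero)
    then have "(\<lambda>s. indicator D (p + s *\<^sub>R e) * (df (p + s *\<^sub>R e) \<bullet> e)) = (\<lambda>_. 0)" by blast
    then show ?thesis by (simp only: line_integral_def integral_zero)
  next
    assume X: "?X - D = {}"
    have "indicator D (p + s *\<^sub>R e) * (df (p + s *\<^sub>R e) \<bullet> e) = indicator {-T..T} s * (df (p + s *\<^sub>R e) \<bullet> e)" for s
    proof (cases "p + s *\<^sub>R e \<in> ball y r")
      case True
      then have "s \<in> {-T..T}" using line_far[OF e, of p s] unfolding T_def by force
      moreover have "p + s *\<^sub>R e \<in> D" using X True by blast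
      ultimately show ?thesis by simp
    qed (simp add: local_grad_zero)
    then have "line_integral e p = (\<integral>s. indicator {-T..T} s * (df (p + s *\<^sub>R e) \<bullet> e) \<partial>lborel)"
      by (simp only: line_integral_def)
    also have "\<dots> = f (p + T *\<^sub>R e) - f (p + (- T) *\<^sub>R e)"
      by (rule line_FTC[OF e]) (use T0 in simp)
    also have "f (p + T *\<^sub>R e) = 0" by (intro f(3) line_far e) (use T0 in \<open>simp add: T_def\<close>)
    also have "f (p + (- T) *\<^sub>R e) = 0" by (intro f(3) line_far e) (use T0 in \<open>simp add: T_def\<close>)
    finally show ?thesis by simp
  qed
qed

lemma line_integral_nonneg:
  assumes e: "norm e = 1" "e \<bullet> n > \<epsilon>"
  shows "0 \<le> line_integral e p"
proof (cases "\<exists>s. p + s *\<^sub>R e \<in> frontier D \<inter> ball y r")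
  case True
  then obtain s where s: "p + s *\<^sub>R e \<in> frontier D \<inter> ball y r" ..
  show ?thesis unfolding line_integral_crossing[OF e s] by (rule f(2))
next
  case False
  then show ?thesis by (subst line_integral_no_crossing[OF e(1)]) auto
qed

text \<open>The line through p meets the boundary piece at the point that projects to p, and the
  line integral is the value of f there. Layers of the line integral are therefore shadows of layers
  of f on the boundary.\<close>

lemma line_integral_superlevel:
  assumes e: "norm e = 1" "e \<bullet> n > \<epsilon>" and t: "0 < t"
  shows "{p \<in> hyperplane e. t < line_integral e p} = proj_along e ` {a \<in> frontier D \<inter> ball y r. t < f a}"
proof (intro equalityI subsetI)
  fix p assume p: "p \<in> {p \<in> hyperplane e. t < line_integral e p}"
  then obtain s where s: "p + s *\<^sub>R e \<in> frontier D \<inter> ball y r"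
    using line_integral_no_crossing[OF e(1), of p] t by fastforce
  have "proj_along e (p + s *\<^sub>R e) = p"
    using p e(1) by (simp add: proj_along_def hyperplane_def inner_add_left norm_eq_1)
  then show "p \<in> proj_along e ` {a \<in> frontier D \<inter> ball y r. t < f a}"
    using s p line_integral_crossing[OF e s] by (intro image_eqI[of _ _ "p + s *\<^sub>R e"]) auto
next
  fix p assume "p \<in> proj_along e ` {a \<in> frontier D \<inter> ball y r. t < f a}"
  then obtain a where a: "a \<in> frontier D \<inter> ball y r" "t < f a" "p = proj_along e a" by auto
  then show "p \<in> {p \<in> hyperplane e. t < line_integral e p}"
    using line_integral_crossing[OF e, of p "a \<bullet> e"] by (simp add: proj_along_hyperplane e(1))
qed

text \<open>Fubini for \<open>swept_measure e\<close>, which is c times Lebesgue measure, collects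
  the line integrals into the flux of the gradient in direction e. This is how c gets into the
  divergence theorem.\<close>

lemma line_integral_Fubini:
  assumes e: "norm e = 1" "e \<bullet> n > \<epsilon>" and c: "swept_measure e = density lborel (\<lambda>_. ennreal c)" "0 < c"
  shows "line_integral e \<in> borel_measurable (hyperplane_measure e)"
    and "0 \<le> (\<integral>x. indicator D x *\<^sub>R df x \<partial>lborel) \<bullet> e"
    and "(\<integral>\<^sup>+p. ennreal (line_integral e p) \<partial>hyperplane_measure e) = ennreal (c * ((\<integral>x. indicator D x *\<^sub>R df x \<partial>lborel) \<bullet> e))"
proof -
  interpret P: pair_sigma_finite "hyperplane_measure e" lborel
    using sigma_finite_hyperplane_measure[OF e(1)] lborel.sigma_finite_measure_axioms by (simp add: pair_sigma_finite_def)
  define g where "g x = indicator D x * (df x \<bullet> e)" for x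
  have gm[measurable]: "g \<in> borel_measurable borel"
  proof -
    have [measurable]: "D \<in> sets borel" "df \<in> borel_measurable borel"
      using D f(1) by (auto intro: C1_fun_measurable_grad)
    show ?thesis unfolding g_def by measurable
  qed
  have gi: "integrable lborel g"
    using integrable_inner_left[OF local_integrable, of e] by (simp add: g_def[abs_def])
  have "integrable (swept_measure e) g"
    unfolding c(1) using gi c(2) by (subst integrable_density) auto
  then have gs: "integrable (hyperplane_measure e \<Otimes>\<^sub>M lborel) (\<lambda>x. g (sweep e x))"
    unfolding swept_measure_def by (subst (asm) integrable_distr_eq) auto
  have li: "(\<integral>s. g (sweep e (p, s)) \<partial>lborel) = line_integral e p" for p
    by (simp add: g_def sweep_def line_integral_def)
  have int: "integrable (hyperplane_measure e) (line_integral e)"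
    using P.integrable_fst'[OF gs] unfolding li .
  then show "line_integral e \<in> borel_measurable (hyperplane_measure e)" by simp
  have "c * ((\<integral>x. indicator D x *\<^sub>R df x \<partial>lborel) \<bullet> e) = c * (\<integral>x. g x \<partial>lborel)"
    by (simp add: g_def flip: integral_inner_left[OF local_integrable])
  also have "\<dots> = (\<integral>x. g x \<partial>swept_measure e)"
    unfolding c(1) using c(2) by (subst integral_density) auto
  also have "\<dots> = (\<integral>x. g (sweep e x) \<partial>(hyperplane_measure e \<Otimes>\<^sub>M lborel))"
    unfolding swept_measure_def by (subst integral_distr) auto
  also have "\<dots> = (\<integral>p. line_integral e p \<partial>hyperplane_measure e)"
    using P.integral_fst'[OF gs] unfolding li by simp
  finally have *: "c * ((\<integral>x. indicator D x *\<^sub>R df x \<partial>lborel) \<bullet> e) = (\<integral>p. line_integral e p \<partial>hyperplane_measure e)" .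
  have "0 \<le> (\<integral>p. line_integral e p \<partial>hyperplane_measure e)"
    by (intro Bochner_Integration.integral_nonneg line_integral_nonneg e)
  then show "0 \<le> (\<integral>x. indicator D x *\<^sub>R df x \<partial>lborel) \<bullet> e"
    unfolding *[symmetric] using c(2) by (simp add: zero_le_mult_iff)
  from * show "(\<integral>\<^sup>+p. ennreal (line_integral e p) \<partial>hyperplane_measure e) = ennreal (c * ((\<integral>x. indicator D x *\<^sub>R df x \<partial>lborel) \<bullet> e))"
    using nn_integral_eq_integral[OF int] line_integral_nonneg[OF e] by simp
qed

end

section \<open>The divergence theorem\<close>

text \<open>The direction of the flux vector \<open>G\<close> is forced by its extremality: the bound in the
  directions transversal to the surface leaves no room for a tangential component.\<close>

lemma flux_direction:
  fixes G n :: "'a::real_inner"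
  assumes n: "norm n = 1" and "\<epsilon> \<le> 1/2" and I: "0 \<le> I" and C: "1 \<le> C" "C \<le> 11/10"
    and ub: "\<And>e. norm e = 1 \<Longrightarrow> e \<bullet> n > \<epsilon> \<Longrightarrow> G \<bullet> e \<le> I" and lb: "I \<le> C * (G \<bullet> n)"
  shows "norm (G - I *\<^sub>R n) \<le> sqrt (2 * (1 - 1 / C)) * I"
proof -
  have nn: "n \<bullet> n = 1" using n by (simp add: norm_eq_1)
  define a where "a = G \<bullet> n"
  define T where "T = G - a *\<^sub>R n"
  have Tn: "T \<bullet> n = 0" by (simp add: T_def a_def inner_diff_left nn)
  have GT: "G = a *\<^sub>R n + T" by (simp add: T_def)
  have aI: "a \<le> I" unfolding a_def using assms(2) by (intro ub) (auto simp: n nn)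
  have aC: "I / C \<le> a" using lb C by (simp add: a_def field_simps)
  have "0 \<le> a" using aC I C by (meson divide_nonneg_nonneg order_trans zero_le_one)
  then have a10: "10 * I \<le> 11 * a" using lb mult_right_mono[OF C(2), of a] by (simp add: a_def)
  have G2: "(norm G)\<^sup>2 = a\<^sup>2 + (norm T)\<^sup>2"
    unfolding power2_norm_eq_inner by (subst (1 2) GT) (simp add: inner_add_left inner_add_right inner_commute Tn nn power2_eq_square)
  have T_le: "norm T \<le> sqrt 2 * I"
  proof (cases "T = 0")
    case False
    \<comment> \<open>The direction halfway between n and the tangential part T makes 45 degrees
      with n, hence is transversal, and it detects T with a fixed proportion.\<close>
    define e where "e = (1 / sqrt 2) *\<^sub>R (n + (1 / norm T) *\<^sub>R T)"
    have "(norm (n + (1 / norm T) *\<^sub>R T))\<^sup>2 = 2"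
      unfolding power2_norm_eq_inner using False
      by (simp add: inner_add_left inner_add_right inner_commute Tn nn) (simp add: power2_norm_eq_inner[symmetric] power2_eq_square)
    then have "norm (n + (1 / norm T) *\<^sub>R T) = sqrt 2" by (metis norm_ge_zero real_sqrt_unique)
    then have "norm e = 1" by (simp add: e_def)
    moreover have "e \<bullet> n > \<epsilon>"
    proof -
      have "1 / sqrt 2 > 1 / 2" using real_sqrt_less_mono[of 2 4] by (simp add: field_simps)
      moreover have "e \<bullet> n = 1 / sqrt 2" by (simp add: e_def inner_add_left nn Tn)
      ultimately show ?thesis using assms(2) by linarith
    qed
    ultimately have "G \<bullet> e \<le> I" by (rule ub)
    moreover have "G \<bullet> e = (a + norm T) / sqrt 2"
      using False by (subst GT) (simp add: e_def inner_add_left inner_add_right inner_commute Tn nn n power2_norm_eq_inner[symmetric] power2_eq_square)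
    ultimately have "a + norm T \<le> sqrt 2 * I" by (simp add: field_simps)
    then show ?thesis using a10 I by linarith
  qed (use I in simp)
  then have "(norm T)\<^sup>2 \<le> 2 * I\<^sup>2" using power_mono[OF T_le, of 2] by (simp add: power_mult_distrib)
  moreover have "a\<^sup>2 \<le> I\<^sup>2" using a10 I aI by (intro power_mono) auto
  ultimately have G3: "(norm G)\<^sup>2 \<le> 3 * I\<^sup>2" using G2 by linarith
  \<comment> \<open>A bootstrap: the crude bound by 3 I^2 and the cap 11/10 on C, with 3 * 1.21 < 4,
    keep G within 60 degrees of n. The direction of G itself is then admissible, and testing with it
    gives the sharp bound.\<close>
  have GI: "norm G \<le> I"
  proof (cases "G = 0")
    case False
    then have Ip: "0 < I" using G3 I by (cases "I = 0") auto
    have "(10 * I)\<^sup>2 \<le> (11 * a)\<^sup>2" using a10 I by (intro power_mono) auto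
    then have "100 * I\<^sup>2 \<le> 121 * a\<^sup>2" by (simp add: power_mult_distrib)
    moreover have "0 < I\<^sup>2" using Ip by simp
    moreover have "(2 * a)\<^sup>2 = 4 * a\<^sup>2" by (simp add: power_mult_distrib)
    ultimately have "(norm G)\<^sup>2 < (2 * a)\<^sup>2" using G3 by linarith
    moreover have "0 \<le> 2 * a" using a10 I by linarith
    ultimately have "norm G < 2 * a" by (rule power2_less_imp_less)
    then have "1 / 2 < a / norm G" using False by (simp add: field_simps)
    moreover have "((1 / norm G) *\<^sub>R G) \<bullet> n = a / norm G" by (simp add: a_def)
    ultimately have "((1 / norm G) *\<^sub>R G) \<bullet> n > \<epsilon>" using assms(2) by linarith
    then have "G \<bullet> ((1 / norm G) *\<^sub>R G) \<le> I"
      using False by (intro ub) auto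
    then show ?thesis using False by (simp add: power2_norm_eq_inner[symmetric] power2_eq_square)
  qed (use I in simp)
  have "(norm (G - I *\<^sub>R n))\<^sup>2 = (norm G)\<^sup>2 - 2 * I * a + I\<^sup>2"
    unfolding power2_norm_eq_inner by (simp add: inner_diff_left inner_diff_right inner_commute nn a_def power2_eq_square)
  also have "\<dots> \<le> I\<^sup>2 - 2 * I * (I / C) + I\<^sup>2"
    using GI aC I by (intro add_mono diff_mono power_mono mult_left_mono) auto
  also have "\<dots> = 2 * (1 - 1 / C) * I\<^sup>2" by (simp add: power2_eq_square algebra_simps)
  finally have "sqrt ((norm (G - I *\<^sub>R n))\<^sup>2) \<le> sqrt (2 * (1 - 1 / C) * I\<^sup>2)" by (rule real_sqrt_le_mono)
  then show ?thesis using I by (simp add: real_sqrt_mult)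
qed

text \<open>Projecting the boundary along \<open>e\<close> does not increase its measure, which bounds the flux in every
  transversal direction from above; along the normal the projection is almost isometric, which
  bounds it from below.\<close>

lemma flux_local:
  fixes D :: "'a::euclidean_space set"
  assumes D: "open D" and fin: "finite_measure (surface_measure D)" and n: "norm n = 1" and r: "0 < r" and eps: "0 < \<epsilon>" "\<epsilon> \<le> 1/2"
    and flat: "flat_on D n \<epsilon> (ball y r)"
    and f: "C1_fun f df" "\<And>x. 0 \<le> f x" "\<And>x. x \<notin> ball y r \<Longrightarrow> f x = 0"
    and int: "integrable (surface_measure D) f"
    and c: "0 < c" "\<And>e :: 'a. norm e = 1 \<Longrightarrow> swept_measure e = density lborel (\<lambda>_. ennreal c)"
    and C: "C = (1 / sqrt (1 - \<epsilon>\<^sup>2)) powr real (DIM('a) - 1)" "C \<le> 11/10"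
  shows "norm (c *\<^sub>R (\<integral>x. indicator D x *\<^sub>R df x \<partial>lborel) - (\<integral>x. f x \<partial>surface_measure D) *\<^sub>R n)
    \<le> sqrt (2 * (1 - 1 / C)) * (\<integral>x. f x \<partial>surface_measure D)"
proof -
  define G where "G = (\<integral>x. indicator D x *\<^sub>R df x \<partial>lborel)"
  define J where "J = (\<integral>x. f x \<partial>surface_measure D)"
  interpret S: finite_measure "surface_measure D" by fact
  let ?s = "real (DIM('a) - 1)"
  let ?li = "line_integral D df"
  note ctx = D n r eps(1) flat f
  have fm[measurable]: "f \<in> borel_measurable (surface_measure D)"
    using f(1) by (intro borel_measurable_surface_measure C1_fun_measurable)
  have J: "(\<integral>\<^sup>+x. ennreal (f x) \<partial>surface_measure D) = ennreal J" "0 \<le> J"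
    unfolding J_def using int f(2) by (auto intro!: nn_integral_eq_integral Bochner_Integration.integral_nonneg)
  have L1: "1 \<le> 1 / sqrt (1 - \<epsilon>\<^sup>2)" and L0: "\<epsilon> < 1"
  proof -
    have "\<epsilon>\<^sup>2 < 1" using eps by (simp add: abs_square_less_1)
    then show "1 \<le> 1 / sqrt (1 - \<epsilon>\<^sup>2)" by (simp add: field_simps)
    show "\<epsilon> < 1" using eps by simp
  qed
  have C1: "1 \<le> C" unfolding C(1) using L1 by (intro ge_one_powr_ge_zero) auto
  have sets_f: "{a \<in> frontier D. t < f a} \<in> sets borel" for t
  proof -
    have [measurable]: "f \<in> borel_measurable borel" using f(1) by (rule C1_fun_measurable)
    have "frontier D \<inter> {a. t < f a} \<in> sets borel" by (intro sets.Int) auto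
    also have "frontier D \<inter> {a. t < f a} = {a \<in> frontier D. t < f a}" by auto
    finally show ?thesis .
  qed
  \<comment> \<open>As f vanishes off the ball, boundary points with positive level lie in the flat
    region, where the projections are controlled.\<close>
  have supp: "{a \<in> frontier D \<inter> ball y r. t < f a} = {a \<in> frontier D. t < f a}" if "0 < t" for t
    using f(3) that by force
  have emS: "emeasure (surface_measure D) {a \<in> space (surface_measure D). t < f a} = hausdorff_outer ?s {a \<in> frontier D. t < f a}" for t
    using sets_f[of t] by (simp only: space_surface_measure) (rule emeasure_surface_measure, auto)
  have emP: "emeasure (hyperplane_measure e) {p \<in> space (hyperplane_measure e). t < ?li e p}
      = hausdorff_outer ?s (proj_along e ` {a \<in> frontier D. t < f a})" if e: "norm e = 1" "e \<bullet> n > \<epsilon>" and t: "0 < t" for e t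
  proof -
    have [measurable]: "?li e \<in> borel_measurable (hyperplane_measure e)"
      by (rule line_integral_Fubini[OF ctx e c(2)[OF e(1)] c(1)])
    have A: "emeasure (hyperplane_measure e) {p \<in> space (hyperplane_measure e). t < ?li e p}
      = hausdorff_outer ?s {p \<in> space (hyperplane_measure e). t < ?li e p}"
      by (rule emeasure_hyperplane_measure_sets) measurable
    have B: "{p \<in> space (hyperplane_measure e). t < ?li e p} = proj_along e ` {a \<in> frontier D \<inter> ball y r. t < f a}"
      unfolding space_hyperplane_measure by (rule line_integral_superlevel[OF ctx e t])
    show ?thesis by (rule trans[OF A arg_cong[OF B[unfolded supp[OF t]], of "hausdorff_outer ?s"]])
  qed
  have Fub: "?li e \<in> borel_measurable (hyperplane_measure e)" "0 \<le> G \<bullet> e"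
    "(\<integral>\<^sup>+p. ennreal (?li e p) \<partial>hyperplane_measure e) = ennreal (c * (G \<bullet> e))"
    if e: "norm e = 1" "e \<bullet> n > \<epsilon>" for e
    unfolding G_def using line_integral_Fubini[OF ctx e c(2)[OF e(1)] c(1)] by auto
  have ub: "(c *\<^sub>R G) \<bullet> e \<le> J" if e: "norm e = 1" "e \<bullet> n > \<epsilon>" for e
  proof -
    have "(\<integral>\<^sup>+p. ennreal (?li e p) \<partial>hyperplane_measure e) \<le> 1 * (\<integral>\<^sup>+x. ennreal (f x) \<partial>surface_measure D)"
    proof (rule nn_integral_mono_superlevel[OF sigma_finite_hyperplane_measure[OF e(1)] S.sigma_finite_measure_axioms Fub(1)[OF e] fm])
      fix t :: real assume "0 < t"
      then show "emeasure (hyperplane_measure e) {x \<in> space (hyperplane_measure e). t < ?li e x}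
           \<le> 1 * emeasure (surface_measure D) {x \<in> space (surface_measure D). t < f x}"
        unfolding emS emP[OF e \<open>0 < t\<close>] by (simp only: mult_1) (rule hausdorff_outer_proj_le[OF e(1)], simp)
    qed
    then show ?thesis using J c(1) Fub(2)[OF e] by (simp add: Fub(3)[OF e])
  qed
  have nn: "n \<bullet> n > \<epsilon>" using n L0 by (simp add: norm_eq_1)
  have lb: "J \<le> C * ((c *\<^sub>R G) \<bullet> n)"
  proof -
    have "(\<integral>\<^sup>+x. ennreal (f x) \<partial>surface_measure D) \<le> ennreal C * (\<integral>\<^sup>+p. ennreal (?li n p) \<partial>hyperplane_measure n)"
    proof (rule nn_integral_mono_superlevel[OF S.sigma_finite_measure_axioms sigma_finite_hyperplane_measure[OF n] fm Fub(1)[OF n nn]])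
      fix t :: real assume t: "0 < t"
      have "hausdorff_outer ?s {a \<in> frontier D. t < f a} \<le> ennreal C * hausdorff_outer ?s (proj_along n ` {a \<in> frontier D. t < f a})"
        unfolding C(1) supp[OF t, symmetric]
      proof (rule hausdorff_outer_le_expanding_image)
        show "0 < 1 / sqrt (1 - \<epsilon>\<^sup>2)" using L1 by linarith
        show "dist x z \<le> 1 / sqrt (1 - \<epsilon>\<^sup>2) * dist (proj_along n x) (proj_along n z)"
          if "x \<in> {a \<in> frontier D \<inter> ball y r. t < f a}" "z \<in> {a \<in> frontier D \<inter> ball y r. t < f a}" for x z
          using that eps L0 by (intro flat_on_expanding[OF D flat n]) auto
      qed simp
      then show "emeasure (surface_measure D) {x \<in> space (surface_measure D). t < f x}
           \<le> ennreal C * emeasure (hyperplane_measure n) {x \<in> space (hyperplane_measure n). t < ?li n x}"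
        unfolding emS emP[OF n nn t] .
    qed
    then have "ennreal J \<le> ennreal (C * (c * (G \<bullet> n)))"
      using C1 by (simp add: J(1) Fub(3)[OF n nn] ennreal_mult')
    then show ?thesis using C1 c(1) Fub(2)[OF n nn] by (simp add: ennreal_le_iff)
  qed
  show ?thesis
    unfolding G_def[symmetric] J_def[symmetric]
    by (rule flux_direction[OF n eps(2) J(2) C1 C(2) ub lb])
qed

text \<open>The expansion constant tends to 1 as \<epsilon> tends to 0. The bounds 1/2 and 11/10 are
  those required by \<open>flux_direction\<close>; \<open>2 * \<epsilon>\<close> is the deviation of
  the normal allowed by \<open>flat_on_normal_close\<close>.\<close>

lemma flux_constant_close_to_one:
  fixes s \<delta> :: real
  assumes "0 < \<delta>"
  shows "\<exists>\<epsilon>>0. \<epsilon> \<le> 1/2 \<and> 2 * \<epsilon> \<le> \<delta> \<and> (1 / sqrt (1 - \<epsilon>\<^sup>2)) powr s \<le> 11/10 \<and> sqrt (2 * (1 - 1 / ((1 / sqrt (1 - \<epsilon>\<^sup>2)) powr s))) \<le> \<delta>"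
proof -
  have t1: "((\<lambda>\<epsilon>::real. (1 / sqrt (1 - \<epsilon>\<^sup>2)) powr s) \<longlongrightarrow> (1 / sqrt (1 - 0\<^sup>2)) powr s) (at_right 0)"
    by (intro tendsto_intros) auto
  then have t2: "((\<lambda>\<epsilon>::real. sqrt (2 * (1 - 1 / ((1 / sqrt (1 - \<epsilon>\<^sup>2)) powr s)))) \<longlongrightarrow> sqrt (2 * (1 - 1 / ((1 / sqrt (1 - 0\<^sup>2)) powr s)))) (at_right 0)"
    by (intro tendsto_intros) auto
  have e1: "\<forall>\<^sub>F \<epsilon> in at_right (0::real). (1 / sqrt (1 - \<epsilon>\<^sup>2)) powr s < 11/10"
    using order_tendstoD(2)[OF t1, of "11/10"] by simp
  have e2: "\<forall>\<^sub>F \<epsilon> in at_right (0::real). sqrt (2 * (1 - 1 / ((1 / sqrt (1 - \<epsilon>\<^sup>2)) powr s))) < \<delta>"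
    using order_tendstoD(2)[OF t2, of \<delta>] assms by simp
  have e3: "\<forall>\<^sub>F \<epsilon> in at_right (0::real). \<epsilon> \<in> {0<..<min (1/2) (\<delta>/2)}"
    using assms by (intro eventually_at_right_real) auto
  from eventually_conj[OF e1 eventually_conj[OF e2 e3]]
  obtain \<epsilon> :: real where "(1 / sqrt (1 - \<epsilon>\<^sup>2)) powr s < 11/10" "sqrt (2 * (1 - 1 / ((1 / sqrt (1 - \<epsilon>\<^sup>2)) powr s))) < \<delta>"
     "\<epsilon> \<in> {0<..<min (1/2) (\<delta>/2)}"
    by (metis (mono_tags, lifting) eventually_happens' trivial_limit_at_right_real)
  then show ?thesis by (intro exI[of _ \<epsilon>]) auto
qed

text \<open>A quotient A / (A + B) in the squared distance, where A and B are squared positive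
  parts: squaring makes them C1, A vanishes beyond r, B vanishes within r / 2, and they are never
  zero together.\<close>

lemma C1_bump:
  fixes y :: "'a::euclidean_space"
  assumes r: "0 < r"
  obtains \<theta> d\<theta> where "C1_fun \<theta> d\<theta>" "\<And>x. 0 \<le> \<theta> x" "\<And>x. \<theta> x \<le> 1"
    "\<And>x. x \<notin> ball y r \<Longrightarrow> \<theta> x = 0" "\<And>x. x \<in> ball y (r/2) \<Longrightarrow> \<theta> x = 1"
proof -
  define m where "m t = (max 0 t)\<^sup>2" for t :: real
  define A where "A t = m (r\<^sup>2 - t)" for t
  define B where "B t = m (t - r\<^sup>2/4)" for t
  have dm: "(m has_real_derivative 2 * max 0 t) (at t)" for t
  proof (cases t "0::real" rule: linorder_cases)
    case less
    have "((\<lambda>_. 0) has_real_derivative 2 * max 0 t) (at t)" using less by (auto intro!: derivative_eq_intros)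
    then show ?thesis
      by (rule has_field_derivative_transform_within_open[of _ _ _ "{..<0}"]) (use less in \<open>auto simp: m_def\<close>)
  next
    case greater
    have "((\<lambda>t. t\<^sup>2) has_real_derivative 2 * max 0 t) (at t)" using greater by (auto intro!: derivative_eq_intros)
    then show ?thesis
      by (rule has_field_derivative_transform_within_open[of _ _ _ "{0<..}"]) (use greater in \<open>auto simp: m_def\<close>)
  next
    case equal
    have "((\<lambda>h. (m (0 + h) - m 0) / h) \<longlongrightarrow> 0) (at 0)"
    proof (rule Lim_null_comparison)
      show "\<forall>\<^sub>F h in at 0. norm ((m (0 + h) - m 0) / h) \<le> \<bar>h\<bar>"
        by (intro always_eventually allI) (auto simp: m_def max_def power2_eq_square)
      show "((\<lambda>h::real. \<bar>h\<bar>) \<longlongrightarrow> 0) (at 0)" by (auto intro!: tendsto_eq_intros)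
    qed
    then show ?thesis using equal by (simp add: DERIV_def)
  qed
  have mc: "continuous_on UNIV m" using dm DERIV_isCont continuous_at_imp_continuous_on by blast
  have pos: "0 < A t + B t" for t
  proof (cases "t < r\<^sup>2")
    case True then show ?thesis using r by (auto simp: A_def B_def m_def intro!: add_pos_nonneg)
  next
    case False
    then have "r\<^sup>2 / 4 < t" using zero_less_power[OF r, of 2] by linarith
    then show ?thesis by (auto simp: A_def B_def m_def intro!: add_nonneg_pos)
  qed
  define q where "q t = A t / (A t + B t)" for t
  define A' where "A' t = 2 * max 0 (r\<^sup>2 - t) * (- 1)" for t
  define B' where "B' t = 2 * max 0 (t - r\<^sup>2/4) * 1" for t
  define q' where "q' t = (A' t * (A t + B t) - A t * (A' t + B' t)) / ((A t + B t) * (A t + B t))" for t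
  have dA: "(A has_real_derivative A' t) (at t)" for t
    unfolding A_def A'_def by (rule DERIV_chain2[OF dm]) (auto intro!: derivative_eq_intros)
  have dB: "(B has_real_derivative B' t) (at t)" for t
    unfolding B_def B'_def by (rule DERIV_chain2[OF dm]) (auto intro!: derivative_eq_intros)
  have dq: "(q has_real_derivative q' t) (at t)" for t
    unfolding q_def q'_def using pos[of t] by (intro DERIV_divide DERIV_add dA dB) auto
  have cA: "continuous_on UNIV A" "continuous_on UNIV B"
    using dA dB DERIV_isCont continuous_at_imp_continuous_on by blast+
  have cq: "continuous_on UNIV q'"
  proof -
    have "A t + B t \<noteq> 0" for t using pos[of t] by simp
    then show ?thesis unfolding q'_def A'_def B'_def by (intro continuous_intros cA) auto
  qed
  define N where "N x = (x - y) \<bullet> (x - y)" for x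
  have N: "C1_fun N (\<lambda>x. 2 *\<^sub>R (x - y))"
    unfolding C1_fun_def N_def
    by (auto intro!: derivative_eq_intros continuous_intros simp: inner_commute algebra_simps)
  have Nn: "N x = (dist y x)\<^sup>2" for x by (simp add: N_def dist_norm power2_norm_eq_inner norm_minus_commute)
  show ?thesis
  proof (rule that[of "\<lambda>x. q (N x)" "\<lambda>x. q' (N x) *\<^sub>R (2 *\<^sub>R (x - y))"])
    show "C1_fun (\<lambda>x. q (N x)) (\<lambda>x. q' (N x) *\<^sub>R (2 *\<^sub>R (x - y)))"
      by (rule C1_fun_compose[OF N dq cq])
    have AB: "0 \<le> A t" "0 \<le> B t" for t by (simp_all add: A_def B_def m_def)
    then show "0 \<le> q (N x)" "q (N x) \<le> 1" for x
      using pos[of "N x"] by (simp_all add: q_def)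
    show "q (N x) = 0" if "x \<notin> ball y r" for x
    proof -
      have "r\<^sup>2 \<le> N x" unfolding Nn using that r by (intro power_mono) auto
      then show ?thesis by (simp add: q_def A_def m_def)
    qed
    show "q (N x) = 1" if "x \<in> ball y (r/2)" for x
    proof -
      have "N x \<le> (r/2)\<^sup>2" unfolding Nn using that r by (intro power_mono) auto
      then have "B (N x) = 0" by (simp add: B_def m_def power_divide)
      then show ?thesis using pos[of "N x"] by (simp add: q_def)
    qed
  qed
qed

lemma integrable_continuous_surface:
  fixes D :: "'a::euclidean_space set" and f :: "'a \<Rightarrow> 'b::euclidean_space"
  assumes D: "open D" "bounded D" "C1_domain D" and f: "continuous_on (frontier D) f"
  shows "integrable (surface_measure D) f"
proof -
  interpret S: finite_measure "surface_measure D" by (rule finite_surface_measure[OF D])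
  have "bounded (f ` frontier D)"
    using f compact_frontier_bounded[OF D(2)] by (intro compact_imp_bounded compact_continuous_image)
  then obtain K where "\<And>x. x \<in> frontier D \<Longrightarrow> norm (f x) \<le> K" unfolding bounded_iff by auto
  then show ?thesis
    using f by (intro S.integrable_const_bound[of _ K] AE_I2 continuous_on_borel_measurable_surface_measure) auto
qed

lemma integrable_continuous_domain:
  fixes D :: "'a::euclidean_space set" and f :: "'a \<Rightarrow> 'b::{banach, second_countable_topology}"
  assumes D: "open D" "bounded D" and f: "continuous_on (closure D) f"
  shows "integrable lborel (\<lambda>x. indicator D x *\<^sub>R f x)"
proof -
  have "integrable lborel (\<lambda>x. indicator (closure D) x *\<^sub>R f x)"
    using D by (intro borel_integrable_compact f) (simp add: compact_closure)
  then have "integrable lborel (\<lambda>x. indicator D x *\<^sub>R (indicator (closure D) x *\<^sub>R f x))"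
    by (rule integrable_mult_indicator[rotated]) (use D in simp)
  moreover have "indicator D x *\<^sub>R (indicator (closure D) x *\<^sub>R f x) = indicator D x *\<^sub>R f x" for x
    using closure_subset[of D] by (auto split: split_indicator)
  ultimately show ?thesis by (simp only:)
qed

text \<open>The error is proportional to the boundary integral of f itself. It can therefore be
  summed over many localised pieces without growing.\<close>

lemma flux_closure:
  fixes D :: "'a::euclidean_space set"
  assumes D: "open D" "bounded D" "C1_domain D" and y: "y \<in> closure D" and "0 < \<delta>"
    and c: "0 < c" "\<And>e :: 'a. norm e = 1 \<Longrightarrow> swept_measure e = density lborel (\<lambda>_. ennreal c)"
  shows "\<exists>r>0. \<forall>f df. C1_fun f df \<longrightarrow> (\<forall>x. 0 \<le> f x) \<longrightarrow> (\<forall>x. x \<notin> ball y r \<longrightarrow> f x = 0) \<longrightarrow>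
    norm (c *\<^sub>R (\<integral>x. indicator D x *\<^sub>R df x \<partial>lborel) - (\<integral>x. f x *\<^sub>R outer_normal D x \<partial>surface_measure D))
      \<le> 2 * \<delta> * (\<integral>x. f x \<partial>surface_measure D)"
proof -
  obtain \<epsilon> where eps: "0 < \<epsilon>" "\<epsilon> \<le> 1/2" "2 * \<epsilon> \<le> \<delta>"
    and C: "(1 / sqrt (1 - \<epsilon>\<^sup>2)) powr real (DIM('a) - 1) \<le> 11/10"
      "sqrt (2 * (1 - 1 / ((1 / sqrt (1 - \<epsilon>\<^sup>2)) powr real (DIM('a) - 1)))) \<le> \<delta>"
    using flux_constant_close_to_one[OF \<open>0 < \<delta>\<close>, of "real (DIM('a) - 1)"] by blast
  have "\<exists>r>0. \<exists>n. norm n = 1 \<and> flat_on D n \<epsilon> (ball y r)"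
  proof (cases "y \<in> D")
    case True
    then obtain r where r: "r > 0" "ball y r \<subseteq> D" using D(1) open_contains_ball by blast
    have "frontier D \<inter> ball y r = {}" using r(2) D(1) by (auto simp: frontier_def interior_open)
    \<comment> \<open>For an interior point the ball contains no frontier, so flatness is vacuous
      and any unit vector can play the normal.\<close>
    moreover obtain b :: 'a where "b \<in> Basis" using nonempty_Basis by blast
    ultimately show ?thesis using r(1) by (intro exI[of _ r] exI[of _ b] conjI) (auto simp: flat_on_def)
  next
    case False
    then have "y \<in> frontier D" using y D(1) by (simp add: frontier_def interior_open)
    then show ?thesis using flat_on_outer_normal[OF D(3), of y \<epsilon>] norm_outer_normal[OF D(3), of y] eps(1) by blast
  qed
  then obtain r n where r: "r > 0" and n: "norm n = 1" and flat: "flat_on D n \<epsilon> (ball y r)" by blast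
  interpret S: finite_measure "surface_measure D" by (rule finite_surface_measure[OF D])
  show ?thesis
  proof (intro exI[of _ r] conjI r allI impI)
    fix f df assume f: "C1_fun f df" "\<forall>x. 0 \<le> f x" "\<forall>x. x \<notin> ball y r \<longrightarrow> f x = (0::real)"
    let ?G = "c *\<^sub>R (\<integral>x. indicator D x *\<^sub>R df x \<partial>lborel)" and ?V = "\<integral>x. f x *\<^sub>R outer_normal D x \<partial>surface_measure D"
    let ?J = "\<integral>x. f x \<partial>surface_measure D"
    have int: "integrable (surface_measure D) f"
      by (rule integrable_continuous_surface[OF D C1_fun_continuous[OF f(1)]])
    have intV: "integrable (surface_measure D) (\<lambda>x. f x *\<^sub>R outer_normal D x)"
      by (intro integrable_continuous_surface[OF D] continuous_on_scaleR C1_fun_continuous[OF f(1)] continuous_on_outer_normal D)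
    have J: "0 \<le> ?J" using f(2) by (intro Bochner_Integration.integral_nonneg) auto
    have 1: "norm (?G - ?J *\<^sub>R n) \<le> \<delta> * ?J"
    proof -
      have "norm (?G - ?J *\<^sub>R n) \<le> sqrt (2 * (1 - 1 / ((1 / sqrt (1 - \<epsilon>\<^sup>2)) powr real (DIM('a) - 1)))) * ?J"
        by (rule flux_local[OF D(1) S.finite_measure_axioms n r eps(1,2) flat f(1) _ _ int c refl C(1)]) (use f in auto)
      also have "\<dots> \<le> \<delta> * ?J" using C(2) J by (rule mult_right_mono)
      finally show ?thesis .
    qed
    have "?V - ?J *\<^sub>R n = (\<integral>x. f x *\<^sub>R (outer_normal D x - n) \<partial>surface_measure D)"
      using int intV by (simp add: scaleR_diff_right flip: integral_scaleR_left)
    also have "norm \<dots> \<le> (\<integral>x. \<delta> * f x \<partial>surface_measure D)"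
    proof (rule order_trans[OF integral_norm_bound Bochner_Integration.integral_mono])
      show "integrable (surface_measure D) (\<lambda>x. norm (f x *\<^sub>R (outer_normal D x - n)))"
        using int intV by (intro integrable_norm) (simp add: scaleR_diff_right)
      show "integrable (surface_measure D) (\<lambda>x. \<delta> * f x)" using int by simp
      fix x assume x: "x \<in> space (surface_measure D)"
      show "norm (f x *\<^sub>R (outer_normal D x - n)) \<le> \<delta> * f x"
      proof (cases "x \<in> ball y r")
        case True
        have "norm (outer_normal D x - n) \<le> 2 * \<epsilon>"
          using x True by (intro flat_on_normal_close[OF flat n _ is_outer_normal_outer_normal[OF D(3)] eps(1)]) auto
        then have "f x * norm (outer_normal D x - n) \<le> f x * \<delta>"
          using f(2) eps(3) by (intro mult_left_mono) auto
        then show ?thesis using f(2) by (simp add: mult.commute)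
      qed (use f(3) in simp)
    qed
    finally have 2: "norm (?V - ?J *\<^sub>R n) \<le> \<delta> * ?J" by simp
    \<comment> \<open>One \<delta> comes from the flux estimate with the constant vector n, the
      other from replacing n by the true normal.\<close>
    have "norm (?G - ?V) \<le> norm (?G - ?J *\<^sub>R n) + norm (?V - ?J *\<^sub>R n)"
      using norm_triangle_ineq4[of "?G - ?J *\<^sub>R n" "?V - ?J *\<^sub>R n"] by simp
    then show "norm (?G - ?V) \<le> 2 * \<delta> * ?J" using 1 2 by linarith
  qed
qed

text \<open>Nonnegativity makes the local errors add up to at most 2 \<delta> times the boundary
  integral of f, for every \<delta>, so the total error is zero.\<close>

lemma flux_nonneg:
  fixes D :: "'a::euclidean_space set"
  assumes D: "open D" "bounded D" "C1_domain D"
    and c: "0 < c" "\<And>e :: 'a. norm e = 1 \<Longrightarrow> swept_measure e = density lborel (\<lambda>_. ennreal c)"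
    and f: "C1_fun f df" "\<And>x. 0 \<le> f x"
  shows "c *\<^sub>R (\<integral>x. indicator D x *\<^sub>R df x \<partial>lborel) = (\<integral>x. f x *\<^sub>R outer_normal D x \<partial>surface_measure D)"
proof -
  let ?\<sigma> = "surface_measure D"
  define E where "E f df = c *\<^sub>R (\<integral>x. indicator D x *\<^sub>R df x \<partial>lborel) - (\<integral>x. f x *\<^sub>R outer_normal D x \<partial>?\<sigma>)" for f :: "'a \<Rightarrow> real" and df
  define J where "J f = (\<integral>x. f x \<partial>?\<sigma>)" for f :: "'a \<Rightarrow> real"
  have int: "integrable ?\<sigma> f" "integrable ?\<sigma> (\<lambda>x. f x *\<^sub>R outer_normal D x)" "integrable lborel (\<lambda>x. indicator D x *\<^sub>R df x)"
    if "C1_fun f df" for f df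
    by (rule integrable_continuous_surface[OF D C1_fun_continuous[OF that]],
        rule integrable_continuous_surface[OF D continuous_on_scaleR[OF C1_fun_continuous[OF that] continuous_on_outer_normal[OF D(3)]]],
        rule integrable_continuous_domain[OF D(1,2) C1_fun_continuous_grad[OF that]])
  have E_add: "E (\<lambda>x. f x + g x) (\<lambda>x. df x + dg x) = E f df + E g dg" and J_add: "J (\<lambda>x. f x + g x) = J f + J g"
    if "C1_fun f df" "C1_fun g dg" for f df g dg
    using int[OF that(1)] int[OF that(2)] by (simp_all add: E_def J_def scaleR_add_left scaleR_add_right)
  have bound: "norm (E f df) \<le> 2 * \<delta> * J f" if \<delta>: "0 < \<delta>" for \<delta>
  proof -
    have "\<forall>y\<in>closure D. \<exists>r>0. \<forall>f df. C1_fun f df \<longrightarrow> (\<forall>x. 0 \<le> f x) \<longrightarrow> (\<forall>x. x \<notin> ball y r \<longrightarrow> f x = 0) \<longrightarrow> norm (E f df) \<le> 2 * \<delta> * J f"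
      unfolding E_def J_def using flux_closure[OF D _ \<delta> c] by blast
    from bchoice[OF this] obtain r where r': "\<forall>y\<in>closure D. 0 < r y \<and> (\<forall>f df. C1_fun f df \<longrightarrow> (\<forall>x. 0 \<le> f x) \<longrightarrow> (\<forall>x. x \<notin> ball y (r y) \<longrightarrow> f x = 0) \<longrightarrow> norm (E f df) \<le> 2 * \<delta> * J f)" ..
    have r: "0 < r y" "C1_fun f df \<Longrightarrow> (\<And>x. 0 \<le> f x) \<Longrightarrow> (\<And>x. x \<notin> ball y (r y) \<Longrightarrow> f x = 0) \<Longrightarrow> norm (E f df) \<le> 2 * \<delta> * J f"
      if "y \<in> closure D" for y f df
      using r' that by blast+
    \<comment> \<open>Induction over a finite cover replaces a partition of unity: f splits into
      \<open>f * \<theta>\<close>, which is localised at y, and \<open>f - f * \<theta>\<close>,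
      which vanishes on the half ball at y and so is handled by the remaining centres. Both parts
      stay nonnegative.\<close>
    have claim: "norm (E f df) \<le> 2 * \<delta> * J f"
      if "finite Y" "Y \<subseteq> closure D" "C1_fun f df" "\<And>x. 0 \<le> f x"
        "\<And>x. x \<in> closure D \<Longrightarrow> x \<notin> (\<Union>y\<in>Y. ball y (r y / 2)) \<Longrightarrow> f x = 0" for Y f df
      using that
    proof (induction Y arbitrary: f df)
      case empty
      have 0: "f x = 0" if "x \<in> closure D" for x using empty.prems that by auto
      have "df x = 0" if "x \<in> D" for x
        using C1_fun_zero_grad[OF empty.prems(2,3)] 0 closure_subset that by blast
      then have "(\<lambda>x. indicator D x *\<^sub>R df x) = (\<lambda>_. 0)" by (auto split: split_indicator)
      moreover have "(\<integral>x. f x *\<^sub>R outer_normal D x \<partial>?\<sigma>) = (\<integral>x. 0 \<partial>?\<sigma>)" "J f = (\<integral>x. 0 \<partial>?\<sigma>)"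
        unfolding J_def by (intro Bochner_Integration.integral_cong; auto simp: 0 frontier_def)+
      ultimately show ?case by (simp add: E_def)
    next
      case (insert y Y)
      have y: "y \<in> closure D" using insert.prems by auto
      obtain \<theta> d\<theta> where \<theta>: "C1_fun \<theta> d\<theta>" "\<And>x. 0 \<le> \<theta> x" "\<And>x. \<theta> x \<le> 1"
        "\<And>x. x \<notin> ball y (r y) \<Longrightarrow> \<theta> x = 0" "\<And>x. x \<in> ball y (r y / 2) \<Longrightarrow> \<theta> x = 1"
        using C1_bump[OF r(1)[OF y]] by blast
      obtain d1 where d1: "C1_fun (\<lambda>x. f x * \<theta> x) d1" using C1_fun_mult[OF insert.prems(2) \<theta>(1)] by blast
      have d2: "C1_fun (\<lambda>x. f x - f x * \<theta> x) (\<lambda>x. df x - d1 x)" by (rule C1_fun_diff[OF insert.prems(2) d1])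
      have "norm (E (\<lambda>x. f x * \<theta> x) d1) \<le> 2 * \<delta> * J (\<lambda>x. f x * \<theta> x)"
        by (rule r(2)[OF y d1]) (use insert.prems(3) \<theta> in auto)
      moreover have "norm (E (\<lambda>x. f x - f x * \<theta> x) (\<lambda>x. df x - d1 x)) \<le> 2 * \<delta> * J (\<lambda>x. f x - f x * \<theta> x)"
      proof (rule insert.IH[OF _ d2])
        show "0 \<le> f x - f x * \<theta> x" for x
          using mult_left_mono[OF \<theta>(3)[of x] insert.prems(3)[of x]] by simp
        show "f x - f x * \<theta> x = 0" if "x \<in> closure D" "x \<notin> (\<Union>y\<in>Y. ball y (r y / 2))" for x
          using insert.prems(4)[OF that(1)] that(2) \<theta>(5)[of x] by (cases "x \<in> ball y (r y / 2)") auto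
      qed (use insert.prems in auto)
      moreover have "E f df = E (\<lambda>x. f x * \<theta> x) d1 + E (\<lambda>x. f x - f x * \<theta> x) (\<lambda>x. df x - d1 x)"
        using E_add[OF d1 d2] by simp
      moreover have "J f = J (\<lambda>x. f x * \<theta> x) + J (\<lambda>x. f x - f x * \<theta> x)"
        using J_add[OF d1 d2] by simp
      ultimately show ?case
        using norm_triangle_ineq[of "E (\<lambda>x. f x * \<theta> x) d1" "E (\<lambda>x. f x - f x * \<theta> x) (\<lambda>x. df x - d1 x)"]
        by (simp add: distrib_left)
    qed
    have "compact (closure D)" using D(2) by (simp add: compact_closure)
    then obtain Y where Y: "Y \<subseteq> closure D" "finite Y" "closure D \<subseteq> (\<Union>y\<in>Y. ball y (r y / 2))"
      by (rule compactE_image[of _ "closure D" "\<lambda>y. ball y (r y / 2)"]) (use r(1) in force)+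
    show ?thesis by (rule claim[OF Y(2,1) f]) (use Y(3) in auto)
  qed
  have "norm (E f df) \<le> 0"
  proof (rule field_le_epsilon)
    fix e :: real assume "0 < e"
    have J0: "0 \<le> J f" unfolding J_def using f(2) by (intro Bochner_Integration.integral_nonneg) auto
    have "norm (E f df) \<le> 2 * (e / (2 * (J f + 1))) * J f"
      using \<open>0 < e\<close> J0 by (intro bound) auto
    also have "\<dots> \<le> e" using \<open>0 < e\<close> J0 by (simp add: field_simps)
    finally show "norm (E f df) \<le> 0 + e" by simp
  qed
  then show ?thesis by (simp add: E_def)
qed

text \<open>\<open>c\<close> is the normalisation constant provided by \<open>swept_measure_eq\<close>.\<close>

theorem divergence_theorem:
  fixes D :: "'a::euclidean_space set"
  assumes D: "open D" "bounded D" "C1_domain D"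
    and c: "0 < c" "\<And>e :: 'a. norm e = 1 \<Longrightarrow> swept_measure e = density lborel (\<lambda>_. ennreal c)"
    and f: "C1_fun f df"
  shows "c *\<^sub>R (\<integral>x. indicator D x *\<^sub>R df x \<partial>lborel) = (\<integral>x. f x *\<^sub>R outer_normal D x \<partial>surface_measure D)"
proof -
  let ?\<sigma> = "surface_measure D"
  have cont: "continuous_on (frontier D) (\<lambda>x. h x *\<^sub>R outer_normal D x)" if "C1_fun h dh" for h dh
    by (rule continuous_on_scaleR[OF C1_fun_continuous[OF that] continuous_on_outer_normal[OF D(3)]])
  have int: "integrable ?\<sigma> (\<lambda>x. h x *\<^sub>R outer_normal D x)" "integrable lborel (\<lambda>x. indicator D x *\<^sub>R dh x)"
    if "C1_fun h dh" for h dh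
    by (rule integrable_continuous_surface[OF D cont[OF that]],
        rule integrable_continuous_domain[OF D(1,2) C1_fun_continuous_grad[OF that]])
  \<comment> \<open>A function of arbitrary sign is half the difference of the nonnegative C1
    functions (f + 1)^2 and f^2 + 1.\<close>
  obtain d1 where d1: "C1_fun (\<lambda>x. (f x + 1) * (f x + 1)) d1"
    using C1_fun_mult[OF C1_fun_add[OF f C1_fun_const[of 1]] C1_fun_add[OF f C1_fun_const[of 1]]] by blast
  obtain d2 where d2: "C1_fun (\<lambda>x. f x * f x + 1) d2"
    using C1_fun_add[OF C1_fun_mult[OF f f] C1_fun_const[of 1]] by blast
  have eq1: "c *\<^sub>R (\<integral>x. indicator D x *\<^sub>R d1 x \<partial>lborel) = (\<integral>x. ((f x + 1) * (f x + 1)) *\<^sub>R outer_normal D x \<partial>?\<sigma>)"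
    by (rule flux_nonneg[OF D c d1]) auto
  have eq2: "c *\<^sub>R (\<integral>x. indicator D x *\<^sub>R d2 x \<partial>lborel) = (\<integral>x. (f x * f x + 1) *\<^sub>R outer_normal D x \<partial>?\<sigma>)"
    by (rule flux_nonneg[OF D c d2]) auto
  have df: "d1 x - d2 x = 2 *\<^sub>R df x" for x
  proof -
    have "((\<lambda>x. (f x + 1) * (f x + 1) - (f x * f x + 1)) has_derivative (\<lambda>h. (d1 x - d2 x) \<bullet> h)) (at x)"
      using C1_fun_diff[OF d1 d2] by (simp add: C1_fun_def)
    moreover have "((\<lambda>x. 2 * f x) has_derivative (\<lambda>h. (2 *\<^sub>R df x) \<bullet> h)) (at x)"
      using f by (auto simp: C1_fun_def intro!: derivative_eq_intros)
    moreover have "(\<lambda>x. (f x + 1) * (f x + 1) - (f x * f x + 1)) = (\<lambda>x. 2 * f x)" by (auto simp: algebra_simps)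
    ultimately have "(\<lambda>h. (d1 x - d2 x) \<bullet> h) = (\<lambda>h. (2 *\<^sub>R df x) \<bullet> h)"
      using has_derivative_unique by metis
    then show ?thesis by (metis vector_eq_rdot)
  qed
  have "2 *\<^sub>R (c *\<^sub>R (\<integral>x. indicator D x *\<^sub>R df x \<partial>lborel)) = c *\<^sub>R (\<integral>x. indicator D x *\<^sub>R (d1 x - d2 x) \<partial>lborel)"
  proof -
    have "(\<lambda>x. indicator D x *\<^sub>R (d1 x - d2 x)) = (\<lambda>x. 2 *\<^sub>R (indicator D x *\<^sub>R df x))" by (simp add: df mult.commute)
    then have "(\<integral>x. indicator D x *\<^sub>R (d1 x - d2 x) \<partial>lborel) = 2 *\<^sub>R (\<integral>x. indicator D x *\<^sub>R df x \<partial>lborel)"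
      by (simp only: integral_scaleR_right)
    then show ?thesis by (simp add: mult.commute)
  qed
  also have "\<dots> = (\<integral>x. ((f x + 1) * (f x + 1)) *\<^sub>R outer_normal D x \<partial>?\<sigma>) - (\<integral>x. (f x * f x + 1) *\<^sub>R outer_normal D x \<partial>?\<sigma>)"
    using int(2)[OF d1] int(2)[OF d2] by (simp add: scaleR_diff_right eq1 eq2)
  also have "\<dots> = (\<integral>x. 2 *\<^sub>R (f x *\<^sub>R outer_normal D x) \<partial>?\<sigma>)"
    unfolding Bochner_Integration.integral_diff[OF int(1)[OF d1] int(1)[OF d2], symmetric]
  proof (intro Bochner_Integration.integral_cong refl)
    fix x
    have "(f x + 1) * (f x + 1) - (f x * f x + 1) = 2 * f x" by (simp add: algebra_simps)
    then show "((f x + 1) * (f x + 1)) *\<^sub>R outer_normal D x - (f x * f x + 1) *\<^sub>R outer_normal D x = 2 *\<^sub>R (f x *\<^sub>R outer_normal D x)"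
      unfolding scaleR_diff_left[symmetric] by simp
  qed
  also have "\<dots> = 2 *\<^sub>R (\<integral>x. f x *\<^sub>R outer_normal D x \<partial>?\<sigma>)" by (rule integral_scaleR_right)
  finally show ?thesis by (simp only: scaleR_cancel_left) simp
qed

section \<open>The polar norm and Wulff shapes\<close>

text \<open>The common source of \<open>C1_domain\<close> for graph boundaries and Wulff shapes. The
  mean value inequality for \<phi> minus its linear part at y makes the linearisation error small
  relative to z - x for all pairs near y, so outside a thin double cone the sign of
  \<open>\<phi> z\<close> is that of the linear part.\<close>

lemma level_set_flat:
  fixes \<phi> :: "'a::euclidean_space \<Rightarrow> real" and g :: "'a \<Rightarrow> 'a"
  assumes r: "0 < r" and d\<phi>: "\<And>x. x \<in> ball y r \<Longrightarrow> (\<phi> has_derivative (\<lambda>h. g x \<bullet> h)) (at x)"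
    and g: "isCont g y" "g y \<noteq> 0"
    and D: "open D" "D \<inter> ball y r = {x \<in> ball y r. \<phi> x < 0}" and "0 < \<epsilon>"
  shows "\<exists>\<rho>>0. flat_on D ((1 / norm (g y)) *\<^sub>R g y) \<epsilon> (ball y \<rho>)"
proof -
  have g0: "0 < norm (g y)" using g(2) by simp
  then have "0 < \<epsilon> * norm (g y) / 2" using \<open>0 < \<epsilon>\<close> by simp
  then obtain d where d: "d > 0" "\<And>x. dist x y < d \<Longrightarrow> dist (g x) (g y) < \<epsilon> * norm (g y) / 2"
    using g(1) unfolding continuous_at_eps_delta by blast
  define \<rho> where "\<rho> = min r d"
  have \<rho>: "0 < \<rho>" "ball y \<rho> \<subseteq> ball y r" using r d(1) by (auto simp: \<rho>_def)
  have lin: "\<bar>\<phi> z - \<phi> x - g y \<bullet> (z - x)\<bar> \<le> \<epsilon> * norm (g y) / 2 * norm (z - x)"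
    if "x \<in> ball y \<rho>" "z \<in> ball y \<rho>" for x z
  proof -
    have "norm ((\<phi> z - g y \<bullet> z) - (\<phi> x - g y \<bullet> x)) \<le> \<epsilon> * norm (g y) / 2 * norm (z - x)"
    proof (rule differentiable_bound[of "ball y \<rho>" _ "\<lambda>x h. (g x - g y) \<bullet> h"])
      fix w assume w: "w \<in> ball y \<rho>"
      have "(\<phi> has_derivative (\<lambda>h. g w \<bullet> h)) (at w within ball y \<rho>)"
        by (rule has_derivative_at_withinI, rule d\<phi>) (use w \<rho>(2) in blast)
      then show "((\<lambda>x. \<phi> x - g y \<bullet> x) has_derivative (\<lambda>h. (g w - g y) \<bullet> h)) (at w within ball y \<rho>)"
        by (auto intro!: derivative_eq_intros simp: inner_diff_left)
      have "dist (g w) (g y) < \<epsilon> * norm (g y) / 2" using w by (intro d(2)) (auto simp: \<rho>_def dist_commute)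
      then show "onorm (\<lambda>h. (g w - g y) \<bullet> h) \<le> \<epsilon> * norm (g y) / 2"
      proof (intro onorm_le)
        fix h
        have "norm ((g w - g y) \<bullet> h) \<le> norm (g w - g y) * norm h" using Cauchy_Schwarz_ineq2[of "g w - g y" h] by simp
        also have "\<dots> \<le> \<epsilon> * norm (g y) / 2 * norm h"
          using \<open>dist (g w) (g y) < _\<close> by (intro mult_right_mono) (auto simp: dist_norm)
        finally show "norm ((g w - g y) \<bullet> h) \<le> \<epsilon> * norm (g y) / 2 * norm h" .
      qed
    qed (use that in auto)
    moreover have "(\<phi> z - g y \<bullet> z) - (\<phi> x - g y \<bullet> x) = \<phi> z - \<phi> x - g y \<bullet> (z - x)" by (simp add: inner_diff_right)
    ultimately show ?thesis by simp
  qed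
  have cont: "continuous_on (ball y r) \<phi>"
    by (intro continuous_at_imp_continuous_on ballI has_derivative_continuous[OF d\<phi>])
  \<comment> \<open>A frontier point is not in the open set D, hence \<phi> is nonnegative there,
    and it is a limit of points of D, hence \<phi> cannot be positive.\<close>
  have zero: "\<phi> x = 0" if x: "x \<in> frontier D" "x \<in> ball y r" for x
  proof (rule antisym)
    have xD: "x \<notin> D" using x D(1) by (simp add: frontier_def interior_open)
    then show "0 \<le> \<phi> x" using D(2) x(2) by fastforce
    show "\<phi> x \<le> 0"
    proof (rule ccontr)
      assume "\<not> \<phi> x \<le> 0"
      have "open (ball y r \<inter> \<phi> -` {0<..})" by (rule continuous_open_preimage[OF cont]) auto
      moreover have "x \<in> ball y r \<inter> \<phi> -` {0<..}" using x \<open>\<not> \<phi> x \<le> 0\<close> by simp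
      moreover have "x \<in> closure D" using x by (simp add: frontier_def)
      ultimately have "(ball y r \<inter> \<phi> -` {0<..}) \<inter> D \<noteq> {}" using open_Int_closure_eq_empty by blast
      then obtain w where "w \<in> ball y r" "0 < \<phi> w" "w \<in> D" by auto
      then have "w \<in> {x \<in> ball y r. \<phi> x < 0}" using D(2) by blast
      then show False using \<open>0 < \<phi> w\<close> by simp
    qed
  qed
  show ?thesis
  proof (intro exI[of _ \<rho>] conjI \<rho>(1))
    show "flat_on D ((1 / norm (g y)) *\<^sub>R g y) \<epsilon> (ball y \<rho>)"
      unfolding flat_on_def
    proof (intro ballI conjI impI)
      fix x z assume x: "x \<in> frontier D \<inter> ball y \<rho>" and z: "z \<in> ball y \<rho>"
      have \<phi>x: "\<phi> x = 0" using x \<rho>(2) by (intro zero) auto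
      define q where "q = g y \<bullet> (z - x)"
      define w where "w = \<epsilon> * norm (z - x) * norm (g y)"
      have L: "\<bar>\<phi> z - q\<bar> \<le> w / 2" using lin[of x z] x z by (simp add: \<phi>x q_def w_def mult_ac)
      have w: "0 \<le> w" using \<open>0 < \<epsilon>\<close> by (simp add: w_def)
      have ip: "(z - x) \<bullet> ((1 / norm (g y)) *\<^sub>R g y) = q / norm (g y)" by (simp add: inner_commute q_def)
      { assume "(z - x) \<bullet> ((1 / norm (g y)) *\<^sub>R g y) < - \<epsilon> * norm (z - x)"
        then have "q < - w" unfolding ip using g0 by (simp add: divide_less_eq w_def)
        then have "\<phi> z < 0" using L w by linarith
        then show "z \<in> D" using D(2) z \<rho>(2) by blast }
      { assume "(z - x) \<bullet> ((1 / norm (g y)) *\<^sub>R g y) > \<epsilon> * norm (z - x)"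
        then have "w < q" unfolding ip using g0 by (simp add: less_divide_eq w_def)
        then have "\<not> \<phi> z < 0" using L w by linarith
        then have "z \<notin> D \<inter> ball y r" unfolding D(2) by simp
        then show "z \<notin> D" using z \<rho>(2) by blast }
    qed
  qed
qed

text \<open>The Hoelder bound makes Dg continuous. The boundary is the zero level of z \<bullet> e -
  g(P z), whose gradient G has component 1 along e and so never vanishes.\<close>

lemma C1alpha_boundary_imp_C1_domain:
  fixes D :: "'a::euclidean_space set"
  assumes D: "open D" "C1alpha_boundary \<alpha> D" and "0 < \<alpha>"
  shows "C1_domain D"
  unfolding C1_domain_def
proof
  fix y assume y: "y \<in> frontier D"
  obtain r e g Dg C where r: "r > 0" and e: "norm e = 1"
    and dg: "\<And>y. (g has_derivative (\<lambda>h. Dg y \<bullet> h)) (at y)"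
    and Dg: "\<And>y z. norm (Dg y - Dg z) \<le> C * norm (y - z) powr \<alpha>"
    and chart: "D \<inter> ball y r = {z \<in> ball y r. z \<bullet> e < g (z - (z \<bullet> e) *\<^sub>R e)}"
  proof -
    from bspec[OF D(2)[unfolded C1alpha_boundary_def] y] obtain r e g Dg C where *: "r > 0" "norm e = 1"
      "\<forall>y. (g has_derivative (\<lambda>h. Dg y \<bullet> h)) (at y)"
      "\<forall>y z. norm (Dg y - Dg z) \<le> C * norm (y - z) powr \<alpha>"
      "D \<inter> ball y r = {z \<in> ball y r. z \<bullet> e < g (z - (z \<bullet> e) *\<^sub>R e)}"
      by (elim exE conjE) (rule that)
    show ?thesis by (rule that[OF *(1,2) spec[OF *(3)] _ *(5)]) (use *(4) in blast)
  qed
  define P where "P = proj_along e"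
  have P: "P x = x - (x \<bullet> e) *\<^sub>R e" for x by (simp add: P_def proj_along_def)
  have ee: "e \<bullet> e = 1" using e by (simp add: norm_eq_1)
  have Psym: "v \<bullet> P h = P v \<bullet> h" for v h by (simp add: P inner_diff_left inner_diff_right inner_commute mult.commute)
  define G where "G x = e - P (Dg (P x))" for x
  have Dg_cont: "isCont Dg z" for z
  proof -
    have "((\<lambda>x. C * norm (x - z) powr \<alpha>) \<longlongrightarrow> C * norm (z - z) powr \<alpha>) (at z)"
      using \<open>0 < \<alpha>\<close> by (intro tendsto_intros) auto
    then have "((\<lambda>x. C * norm (x - z) powr \<alpha>) \<longlongrightarrow> 0) (at z)" by simp
    then have "((\<lambda>x. Dg x - Dg z) \<longlongrightarrow> 0) (at z)"
      by (rule Lim_null_comparison[rotated]) (use Dg in auto)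
    then show ?thesis by (simp add: isCont_def LIM_zero_iff)
  qed
  have Pcont: "isCont P x" for x unfolding P by (intro continuous_intros)
  have G: "isCont G y"
  proof -
    have "isCont (\<lambda>x. P (Dg (P x))) y" by (rule isCont_o2[OF isCont_o2[OF Pcont Dg_cont] Pcont])
    then show ?thesis unfolding G_def by (intro continuous_intros)
  qed
  have d: "((\<lambda>z. z \<bullet> e - g (P z)) has_derivative (\<lambda>h. G x \<bullet> h)) (at x)" for x
  proof -
    have 1: "(P has_derivative P) (at x)" unfolding P[abs_def] by (auto intro!: derivative_eq_intros)
    have "((\<lambda>z. g (P z)) has_derivative (\<lambda>h. Dg (P x) \<bullet> P h)) (at x)"
      by (rule has_derivative_compose[OF 1 dg])
    then have "((\<lambda>z. z \<bullet> e - g (P z)) has_derivative (\<lambda>h. h \<bullet> e - Dg (P x) \<bullet> P h)) (at x)"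
      by (intro has_derivative_diff has_derivative_inner_left has_derivative_ident)
    moreover have "h \<bullet> e - Dg (P x) \<bullet> P h = G x \<bullet> h" for h
      by (simp only: Psym G_def inner_diff_left inner_commute[of h e])
    ultimately show ?thesis by simp
  qed
  have "G y \<bullet> e = 1" by (simp add: G_def inner_diff_left P ee)
  then have G0: "G y \<noteq> 0" by auto
  have chart': "D \<inter> ball y r = {z \<in> ball y r. z \<bullet> e - g (P z) < 0}" using chart by (auto simp: P)
  have "\<And>\<epsilon>. 0 < \<epsilon> \<Longrightarrow> \<exists>r>0. flat_on D ((1 / norm (G y)) *\<^sub>R G y) \<epsilon> (ball y r)"
    by (rule level_set_flat[OF r d G G0 D(1) chart'])
  then show "\<exists>n. norm n = 1 \<and> (\<forall>\<epsilon>>0. \<exists>r>0. flat_on D n \<epsilon> (ball y r))"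
    using G0 by (intro exI[of _ "(1 / norm (G y)) *\<^sub>R G y"]) auto
qed

section \<open>The norm F\<close>

locale finsler =
  fixes F :: "'a::euclidean_space \<Rightarrow> real" and p :: real
  assumes finsler: "finsler_norm p F" and p: "1 < p"
begin

lemma F_nonneg: "0 \<le> F \<xi>" and F_convex: "convex_on UNIV F" and F_minus: "F (- \<xi>) = F \<xi>"
  and F_scale: "F (t *\<^sub>R \<xi>) = \<bar>t\<bar> * F \<xi>"
  using finsler unfolding finsler_norm_def by auto

lemma F_bounds: "\<exists>a b. 0 < a \<and> a \<le> b \<and> (\<forall>\<xi>. a * norm \<xi> \<le> F \<xi> \<and> F \<xi> \<le> b * norm \<xi>)"
  using finsler unfolding finsler_norm_def by blast

lemma F_zero [simp]: "F 0 = 0"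
  using F_scale[of 0 0] by simp

lemma F_pos: "\<xi> \<noteq> 0 \<Longrightarrow> 0 < F \<xi>"
proof -
  assume "\<xi> \<noteq> 0"
  obtain a b where "0 < a" "\<And>\<xi>. a * norm \<xi> \<le> F \<xi>" using F_bounds by blast
  then show ?thesis using \<open>\<xi> \<noteq> 0\<close> by (meson less_le_trans mult_pos_pos zero_less_norm_iff)
qed

lemma F_triangle: "F (x + y) \<le> F x + F y"
proof -
  have "F ((1 - 1/2) *\<^sub>R x + (1/2) *\<^sub>R y) \<le> (1 - 1/2) * F x + (1/2) * F y"
    by (rule convex_onD[OF F_convex]) auto
  also have "(1 - 1/2) *\<^sub>R x + (1/2) *\<^sub>R y = (1/2) *\<^sub>R (x + y)" by (simp add: scaleR_add_right)
  finally show ?thesis by (simp add: F_scale)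
qed

lemma F_continuous: "continuous_on A F"
  using convex_on_continuous[OF open_UNIV F_convex] continuous_on_subset by blast

lemma F_measurable [measurable]: "F \<in> borel_measurable borel"
  by (intro borel_measurable_continuous_onI F_continuous)

section \<open>The dual norm and its gradient\<close>

abbreviation "N \<equiv> polar F"

lemma polar_bdd: "bdd_above ((\<lambda>\<xi>. (\<xi> \<bullet> v) / F \<xi>) ` (- {0}))"
proof -
  obtain a b where a: "0 < a" "\<And>\<xi>. a * norm \<xi> \<le> F \<xi>" using F_bounds by blast
  have "(\<xi> \<bullet> v) / F \<xi> \<le> norm v / a" if "\<xi> \<noteq> 0" for \<xi>
  proof -
    have "(\<xi> \<bullet> v) * a \<le> (norm \<xi> * norm v) * a" using a(1) norm_cauchy_schwarz by (intro mult_right_mono) auto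
    also have "\<dots> \<le> F \<xi> * norm v" using a(2)[of \<xi>] mult_right_mono[of "a * norm \<xi>" "F \<xi>" "norm v"] by (simp add: mult_ac)
    finally show ?thesis using F_pos[OF that] a(1) by (simp add: field_simps)
  qed
  then show ?thesis by (intro bdd_aboveI[of _ "norm v / a"]) auto
qed

lemma inner_le_polar: "\<xi> \<bullet> v \<le> F \<xi> * N v"
proof (cases "\<xi> = 0")
  case False
  then have "(\<xi> \<bullet> v) / F \<xi> \<le> N v" unfolding polar_def by (intro cSUP_upper polar_bdd) auto
  then show ?thesis using F_pos[OF False] by (simp add: field_simps)
qed simp

lemma abs_inner_le_polar: "\<bar>\<xi> \<bullet> v\<bar> \<le> F \<xi> * N v"
  using inner_le_polar[of \<xi> v] inner_le_polar[of "- \<xi>" v] by (simp add: F_minus abs_le_iff)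

definition unit_sphere :: "'a set" where "unit_sphere = {\<xi>. F \<xi> = 1}"

lemma compact_unit_sphere: "compact unit_sphere"
proof -
  obtain a b where a: "0 < a" "\<And>\<xi>. a * norm \<xi> \<le> F \<xi>" using F_bounds by blast
  have "bounded unit_sphere"
    unfolding bounded_iff
  proof (intro exI[of _ "1/a"] ballI)
    fix \<xi> assume "\<xi> \<in> unit_sphere"
    then have "a * norm \<xi> \<le> 1" using a(2)[of \<xi>] by (simp add: unit_sphere_def)
    then show "norm \<xi> \<le> 1 / a" using a(1) by (simp add: field_simps)
  qed
  moreover have "closed unit_sphere"
    unfolding unit_sphere_def by (intro closed_Collect_eq F_continuous continuous_on_const)
  ultimately show ?thesis by (simp add: compact_eq_bounded_closed)
qed

lemma normalize_unit_sphere: "\<xi> \<noteq> 0 \<Longrightarrow> (1 / F \<xi>) *\<^sub>R \<xi> \<in> unit_sphere"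
  using F_pos[of \<xi>] by (simp add: unit_sphere_def F_scale)

lemma polar_attained: "\<exists>m. F m = 1 \<and> m \<bullet> v = N v"
proof -
  obtain b :: 'a where b: "b \<in> Basis" using nonempty_Basis by blast
  then have "unit_sphere \<noteq> {}" using normalize_unit_sphere[of b] nonzero_Basis by blast
  then obtain m where m: "m \<in> unit_sphere" "\<And>\<xi>. \<xi> \<in> unit_sphere \<Longrightarrow> \<xi> \<bullet> v \<le> m \<bullet> v"
  proof -
    have "continuous_on unit_sphere (\<lambda>\<xi>. \<xi> \<bullet> v)" by (intro continuous_intros)
    then show ?thesis using continuous_attains_sup[OF compact_unit_sphere \<open>unit_sphere \<noteq> {}\<close>] that by blast
  qed
  have "N v \<le> m \<bullet> v" unfolding polar_def
  proof (rule cSUP_least)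
    fix \<xi> :: 'a assume "\<xi> \<in> - {0}"
    then show "\<xi> \<bullet> v / F \<xi> \<le> m \<bullet> v" using m(2)[OF normalize_unit_sphere[of \<xi>]] by simp
  qed (use b nonzero_Basis in auto)
  moreover have "m \<bullet> v \<le> N v" using inner_le_polar[of m v] m(1) by (simp add: unit_sphere_def)
  ultimately show ?thesis using m(1) by (auto simp: unit_sphere_def)
qed

text \<open>A maximiser of the dual pairing on the unit sphere of F. Taking it as the candidate for
  the gradient of N gives F-norm one and Euler's relation at once; at v = 0 it is merely some unit
  vector.\<close>

definition gradN :: "'a \<Rightarrow> 'a" where "gradN v = (SOME m. F m = 1 \<and> m \<bullet> v = N v)"

lemma F_gradN: "F (gradN v) = 1" and gradN_inner: "gradN v \<bullet> v = N v"
  using someI_ex[OF polar_attained, of v] by (auto simp: gradN_def)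

lemma gradN_nonzero: "gradN v \<noteq> 0"
  using F_gradN[of v] by auto

lemma polar_zero [simp]: "N 0 = 0"
  using gradN_inner[of 0] by simp

lemma polar_bounds: "\<exists>a b. 0 < a \<and> 0 < b \<and> (\<forall>v. norm v \<le> b * N v \<and> a * N v \<le> norm v)"
proof -
  obtain a b where ab: "0 < a" "a \<le> b" "\<And>\<xi>. a * norm \<xi> \<le> F \<xi>" "\<And>\<xi>. F \<xi> \<le> b * norm \<xi>" using F_bounds by blast
  have "norm v \<le> b * N v" for v
  proof (cases "v = 0")
    case False
    have "norm v * norm v = v \<bullet> v" by (simp add: power2_norm_eq_inner[symmetric] power2_eq_square)
    also have "\<dots> \<le> F v * N v" by (rule inner_le_polar)
    also have "\<dots> \<le> (b * norm v) * N v"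
    proof (rule mult_right_mono[OF ab(4)])
      have "0 < v \<bullet> v" using False by simp
      then have "0 < F v * N v" using inner_le_polar[of v v] by linarith
      then show "0 \<le> N v" using F_pos[OF False] by (simp add: zero_less_mult_iff)
    qed
    finally show ?thesis using False by (simp add: mult_ac)
  qed simp
  moreover have "a * N v \<le> norm v" for v
  proof -
    have "N v \<le> norm (gradN v) * norm v" using norm_cauchy_schwarz[of "gradN v" v] by (simp add: gradN_inner)
    then have "a * N v \<le> (a * norm (gradN v)) * norm v" using ab(1) by (simp add: mult_ac)
    also have "\<dots> \<le> 1 * norm v" using ab(3)[of "gradN v"] by (intro mult_right_mono) (auto simp: F_gradN)
    finally show ?thesis by simp
  qed
  ultimately show ?thesis using ab by (intro exI[of _ a] exI[of _ b]) auto
qed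

lemma polar_pos: "v \<noteq> 0 \<Longrightarrow> 0 < N v"
proof -
  assume "v \<noteq> 0"
  obtain a b where "0 < b" "norm v \<le> b * N v" using polar_bounds by blast
  then have "0 < b * N v" using \<open>v \<noteq> 0\<close> by (meson less_le_trans zero_less_norm_iff)
  then show ?thesis using \<open>0 < b\<close> by (simp add: zero_less_mult_iff)
qed

lemma polar_nonneg: "0 \<le> N v"
  using polar_pos[of v] by (cases "v = 0") auto

lemma polar_triangle: "N (x + y) \<le> N x + N y"
proof -
  have "N (x + y) = gradN (x + y) \<bullet> x + gradN (x + y) \<bullet> y" by (simp add: gradN_inner[symmetric] inner_add_right)
  also have "\<dots> \<le> F (gradN (x + y)) * N x + F (gradN (x + y)) * N y" by (intro add_mono inner_le_polar)
  finally show ?thesis by (simp add: F_gradN)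
qed

lemma polar_minus: "N (- v) = N v"
proof -
  have "N (- v) \<le> N v" for v
    using abs_inner_le_polar[of "gradN (- v)" v] gradN_inner[of "- v"] by (simp add: F_gradN)
  from this[of v] this[of "- v"] show ?thesis by simp
qed

lemma polar_continuous: "continuous_on A N"
proof -
  obtain a b where a: "0 < a" "\<And>v. a * N v \<le> norm v" using polar_bounds by blast
  have "\<bar>N x - N y\<bar> \<le> norm (x - y) / a" for x y
  proof -
    have "N x \<le> N (x - y) + N y" using polar_triangle[of "x - y" y] by simp
    moreover have "N y \<le> N (x - y) + N x" using polar_triangle[of "y - x" x] polar_minus[of "x - y"] by simp
    moreover have "N (x - y) \<le> norm (x - y) / a" using a(2)[of "x - y"] a(1) by (simp add: field_simps)
    ultimately show ?thesis by linarith
  qed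
  then have "(1/a)-lipschitz_on A N" using a(1) by (intro lipschitz_onI) (auto simp: dist_norm)
  then show ?thesis by (rule lipschitz_on_continuous_on)
qed

text \<open>Strict convexity of the unit ball of \<open>F\<close>: on a segment of maximisers \<open>F\<^sup>p\<close> would be constant,
  against the positivity of its Hessian.\<close>

lemma polar_maximizer_unique:
  assumes v: "v \<noteq> 0" and m: "F m = 1" "m \<bullet> v = N v" and m': "F m' = 1" "m' \<bullet> v = N v"
  shows "m = m'"
proof (rule ccontr)
  assume ne: "m \<noteq> m'"
  define d where "d = m' - m"
  have d: "d \<noteq> 0" "d \<bullet> v = 0" using ne m m' by (auto simp: d_def inner_diff_left)
  have Nv: "0 < N v" by (rule polar_pos[OF v])
  \<comment> \<open>Convexity gives the upper bound on the segment. The pairing with v is constantly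
    N v there, and the duality inequality then gives the lower bound.\<close>
  have F1: "F (m + t *\<^sub>R d) = 1" if "0 < t" "t < 1" for t
  proof (rule antisym)
    have "m + t *\<^sub>R d = (1 - t) *\<^sub>R m + t *\<^sub>R m'" by (simp add: d_def algebra_simps)
    then show "F (m + t *\<^sub>R d) \<le> 1"
      using convex_onD[OF F_convex, of t m m'] that m m' by simp
    have "N v \<le> F (m + t *\<^sub>R d) * N v" using inner_le_polar[of "m + t *\<^sub>R d" v] by (simp add: inner_add_left d m)
    then show "1 \<le> F (m + t *\<^sub>R d)" using Nv by simp
  qed
  obtain g H where gH: "C2_grad_hess (- {0}) (\<lambda>\<xi>. F \<xi> powr p) g H" "\<And>\<xi> v. \<xi> \<noteq> 0 \<Longrightarrow> v \<noteq> 0 \<Longrightarrow> v \<bullet> H \<xi> v > 0"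
    using finsler unfolding finsler_norm_def by blast
  have nz: "m + t *\<^sub>R d \<noteq> 0" for t
  proof
    assume "m + t *\<^sub>R d = 0"
    then have "(m + t *\<^sub>R d) \<bullet> v = 0" by simp
    then show False using Nv by (simp add: inner_add_left d m)
  qed
  have line: "((\<lambda>t. m + t *\<^sub>R d) has_derivative (\<lambda>h. h *\<^sub>R d)) (at t)" for t
    by (auto intro!: derivative_eq_intros)
  have first: "g (m + t *\<^sub>R d) \<bullet> d = 0" if t: "0 < t" "t < 1" for t
  proof -
    have "((\<lambda>\<xi>. F \<xi> powr p) has_derivative (\<lambda>h. g (m + t *\<^sub>R d) \<bullet> h)) (at (m + t *\<^sub>R d))"
      using gH(1) nz unfolding C2_grad_hess_def by auto
    from has_derivative_compose[OF line this]
    have "((\<lambda>t. F (m + t *\<^sub>R d) powr p) has_derivative (\<lambda>h. g (m + t *\<^sub>R d) \<bullet> (h *\<^sub>R d))) (at t)" .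
    then have "((\<lambda>t. F (m + t *\<^sub>R d) powr p) has_real_derivative g (m + t *\<^sub>R d) \<bullet> d) (at t)"
      by (simp add: has_field_derivative_def mult_commute_abs)
    moreover have "((\<lambda>t. F (m + t *\<^sub>R d) powr p) has_real_derivative 0) (at t)"
    proof (rule has_field_derivative_transform_within_open[of "\<lambda>_. 1" _ _ "{0<..<1}"])
      show "((\<lambda>_::real. 1::real) has_real_derivative 0) (at t)" by simp
    qed (use t F1 in auto)
    ultimately show ?thesis by (rule DERIV_unique)
  qed
  have "(g has_derivative H (m + (1/2) *\<^sub>R d)) (at (m + (1/2) *\<^sub>R d))"
    using gH(1) nz[of "1/2"] unfolding C2_grad_hess_def by auto
  from has_derivative_inner_left[OF has_derivative_compose[OF line this], of d]
  have A: "((\<lambda>t. g (m + t *\<^sub>R d) \<bullet> d) has_derivative (\<lambda>h. H (m + (1/2) *\<^sub>R d) (h *\<^sub>R d) \<bullet> d)) (at (1/2))" .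
  have B: "((\<lambda>t. g (m + t *\<^sub>R d) \<bullet> d) has_derivative (\<lambda>h. 0)) (at (1/2))"
  proof (rule has_derivative_transform_within_open[of "\<lambda>_. 0" _ _ _ "{0<..<1}"])
    show "((\<lambda>_::real. 0::real) has_derivative (\<lambda>h. 0)) (at (1/2))" by simp
  qed (use first in auto)
  have "(\<lambda>h. H (m + (1/2) *\<^sub>R d) (h *\<^sub>R d) \<bullet> d) = (\<lambda>h. 0)" by (rule has_derivative_unique[OF A B])
  then have "H (m + (1/2) *\<^sub>R d) (1 *\<^sub>R d) \<bullet> d = 0" by meson
  then show False using gH(2)[OF nz[of "1/2"] d(1)] by (simp add: inner_commute)
qed

text \<open>A closed graph argument: the values lie in a compact sphere, and by uniqueness of the
  maximiser the graph is the zero set of a continuous function.\<close>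

lemma continuous_on_gradN: "continuous_on (- {0}) gradN"
proof -
  have "gradN \<in> (- {0}) \<rightarrow> unit_sphere" by (auto simp: unit_sphere_def F_gradN)
  moreover have "closedin (top_of_set ((- {0}) \<times> unit_sphere)) ((\<lambda>x. Pair x (gradN x)) ` (- {0}))"
  proof -
    have "(\<lambda>x. Pair x (gradN x)) ` (- {0}) = ((- {0}) \<times> unit_sphere) \<inter> (\<lambda>z. snd z \<bullet> fst z - N (fst z)) -` {0}"
      using polar_maximizer_unique F_gradN gradN_inner by (force simp: unit_sphere_def image_iff)
    moreover have "continuous_on ((- {0}) \<times> unit_sphere) (\<lambda>z. snd z \<bullet> fst z - N (fst z))"
      by (intro continuous_intros continuous_on_compose2[OF polar_continuous[of UNIV]]) auto
    ultimately show ?thesis by (simp add: continuous_closedin_preimage)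
  qed
  ultimately show ?thesis by (subst continuous_closed_graph_eq[OF compact_unit_sphere]) auto
qed

lemma isCont_gradN: "v \<noteq> 0 \<Longrightarrow> isCont gradN v"
  using continuous_on_gradN by (simp add: continuous_on_eq_continuous_at open_Compl)

text \<open>An envelope argument. Using \<open>gradN v\<close> as competitor at y and
  \<open>gradN y\<close> as competitor at v encloses the increment of N between two linear
  expressions, whose difference is controlled by the continuity of \<open>gradN\<close>.\<close>

lemma polar_has_derivative:
  assumes v: "v \<noteq> 0"
  shows "(N has_derivative (\<lambda>h. gradN v \<bullet> h)) (at v)"
  unfolding has_derivative_iff_norm
proof (intro conjI bounded_linear_inner_right)
  have "((\<lambda>y. norm (gradN y - gradN v)) \<longlongrightarrow> norm (gradN v - gradN v)) (at v)"
    using isCont_gradN[OF v] by (intro tendsto_intros) (simp add: isCont_def)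
  then have lim: "((\<lambda>y. norm (gradN y - gradN v)) \<longlongrightarrow> 0) (at v)" by simp
  show "((\<lambda>y. norm (N y - N v - gradN v \<bullet> (y - v)) / norm (y - v)) \<longlongrightarrow> 0) (at v)"
  proof (rule Lim_null_comparison[OF _ lim], intro always_eventually allI)
    fix y
    have "gradN v \<bullet> y \<le> N y" using inner_le_polar[of "gradN v" y] by (simp add: F_gradN)
    then have 1: "0 \<le> N y - N v - gradN v \<bullet> (y - v)" by (simp add: inner_diff_right gradN_inner)
    have "gradN y \<bullet> v \<le> N v" using inner_le_polar[of "gradN y" v] by (simp add: F_gradN)
    then have "N y - N v - gradN v \<bullet> (y - v) \<le> (gradN y - gradN v) \<bullet> (y - v)"
      by (simp add: inner_diff_right inner_diff_left gradN_inner)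
    also have "\<dots> \<le> norm (gradN y - gradN v) * norm (y - v)" by (rule norm_cauchy_schwarz)
    finally show "norm (norm (N y - N v - gradN v \<bullet> (y - v)) / norm (y - v)) \<le> norm (gradN y - gradN v)"
      using 1 by (cases "y = v") (auto simp: divide_le_eq)
  qed
qed

section \<open>Wulff shapes\<close>

context
  fixes x0 :: 'a and R :: real
  assumes R: "0 < R"
begin

lemma open_wulff_shape: "open (wulff_shape F x0 R)"
  unfolding wulff_shape_def
  by (intro open_Collect_less continuous_on_compose2[OF polar_continuous[of UNIV]] continuous_intros) auto

lemma bounded_wulff_shape: "bounded (wulff_shape F x0 R)"
proof -
  obtain a b where b: "0 < b" "\<And>v. norm v \<le> b * N v" using polar_bounds by blast
  have "wulff_shape F x0 R \<subseteq> cball x0 (b * R)"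
  proof
    fix x assume "x \<in> wulff_shape F x0 R"
    then have "b * N (x - x0) \<le> b * R" using b(1) by (auto simp: wulff_shape_def)
    then show "x \<in> cball x0 (b * R)" using b(2)[of "x - x0"] by (simp add: dist_norm norm_minus_commute)
  qed
  then show ?thesis by (meson bounded_cball bounded_subset)
qed

lemma closure_wulff_shape_le:
  assumes "x \<in> closure (wulff_shape F x0 R)"
  shows "N (x - x0) \<le> R"
proof -
  have "closed {x. N (x - x0) \<le> R}"
    by (intro closed_Collect_le continuous_on_compose2[OF polar_continuous[of UNIV]] continuous_intros) auto
  moreover have "wulff_shape F x0 R \<subseteq> {x. N (x - x0) \<le> R}" by (auto simp: wulff_shape_def)
  ultimately show ?thesis using assms closure_minimal by blast
qed

lemma frontier_wulff_shape:
  assumes "x \<in> frontier (wulff_shape F x0 R)"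
  shows "N (x - x0) = R"
  using assms closure_wulff_shape_le[of x] open_wulff_shape
  by (auto simp: frontier_def interior_open wulff_shape_def)

lemma wulff_shape_flat:
  assumes y: "y \<in> frontier (wulff_shape F x0 R)" and "0 < \<epsilon>"
  shows "\<exists>r>0. flat_on (wulff_shape F x0 R) ((1 / norm (gradN (y - x0))) *\<^sub>R gradN (y - x0)) \<epsilon> (ball y r)"
proof -
  have ne: "y - x0 \<noteq> 0" using frontier_wulff_shape[OF y] R by auto
  show ?thesis
  \<comment> \<open>The radius keeps the ball away from the centre x0, where N is not
    differentiable.\<close>
  proof (rule level_set_flat[where \<phi>="\<lambda>x. N (x - x0) - R" and g="\<lambda>x. gradN (x - x0)" and r="norm (y - x0)"])
    fix x assume "x \<in> ball y (norm (y - x0))"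
    then have "x - x0 \<noteq> 0" by (auto simp: dist_norm)
    from has_derivative_compose[OF has_derivative_diff[OF has_derivative_ident has_derivative_const] polar_has_derivative[OF this]]
    show "((\<lambda>x. N (x - x0) - R) has_derivative (\<lambda>h. gradN (x - x0) \<bullet> h)) (at x)"
      by (auto intro!: derivative_eq_intros)
  next
    show "isCont (\<lambda>x. gradN (x - x0)) y"
      by (rule isCont_o2[where f="\<lambda>x. x - x0" and g=gradN]) (use isCont_gradN[OF ne] in \<open>auto intro: continuous_intros\<close>)
  qed (use ne gradN_nonzero open_wulff_shape \<open>0 < \<epsilon>\<close> in \<open>auto simp: wulff_shape_def\<close>)
qed

lemma C1_domain_wulff_shape: "C1_domain (wulff_shape F x0 R)"
  unfolding C1_domain_def
proof
  fix y assume y: "y \<in> frontier (wulff_shape F x0 R)"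
  show "\<exists>n. norm n = 1 \<and> (\<forall>\<epsilon>>0. \<exists>r>0. flat_on (wulff_shape F x0 R) n \<epsilon> (ball y r))"
    using wulff_shape_flat[OF y] gradN_nonzero[of "y - x0"]
    by (intro exI[of _ "(1 / norm (gradN (y - x0))) *\<^sub>R gradN (y - x0)"]) auto
qed

lemma outer_normal_wulff_shape:
  assumes y: "y \<in> frontier (wulff_shape F x0 R)"
  shows "outer_normal (wulff_shape F x0 R) y = (1 / norm (gradN (y - x0))) *\<^sub>R gradN (y - x0)"
  using gradN_nonzero[of "y - x0"]
  by (intro is_outer_normal_imp_outer_normal flat_on_imp_is_outer_normal y wulff_shape_flat) auto

text \<open>The equality case of the duality inequality: the normal is a multiple of
  \<open>gradN (y - x0)\<close>, which attains the supremum defining N. It turns the boundary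
  estimate into an identity on the Wulff shape.\<close>

lemma inner_outer_normal_wulff_shape:
  assumes y: "y \<in> frontier (wulff_shape F x0 R)"
  shows "(y - x0) \<bullet> outer_normal (wulff_shape F x0 R) y = R * F (outer_normal (wulff_shape F x0 R) y)"
  using frontier_wulff_shape[OF y] gradN_nonzero[of "y - x0"] gradN_inner[of "y - x0"]
  by (simp add: outer_normal_wulff_shape[OF y] F_scale F_gradN inner_commute)

end

end

section \<open>The radial profile\<close>

lemma integral_exp_stretch:
  fixes K s :: real
  assumes "0 < K"
  shows "s * integral {0..1} (\<lambda>t. exp (K * (t * s))) = (exp (K * s) - 1) / K"
proof -
  have "((\<lambda>t. s * exp (K * (t * s))) has_integral (exp (K * (1 * s)) / K - exp (K * (0 * s)) / K)) {0..1}"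
    using assms
    by (intro fundamental_theorem_of_calculus)
       (auto intro!: derivative_eq_intros simp flip: has_real_derivative_iff_has_vector_derivative)
  from integral_unique[OF this] show ?thesis by (simp add: diff_divide_distrib)
qed

lemma has_integral_power_01: "((\<lambda>t::real. t ^ m) has_integral 1 / (real m + 1)) {0..1}"
proof -
  have "((\<lambda>t::real. t ^ Suc m / (real m + 1)) has_real_derivative t ^ m) (at t within {0..1})" for t
  proof -
    have "((\<lambda>t::real. t ^ Suc m / (real m + 1)) has_real_derivative real (Suc m) * t ^ (Suc m - Suc 0) / (real m + 1)) (at t)"
      by (intro DERIV_cdivide DERIV_pow)
    moreover have "real (Suc m) * t ^ (Suc m - Suc 0) / (real m + 1) = t ^ m" by (simp add: field_simps)
    ultimately show ?thesis by (metis has_field_derivative_at_within)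
  qed
  then have "((\<lambda>t::real. t ^ m) has_integral (1 ^ Suc m / (real m + 1) - 0 ^ Suc m / (real m + 1))) {0..1}"
    by (intro fundamental_theorem_of_calculus) (auto simp flip: has_real_derivative_iff_has_vector_derivative)
  then show ?thesis by simp
qed

text \<open>The scaled integral is the integral of the positive part over [0, r]. At a maximum of w
  weighted by exp(-K r) with K = 2 L + 1, it contributes at most half of that maximum, which is
  absorbed. The positive part allows one-sided use, for differences of unknown sign.\<close>

lemma scaled_Gronwall:
  fixes w :: "real \<Rightarrow> real"
  assumes R: "0 < R" and L: "0 \<le> L" and C: "0 \<le> C" and w: "continuous_on {0..R} w"
    and le: "\<And>r. r \<in> {0..R} \<Longrightarrow> w r \<le> C + L * (r * integral {0..1} (\<lambda>t. max 0 (w (t * r))))"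
    and r: "r \<in> {0..R}"
  shows "w r \<le> 2 * C * exp ((2 * L + 1) * r)"
proof -
  define K where "K = 2 * L + 1"
  have K: "0 < K" "2 * L \<le> K" using L by (auto simp: K_def)
  have "continuous_on {0..R} (\<lambda>r. exp (- K * r) * w r)" by (intro continuous_intros w)
  moreover have "{0..R} \<noteq> {}" using R by simp
  ultimately obtain r0 where r0: "r0 \<in> {0..R}" "\<And>r. r \<in> {0..R} \<Longrightarrow> exp (- K * r) * w r \<le> exp (- K * r0) * w r0"
    using continuous_attains_sup[of "{0..R}" "\<lambda>r. exp (- K * r) * w r"] by auto
  define M where "M = exp (- K * r0) * w r0"
  have wM: "w r \<le> M * exp (K * r)" if "r \<in> {0..R}" for r
  proof -
    have "exp (K * r) * (exp (- K * r) * w r) \<le> exp (K * r) * M"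
      using r0(2)[OF that] by (intro mult_left_mono) (auto simp: M_def)
    moreover have "exp (K * r) * exp (- K * r) = 1" by (simp add: exp_minus)
    then have "exp (K * r) * (exp (- K * r) * w r) = w r" by (simp only: mult.assoc[symmetric] mult_1)
    ultimately show ?thesis by (simp only: mult.commute[of M])
  qed
  have "M \<le> 2 * C"
  proof (cases "M \<le> 0")
    case False
    have tr: "t * r0 \<in> {0..R}" if "t \<in> {0..1}" for t
      using that r0(1) mult_mono[of t 1 r0 R] by auto
    have cont: "continuous_on {0..1} (\<lambda>t. w (t * r0))"
      by (rule continuous_on_compose2[OF w]) (use tr in \<open>auto intro!: continuous_intros\<close>)
    have "integral {0..1} (\<lambda>t. max 0 (w (t * r0))) \<le> integral {0..1} (\<lambda>t. M * exp (K * (t * r0)))"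
      using wM[OF tr] False
      by (intro integral_le integrable_continuous_real continuous_intros cont) auto
    then have "r0 * integral {0..1} (\<lambda>t. max 0 (w (t * r0))) \<le> r0 * integral {0..1} (\<lambda>t. M * exp (K * (t * r0)))"
      using r0(1) by (intro mult_left_mono) auto
    also have "\<dots> = M * (r0 * integral {0..1} (\<lambda>t. exp (K * (t * r0))))"
      by (simp only: integral_mult_right mult.left_commute)
    also have "\<dots> = M * ((exp (K * r0) - 1) / K)" by (simp only: integral_exp_stretch[OF K(1)])
    also have "\<dots> \<le> M * (exp (K * r0) / K)"
      using False K by (intro mult_left_mono divide_right_mono) auto
    finally have "L * (r0 * integral {0..1} (\<lambda>t. max 0 (w (t * r0)))) \<le> L * (M * (exp (K * r0) / K))"
      using L by (rule mult_left_mono)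
    also have "\<dots> = (L / K) * (M * exp (K * r0))" by simp
    also have "\<dots> \<le> (1 / 2) * (M * exp (K * r0))"
      using K False by (intro mult_right_mono) (auto simp: field_simps)
    finally have "w r0 \<le> C + (1 / 2) * (M * exp (K * r0))" using le[OF r0(1)] by linarith
    moreover have "w r0 = M * exp (K * r0)" by (simp add: M_def exp_minus)
    ultimately have "M * exp (K * r0) \<le> 2 * C" by linarith
    moreover have "M * 1 \<le> M * exp (K * r0)" using False K r0(1) by (intro mult_left_mono) auto
    ultimately show ?thesis by linarith
  qed (use C in linarith)
  then have "M * exp (K * r) \<le> 2 * C * exp (K * r)" by (intro mult_right_mono) auto
  then show ?thesis using wM[OF r] unfolding K_def by linarith
qed

text \<open>The equation is h' + m h / r = l + \<Phi>(h) with h(0) = 0, in a form without the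
  singular coefficient. Banach's theorem is applied to k = exp(-K r) h: the weight makes the map a
  contraction by 1/2 in the ordinary supremum metric, whatever the length R.\<close>

lemma scaled_integral_equation_solution:
  fixes \<Phi> :: "real \<Rightarrow> real"
  assumes R: "0 < R" and L: "0 \<le> L" "\<And>x y. \<bar>\<Phi> x - \<Phi> y\<bar> \<le> L * \<bar>x - y\<bar>" and M: "\<And>x. \<bar>\<Phi> x\<bar> \<le> M"
  shows "\<exists>h. continuous_on {0..R} h \<and> (\<forall>r\<in>{0..R}. h r = r * integral {0..1} (\<lambda>t. t ^ m * (l + \<Phi> (h (t * r)))))"
proof -
  define K where "K = 2 * L + 1"
  have K: "0 < K" "2 * L \<le> K" using L by (auto simp: K_def)
  \<comment> \<open>Clamping the radius to [0, R] lets the operator act on bounded continuous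
    functions on the whole line, a complete metric space available as a type.\<close>
  define \<kappa> where "\<kappa> r = max 0 (min r R)" for r :: real
  have \<kappa>: "0 \<le> \<kappa> r" "\<kappa> r \<le> R" "r \<in> {0..R} \<Longrightarrow> \<kappa> r = r" for r using R by (auto simp: \<kappa>_def)
  have \<Phi>_cont: "continuous_on UNIV \<Phi>"
  proof -
    have "L-lipschitz_on UNIV \<Phi>" using L by (intro lipschitz_onI) (auto simp: dist_real_def)
    then show ?thesis by (rule lipschitz_on_continuous_on)
  qed
  define G where "G k r t = t ^ m * (l + \<Phi> (exp (K * (t * \<kappa> r)) * k (t * \<kappa> r)))" for k :: "real \<Rightarrow> real" and r t
  define T where "T k r = exp (- K * \<kappa> r) * (\<kappa> r * integral {0..1} (G k r))" for k :: "real \<Rightarrow> real" and r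
  have Gc2: "continuous_on (UNIV \<times> {0..1}) (\<lambda>(r, t). G k r t)" if k: "continuous_on UNIV k" for k
    unfolding G_def \<kappa>_def case_prod_beta
    by (intro continuous_intros continuous_on_compose2[OF \<Phi>_cont] continuous_on_compose2[OF k]) auto
  have Gc: "continuous_on {0..1} (G k r)" if k: "continuous_on UNIV k" for k r
    unfolding G_def by (intro continuous_intros continuous_on_compose2[OF \<Phi>_cont] continuous_on_compose2[OF k]) auto
  have Gint: "G k r integrable_on {0..1}" if k: "continuous_on UNIV k" for k r
    by (rule integrable_continuous_real[OF Gc[OF k]])
  have T_bcont: "T k \<in> bcontfun" if k: "continuous_on UNIV k" for k
  proof -
    have "continuous_on UNIV (\<lambda>r. integral (cbox 0 1) (G k r))"
      by (rule integral_continuous_on_param) (use Gc2[OF k] in simp)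
    then have "continuous_on UNIV (T k)"
      unfolding T_def[abs_def] \<kappa>_def by (intro continuous_intros) auto
    moreover have "norm (T k r) \<le> R * (\<bar>l\<bar> + M)" for r
    proof -
      have "norm (integral {0..1} (G k r)) \<le> integral {0..1} (\<lambda>t::real. \<bar>l\<bar> + M)"
      proof (rule integral_norm_bound_integral[OF Gint[OF k]])
        fix t :: real assume t: "t \<in> {0..1}"
        have "norm (G k r t) = t ^ m * \<bar>l + \<Phi> (exp (K * (t * \<kappa> r)) * k (t * \<kappa> r))\<bar>" using t by (simp add: G_def abs_mult)
        also have "\<dots> \<le> 1 * (\<bar>l\<bar> + M)"
          using t M[of "exp (K * (t * \<kappa> r)) * k (t * \<kappa> r)"] by (intro mult_mono power_le_one) auto
        finally show "norm (G k r t) \<le> \<bar>l\<bar> + M" by simp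
      qed (rule integrable_continuous_real[OF continuous_on_const])
      then have I: "\<bar>integral {0..1} (G k r)\<bar> \<le> \<bar>l\<bar> + M" by simp
      have "norm (T k r) = exp (- K * \<kappa> r) * (\<kappa> r * \<bar>integral {0..1} (G k r)\<bar>)" using \<kappa> by (simp add: T_def abs_mult)
      also have "\<dots> \<le> 1 * (R * (\<bar>l\<bar> + M))"
        using I \<kappa>[of r] K R by (intro mult_mono) (auto intro: mult_nonneg_nonneg)
      finally show ?thesis by simp
    qed
    ultimately show ?thesis unfolding bcontfun_def bounded_iff by (auto intro!: exI[of _ "R * (\<bar>l\<bar> + M)"])
  qed
  define TT where "TT k = Bcontfun (T (apply_bcontfun k))" for k
  have TT: "apply_bcontfun (TT k) = T (apply_bcontfun k)" for k
    unfolding TT_def by (rule Bcontfun_inverse) (rule T_bcont, simp)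
  have contr: "dist (TT k) (TT k') \<le> (1/2) * dist k k'" for k k'
  proof (rule dist_bound)
    fix r
    let ?d = "dist k k'"
    have ck: "continuous_on UNIV (apply_bcontfun k)" "continuous_on UNIV (apply_bcontfun k')" by simp_all
    have "norm (integral {0..1} (\<lambda>t. G k r t - G k' r t)) \<le> integral {0..1} (\<lambda>t. L * ?d * exp (K * (t * \<kappa> r)))"
    proof (rule integral_norm_bound_integral)
      show "(\<lambda>t. G k r t - G k' r t) integrable_on {0..1}"
        by (intro integrable_diff Gint ck)
      show "(\<lambda>t. L * ?d * exp (K * (t * \<kappa> r))) integrable_on {0..1}"
        by (intro integrable_continuous_real continuous_intros)
      fix t :: real assume t: "t \<in> {0..1}"
      define s where "s = t * \<kappa> r"
      have "norm (G k r t - G k' r t) = t ^ m * \<bar>\<Phi> (exp (K * s) * k s) - \<Phi> (exp (K * s) * k' s)\<bar>"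
        using t by (simp add: G_def s_def abs_mult flip: right_diff_distrib)
      also have "\<dots> \<le> 1 * (L * \<bar>exp (K * s) * k s - exp (K * s) * k' s\<bar>)"
        using t by (intro mult_mono power_le_one L(2)) auto
      also have "\<dots> = L * (exp (K * s) * dist (k s) (k' s))"
        by (simp add: dist_real_def abs_mult flip: right_diff_distrib)
      also have "\<dots> \<le> L * (exp (K * s) * ?d)"
        using L(1) by (intro mult_left_mono dist_bounded) auto
      finally show "norm (G k r t - G k' r t) \<le> L * ?d * exp (K * (t * \<kappa> r))" by (simp add: s_def mult_ac)
    qed
    then have I: "\<bar>integral {0..1} (G k r) - integral {0..1} (G k' r)\<bar> \<le> L * ?d * integral {0..1} (\<lambda>t. exp (K * (t * \<kappa> r)))"
      by (simp add: integral_diff[OF Gint[OF ck(1)] Gint[OF ck(2)]])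
    have "dist (T k r) (T k' r) = exp (- K * \<kappa> r) * (\<kappa> r * \<bar>integral {0..1} (G k r) - integral {0..1} (G k' r)\<bar>)"
      using \<kappa>[of r] by (simp add: T_def dist_real_def abs_mult flip: right_diff_distrib)
    also have "\<dots> \<le> exp (- K * \<kappa> r) * (\<kappa> r * (L * ?d * integral {0..1} (\<lambda>t. exp (K * (t * \<kappa> r)))))"
      using I \<kappa>[of r] by (intro mult_left_mono) auto
    also have "\<dots> = exp (- K * \<kappa> r) * (L * ?d) * (\<kappa> r * integral {0..1} (\<lambda>t. exp (K * (t * \<kappa> r))))" by simp
    also have "\<dots> = exp (- K * \<kappa> r) * (L * ?d) * ((exp (K * \<kappa> r) - 1) / K)" by (simp only: integral_exp_stretch[OF K(1)])
    also have "\<dots> \<le> exp (- K * \<kappa> r) * (L * ?d) * (exp (K * \<kappa> r) / K)"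
      using K L(1) by (intro mult_left_mono divide_right_mono) auto
    also have "\<dots> = (L / K) * ?d" by (simp add: exp_minus field_simps)
    also have "\<dots> \<le> (1 / 2) * ?d" using K by (intro mult_right_mono) (auto simp: field_simps)
    finally show "dist (apply_bcontfun (TT k) r) (apply_bcontfun (TT k') r) \<le> (1 / 2) * ?d" unfolding TT .
  qed
  have "\<exists>!k. TT k = k" by (rule banach_fix_type[of "1/2"]) (use contr in auto)
  then obtain k where k: "TT k = k" by blast
  define h where "h r = exp (K * r) * apply_bcontfun k r" for r
  have "h r = r * integral {0..1} (\<lambda>t. t ^ m * (l + \<Phi> (h (t * r))))" if r: "r \<in> {0..R}" for r
  proof -
    have "apply_bcontfun k r = exp (- K * r) * (r * integral {0..1} (G (apply_bcontfun k) r))"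
      using fun_cong[OF TT[of k], of r] unfolding k T_def \<kappa>(3)[OF r] .
    moreover have "G (apply_bcontfun k) r = (\<lambda>t. t ^ m * (l + \<Phi> (h (t * r))))"
      using \<kappa>(3)[OF r] by (simp add: G_def h_def fun_eq_iff)
    ultimately show ?thesis by (simp add: h_def exp_minus field_simps)
  qed
  moreover have "continuous_on {0..R} h" unfolding h_def by (intro continuous_intros) auto
  ultimately show ?thesis by blast
qed

text \<open>Cutting the argument off at 0 and B makes the Riccati nonlinearity bounded and globally
  Lipschitz, as the fixed point argument demands. The cut-off disappears afterwards because the
  solution found stays between 0 and B.\<close>

lemma powr_truncated_Lipschitz:
  fixes p B :: real
  assumes p: "1 < p" and B: "0 < B"
  defines "\<Phi> \<equiv> \<lambda>h. (p - 1) * (max 0 (min h B)) powr (p / (p - 1))"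
  shows "0 \<le> \<Phi> x" "\<Phi> x \<le> (p - 1) * B powr (p / (p - 1))" "\<bar>\<Phi> x - \<Phi> y\<bar> \<le> p * B powr (1 / (p - 1)) * \<bar>x - y\<bar>" "x \<le> y \<Longrightarrow> \<Phi> x \<le> \<Phi> y"
proof -
  have p': "0 \<le> p / (p - 1)" using p by simp
  have mono: "\<Phi> x \<le> \<Phi> y" if "x \<le> y" for x y
    unfolding \<Phi>_def using that p p' by (intro mult_left_mono powr_mono2) auto
  then show "x \<le> y \<Longrightarrow> \<Phi> x \<le> \<Phi> y" .
  show "0 \<le> \<Phi> x" using p by (simp add: \<Phi>_def)
  show "\<Phi> x \<le> (p - 1) * B powr (p / (p - 1))"
    unfolding \<Phi>_def using p p' B by (intro mult_left_mono powr_mono2) auto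
  define C where "C = p * B powr (1 / (p - 1))"
  have core: "(p - 1) * b powr (p / (p - 1)) - (p - 1) * a powr (p / (p - 1)) \<le> C * (b - a)" if ab: "0 \<le> a" "a < b" "b \<le> B" for a b
  proof -
    define f where "f t = (p - 1) * t powr (p / (p - 1))" for t
    define f' where "f' t = p * t powr (1 / (p - 1))" for t
    have d: "(f has_real_derivative f' x) (at x)" if "a < x" "x < b" for x
    proof -
      have "p / (p - 1) - 1 = 1 / (p - 1)" using p by (simp add: field_simps)
      then show ?thesis unfolding f_def f'_def using that ab p
        by (auto intro!: derivative_eq_intros)
    qed
    have "\<exists>z>a. z < b \<and> f b - f a = (b - a) * f' z"
    proof (rule mvt[OF ab(2), of f "\<lambda>z h. h * f' z"])
      show "continuous_on {a..b} f" unfolding f_def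
        using ab p by (intro continuous_intros continuous_on_powr') auto
      show "(f has_derivative (\<lambda>h. h * f' x)) (at x)" if "a < x" "x < b" for x
        using d[OF that] by (simp add: has_field_derivative_def mult_commute_abs)
    qed auto
    then obtain z where z: "a < z" "z < b" "f b - f a = (b - a) * f' z" by blast
    have "f' z \<le> C" unfolding f'_def C_def using z ab p by (intro mult_left_mono powr_mono2) auto
    then have "(b - a) * f' z \<le> (b - a) * C" using ab by (intro mult_left_mono) auto
    then show ?thesis using z(3) by (simp add: f_def mult.commute)
  qed
  have C: "0 \<le> C" using p by (simp add: C_def)
  have le: "\<Phi> y - \<Phi> x \<le> C * (y - x)" if "x \<le> y" for x y
  proof (cases "max 0 (min x B) < max 0 (min y B)")
    case True
    have "\<Phi> y - \<Phi> x \<le> C * (max 0 (min y B) - max 0 (min x B))"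
      unfolding \<Phi>_def using B by (intro core True) auto
    also have "\<dots> \<le> C * (y - x)" using that C by (intro mult_left_mono) auto
    finally show ?thesis .
  next
    case False
    then have "max 0 (min x B) = max 0 (min y B)" using that by auto
    then show ?thesis using that C by (simp add: \<Phi>_def)
  qed
  show "\<bar>\<Phi> x - \<Phi> y\<bar> \<le> p * B powr (1 / (p - 1)) * \<bar>x - y\<bar>"
    using le[of x y] le[of y x] mono[of x y] mono[of y x] unfolding C_def[symmetric]
    by (cases "x \<le> y") auto
qed

text \<open>Shooting in l: the truncated equation is solved for every l, its end value depends
  continuously on l, and the intermediate value theorem hits B. Only then is it seen that the
  solution stays within the range where the truncation is inactive.\<close>

proposition radial_profile_exists:
  fixes p B R :: real and m :: nat
  assumes p: "1 < p" and B: "0 < B" and R: "0 < R"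
  obtains l :: real and q :: "real \<Rightarrow> real" where "0 \<le> l" "continuous_on UNIV q" "\<And>r. 0 \<le> q r"
    "R * integral {0..1} (\<lambda>t. t ^ m * q (t * R)) = B"
    "\<And>r. r \<in> {0..R} \<Longrightarrow> r * integral {0..1} (\<lambda>t. t ^ m * q (t * r)) \<le> B"
    "\<And>r. r \<in> {0..R} \<Longrightarrow> q r = l + (p - 1) * (r * integral {0..1} (\<lambda>t. t ^ m * q (t * r))) powr (p / (p - 1))"
proof -
  define \<Phi> where "\<Phi> h = (p - 1) * (max 0 (min h B)) powr (p / (p - 1))" for h :: real
  define L where "L = p * B powr (1 / (p - 1))"
  have L: "0 \<le> L" using p by (simp add: L_def)
  note \<Phi> = powr_truncated_Lipschitz[OF p B, folded \<Phi>_def L_def]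
  have \<Phi>0: "\<Phi> 0 = 0" using B by (simp add: \<Phi>_def)
  have \<Phi>_cont: "continuous_on UNIV \<Phi>"
  proof -
    have "L-lipschitz_on UNIV \<Phi>" using L \<Phi>(3) by (intro lipschitz_onI) (auto simp: dist_real_def)
    then show ?thesis by (rule lipschitz_on_continuous_on)
  qed
  have "\<exists>h. continuous_on {0..R} h \<and> (\<forall>r\<in>{0..R}. h r = r * integral {0..1} (\<lambda>t. t ^ m * (l + \<Phi> (h (t * r)))))" for l
    by (rule scaled_integral_equation_solution[OF R L \<Phi>(3), of "(p - 1) * B powr (p / (p - 1))"]) (use \<Phi>(1,2) in auto)
  then obtain h where hc: "\<And>l. continuous_on {0..R} (h l)"
    and h: "\<And>l r. r \<in> {0..R} \<Longrightarrow> h l r = r * integral {0..1} (\<lambda>t. t ^ m * (l + \<Phi> (h l (t * r))))"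
    by metis
  have tr: "t * r \<in> {0..R}" if "t \<in> {0..1}" "r \<in> {0..R}" for t r
    using that mult_mono[of t 1 r R] by auto
  have hcomp: "continuous_on {0..1} (\<lambda>t. h l (t * r))" if "r \<in> {0..R}" for l r
    by (rule continuous_on_compose2[OF hc]) (use tr that in \<open>auto intro!: continuous_intros\<close>)
  have Ic: "continuous_on {0..1} (\<lambda>t. t ^ m * (l + \<Phi> (h l' (t * r))))" if "r \<in> {0..R}" for l l' r
    by (intro continuous_intros continuous_on_compose2[OF \<Phi>_cont hcomp[OF that]]) auto
  note Ii = integrable_continuous_real[OF Ic]
  text \<open>Lipschitz dependence on the eigenvalue parameter, for the shooting argument.\<close>
  have lip: "\<bar>h l r - h l' r\<bar> \<le> 2 * (R * \<bar>l - l'\<bar>) * exp ((2 * L + 1) * r)" if r: "r \<in> {0..R}" for l l' r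
  proof (rule scaled_Gronwall[OF R L _ _ _ r])
    show "0 \<le> R * \<bar>l - l'\<bar>" using R by simp
    show "continuous_on {0..R} (\<lambda>r. \<bar>h l r - h l' r\<bar>)" by (intro continuous_intros hc)
    fix r assume r: "r \<in> {0..R}"
    let ?w = "\<lambda>r. \<bar>h l r - h l' r\<bar>"
    have "norm (integral {0..1} (\<lambda>t. t ^ m * (l + \<Phi> (h l (t * r))) - t ^ m * (l' + \<Phi> (h l' (t * r)))))
        \<le> integral {0..1} (\<lambda>t. \<bar>l - l'\<bar> + L * max 0 (?w (t * r)))"
    proof (rule integral_norm_bound_integral)
      show "(\<lambda>t. t ^ m * (l + \<Phi> (h l (t * r))) - t ^ m * (l' + \<Phi> (h l' (t * r)))) integrable_on {0..1}"
        by (intro integrable_diff Ii r)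
      show "(\<lambda>t. \<bar>l - l'\<bar> + L * max 0 (?w (t * r))) integrable_on {0..1}"
        by (intro integrable_continuous_real continuous_intros hcomp r)
      fix t :: real assume t: "t \<in> {0..1}"
      have "norm (t ^ m * (l + \<Phi> (h l (t * r))) - t ^ m * (l' + \<Phi> (h l' (t * r))))
          = t ^ m * \<bar>(l - l') + (\<Phi> (h l (t * r)) - \<Phi> (h l' (t * r)))\<bar>"
      proof -
        have "t ^ m * (l + \<Phi> (h l (t * r))) - t ^ m * (l' + \<Phi> (h l' (t * r)))
          = t ^ m * ((l - l') + (\<Phi> (h l (t * r)) - \<Phi> (h l' (t * r))))" by (simp add: algebra_simps)
        then show ?thesis using t by (simp only: real_norm_def abs_mult) simp
      qed
      also have "\<dots> \<le> 1 * (\<bar>l - l'\<bar> + L * ?w (t * r))"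
        using t \<Phi>(3)[of "h l (t * r)" "h l' (t * r)"] by (intro mult_mono power_le_one) auto
      finally show "norm (t ^ m * (l + \<Phi> (h l (t * r))) - t ^ m * (l' + \<Phi> (h l' (t * r)))) \<le> \<bar>l - l'\<bar> + L * max 0 (?w (t * r))"
        by simp
    qed
    also have "\<dots> = \<bar>l - l'\<bar> + L * integral {0..1} (\<lambda>t. max 0 (?w (t * r)))"
    proof -
      have "(\<lambda>t. L * max 0 (?w (t * r))) integrable_on {0..1}"
        by (intro integrable_continuous_real continuous_intros hcomp r)
      from integral_add[OF integrable_continuous_real[OF continuous_on_const[of _ "\<bar>l - l'\<bar>"]] this]
      show ?thesis by simp
    qed
    finally have I: "\<bar>integral {0..1} (\<lambda>t. t ^ m * (l + \<Phi> (h l (t * r)))) - integral {0..1} (\<lambda>t. t ^ m * (l' + \<Phi> (h l' (t * r))))\<bar>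
       \<le> \<bar>l - l'\<bar> + L * integral {0..1} (\<lambda>t. max 0 (?w (t * r)))"
      by (simp only: integral_diff[OF Ii[OF r] Ii[OF r]] real_norm_def)
    have "?w r = r * \<bar>integral {0..1} (\<lambda>t. t ^ m * (l + \<Phi> (h l (t * r)))) - integral {0..1} (\<lambda>t. t ^ m * (l' + \<Phi> (h l' (t * r))))\<bar>"
      using r unfolding h[OF r, of l] h[OF r, of l'] right_diff_distrib[symmetric] abs_mult by simp
    also have "\<dots> \<le> r * (\<bar>l - l'\<bar> + L * integral {0..1} (\<lambda>t. max 0 (?w (t * r))))"
      using r by (intro mult_left_mono I) auto
    also have "\<dots> = r * \<bar>l - l'\<bar> + L * (r * integral {0..1} (\<lambda>t. max 0 (?w (t * r))))" by (simp add: algebra_simps)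
    also have "\<dots> \<le> R * \<bar>l - l'\<bar> + L * (r * integral {0..1} (\<lambda>t. max 0 (?w (t * r))))"
      using r by (intro add_right_mono mult_right_mono) auto
    finally show "?w r \<le> R * \<bar>l - l'\<bar> + L * (r * integral {0..1} (\<lambda>t. max 0 (?w (t * r))))" .
  qed
  have Rin: "R \<in> {0..R}" using R by simp
  \<comment> \<open>Since \<Phi> is nonnegative, the end value is at least R l / (m + 1), which
    equals B for this l.\<close>
  define l1 where "l1 = B * (real m + 1) / R"
  have l1: "0 \<le> l1" using B R by (simp add: l1_def)
  have "\<exists>l\<ge>0. l \<le> l1 \<and> h l R = B"
  proof (rule IVT'[of "\<lambda>l. h l R" 0 B l1])
    have "((2 * R * exp ((2 * L + 1) * R)))-lipschitz_on {0..l1} (\<lambda>l. h l R)"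
      using lip[OF Rin] R by (intro lipschitz_onI) (auto simp: dist_real_def mult_ac)
    then show "continuous_on {0..l1} (\<lambda>l. h l R)" by (rule lipschitz_on_continuous_on)
    \<comment> \<open>With l = 0 the right-hand side is at most L times the positive part of h, so
      Gronwall with C = 0 gives a nonpositive end value.\<close>
    have "h 0 R \<le> 2 * 0 * exp ((2 * L + 1) * R)"
    proof (rule scaled_Gronwall[OF R L order_refl hc _ Rin])
      fix r assume r: "r \<in> {0..R}"
      have "integral {0..1} (\<lambda>t. t ^ m * (0 + \<Phi> (h 0 (t * r)))) \<le> integral {0..1} (\<lambda>t. L * max 0 (h 0 (t * r)))"
      proof (rule integral_le[OF Ii[OF r]])
        show "(\<lambda>t. L * max 0 (h 0 (t * r))) integrable_on {0..1}"
          by (intro integrable_continuous_real continuous_intros hcomp r)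
        fix t :: real assume t: "t \<in> {0..1}"
        have "\<Phi> x \<le> L * max 0 x" for x
          using \<Phi>(3)[of x 0] \<Phi>(4)[of x 0] \<Phi>(1)[of x] by (cases "0 \<le> x") (auto simp: \<Phi>0)
        then have "t ^ m * \<Phi> (h 0 (t * r)) \<le> 1 * (L * max 0 (h 0 (t * r)))"
          using t L \<Phi>(1) by (intro mult_mono power_le_one) auto
        then show "t ^ m * (0 + \<Phi> (h 0 (t * r))) \<le> L * max 0 (h 0 (t * r))" by simp
      qed
      then have "r * integral {0..1} (\<lambda>t. t ^ m * (0 + \<Phi> (h 0 (t * r)))) \<le> r * (L * integral {0..1} (\<lambda>t. max 0 (h 0 (t * r))))"
        using r by (intro mult_left_mono) auto
      then show "h 0 r \<le> 0 + L * (r * integral {0..1} (\<lambda>t. max 0 (h 0 (t * r))))"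
        by (subst h[OF r]) (simp add: mult_ac)
    qed
    then show "h 0 R \<le> B" using B by simp
    have "integral {0..1} (\<lambda>t. l1 * t ^ m) \<le> integral {0..1} (\<lambda>t. t ^ m * (l1 + \<Phi> (h l1 (t * R))))"
    proof (rule integral_le[OF _ Ii[OF Rin]])
      show "(\<lambda>t. l1 * t ^ m) integrable_on {0..1::real}" by (intro integrable_continuous_real continuous_intros)
      fix t :: real assume "t \<in> {0..1}"
      then show "l1 * t ^ m \<le> t ^ m * (l1 + \<Phi> (h l1 (t * R)))" using \<Phi>(1) by (simp add: algebra_simps)
    qed
    moreover have "integral {0..1} (\<lambda>t. l1 * t ^ m) = l1 / (real m + 1)"
    proof -
      from integral_unique[OF has_integral_mult_right[OF has_integral_power_01, of l1 m]] show ?thesis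
        by simp
    qed
    ultimately have "R * (l1 / (real m + 1)) \<le> h l1 R" using R by (subst h[OF Rin]) (intro mult_left_mono, auto)
    moreover have "R * (l1 / (real m + 1)) = B"
    proof -
      have "real m + 1 \<noteq> 0" by linarith
      then have "l1 / (real m + 1) = B / R" by (simp add: l1_def)
      then show ?thesis using R by simp
    qed
    ultimately show "B \<le> h l1 R" by simp
  qed (use l1 in auto)
  then obtain l where l: "0 \<le> l" "h l R = B" by blast
  have h0: "0 \<le> h l r" if r: "r \<in> {0..R}" for r
    using r l(1) \<Phi>(1) by (subst h[OF r]) (intro mult_nonneg_nonneg integral_nonneg Ii, auto)
  \<comment> \<open>Monotonicity in the radius without differentiation: for \<mu> = r / R the
    rescaled function h(\<mu> s) satisfies the integral equation with an additional factor \<mu>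
    \<le> 1, so Gronwall places it below h(s). At s = R this reads h(r) \<le> h(R) = B.\<close>
  have hB: "h l r \<le> B" if r: "r \<in> {0..R}" for r
  proof -
    define \<mu> where "\<mu> = r / R"
    have la: "0 \<le> \<mu>" "\<mu> \<le> 1" "\<mu> * R = r" using r R by (auto simp: \<mu>_def)
    have "h l (\<mu> * R) - h l R \<le> 2 * 0 * exp ((2 * L + 1) * R)"
    proof (rule scaled_Gronwall[OF R L order_refl _ _ Rin, where w="\<lambda>r. h l (\<mu> * r) - h l r"])
      have inR: "\<mu> * r \<in> {0..R}" if "r \<in> {0..R}" for r using tr[of \<mu> r] that la by auto
      show "continuous_on {0..R} (\<lambda>r. h l (\<mu> * r) - h l r)"
        by (intro continuous_intros hc continuous_on_compose2[OF hc]) (use inR in auto)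
      fix s assume s: "s \<in> {0..R}"
      let ?I = "integral {0..1} (\<lambda>t. t ^ m * (l + \<Phi> (h l (t * (\<mu> * s)))))"
      have I0: "0 \<le> ?I" by (intro integral_nonneg Ii inR s) (use l(1) \<Phi>(1) in auto)
      have c1: "continuous_on {0..1} (\<lambda>t. h l (\<mu> * (t * s)))"
        using hcomp[OF inR[OF s], of l] by (simp add: mult.left_commute)
      have "?I - integral {0..1} (\<lambda>t. t ^ m * (l + \<Phi> (h l (t * s)))) = integral {0..1} (\<lambda>t. t ^ m * (l + \<Phi> (h l (t * (\<mu> * s)))) - t ^ m * (l + \<Phi> (h l (t * s))))"
        by (rule integral_diff[OF Ii[OF inR[OF s]] Ii[OF s], symmetric])
      also have "\<dots> \<le> integral {0..1} (\<lambda>t. L * max 0 (h l (\<mu> * (t * s)) - h l (t * s)))"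
      proof (rule integral_le)
        show "(\<lambda>t. t ^ m * (l + \<Phi> (h l (t * (\<mu> * s)))) - t ^ m * (l + \<Phi> (h l (t * s)))) integrable_on {0..1}"
          by (intro integrable_diff Ii inR s)
        show "(\<lambda>t. L * max 0 (h l (\<mu> * (t * s)) - h l (t * s))) integrable_on {0..1}"
          by (intro integrable_continuous_real continuous_intros hcomp s c1)
        fix t :: real assume t: "t \<in> {0..1}"
        have *: "\<Phi> x - \<Phi> y \<le> L * max 0 (x - y)" for x y
          using \<Phi>(3)[of x y] \<Phi>(4)[of x y] by (cases "y \<le> x") auto
        have "t ^ m * (\<Phi> (h l (t * (\<mu> * s))) - \<Phi> (h l (t * s))) \<le> t ^ m * (L * max 0 (h l (t * (\<mu> * s)) - h l (t * s)))"
          using t by (intro mult_left_mono *) auto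
        also have "\<dots> \<le> 1 * (L * max 0 (h l (t * (\<mu> * s)) - h l (t * s)))"
          using t L by (intro mult_right_mono power_le_one) auto
        finally show "t ^ m * (l + \<Phi> (h l (t * (\<mu> * s)))) - t ^ m * (l + \<Phi> (h l (t * s))) \<le> L * max 0 (h l (\<mu> * (t * s)) - h l (t * s))"
          by (simp add: algebra_simps)
      qed
      finally have D: "s * (?I - integral {0..1} (\<lambda>t. t ^ m * (l + \<Phi> (h l (t * s))))) \<le> s * (L * integral {0..1} (\<lambda>t. max 0 (h l (\<mu> * (t * s)) - h l (t * s))))"
        using s by (intro mult_left_mono) auto
      have "h l (\<mu> * s) = \<mu> * (s * ?I)" by (subst h[OF inR[OF s]]) simp
      also have "\<dots> \<le> 1 * (s * ?I)" using la I0 s by (intro mult_right_mono) auto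
      finally show "h l (\<mu> * s) - h l s \<le> 0 + L * (s * integral {0..1} (\<lambda>t. max 0 (h l (\<mu> * (t * s)) - h l (t * s))))"
        using D unfolding h[OF s, of l] right_diff_distrib mult.left_commute[of s L] by linarith
    qed
    then show ?thesis using la l(2) by simp
  qed
  \<comment> \<open>The divergence is extended by constants beyond [0, R], which keeps it continuous
    and nonnegative on the whole line.\<close>
  define \<kappa> where "\<kappa> r = max 0 (min r R)" for r :: real
  define q where "q r = l + \<Phi> (h l (\<kappa> r))" for r
  have \<kappa>: "\<kappa> r \<in> {0..R}" "r \<in> {0..R} \<Longrightarrow> \<kappa> r = r" for r using R by (auto simp: \<kappa>_def)
  have qh: "r * integral {0..1} (\<lambda>t. t ^ m * q (t * r)) = h l r" if r: "r \<in> {0..R}" for r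
  proof -
    have "integral {0..1} (\<lambda>t. t ^ m * q (t * r)) = integral {0..1} (\<lambda>t. t ^ m * (l + \<Phi> (h l (t * r))))"
      by (intro Henstock_Kurzweil_Integration.integral_cong) (simp add: q_def \<kappa>(2)[OF tr[OF _ r]])
    then show ?thesis using h[OF r, of l] by simp
  qed
  show ?thesis
  proof (rule that[of l q])
    have "continuous_on UNIV (\<lambda>r. h l (\<kappa> r))"
      by (rule continuous_on_compose2[OF hc]) (use \<kappa>(1) in \<open>auto simp: \<kappa>_def intro!: continuous_intros\<close>)
    then show "continuous_on UNIV q" unfolding q_def
      by (intro continuous_intros continuous_on_compose2[OF \<Phi>_cont]) auto
    show "0 \<le> q r" for r using l(1) \<Phi>(1) by (simp add: q_def)
    show "R * integral {0..1} (\<lambda>t. t ^ m * q (t * R)) = B" using qh[OF Rin] l(2) by simp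
    show "r * integral {0..1} (\<lambda>t. t ^ m * q (t * r)) \<le> B" if "r \<in> {0..R}" for r using qh[OF that] hB[OF that] by simp
    show "q r = l + (p - 1) * (r * integral {0..1} (\<lambda>t. t ^ m * q (t * r))) powr (p / (p - 1))" if r: "r \<in> {0..R}" for r
      unfolding qh[OF r] using h0[OF r] hB[OF r] \<kappa>(2)[OF r] by (simp add: q_def \<Phi>_def)
  qed fact
qed

text \<open>The substitution s = t r shows that a(r) is the integral of s^m q(s) over [0, r] divided
  by r^(m+1), which can be differentiated for r > 0. The form over [0, 1] gives continuity across 0
  and the value there.\<close>

lemma radial_mean:
  fixes q :: "real \<Rightarrow> real" and m :: nat
  assumes q: "continuous_on UNIV q"
  defines "a \<equiv> \<lambda>r. integral {0..1} (\<lambda>t. t ^ m * q (t * r))"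
  shows "continuous_on UNIV a"
    and "0 < r \<Longrightarrow> (a has_real_derivative (q r - (real m + 1) * a r) / r) (at r)"
    and "a 0 = q 0 / (real m + 1)"
proof -
  have "continuous_on UNIV (\<lambda>r. integral (cbox 0 1) (\<lambda>t. t ^ m * q (t * r)))"
    by (rule integral_continuous_on_param)
       (auto simp: case_prod_beta intro!: continuous_intros continuous_on_compose2[OF q])
  then show "continuous_on UNIV a" by (simp add: a_def)
  from integral_unique[OF has_integral_mult_left[OF has_integral_power_01, of m "q 0"]]
  show "a 0 = q 0 / (real m + 1)" by (simp add: a_def)
  define J where "J r = integral {0..r} (\<lambda>s. s ^ m * q s)" for r
  have cont: "continuous_on S (\<lambda>s. s ^ m * q s)" for S
    by (intro continuous_intros continuous_on_subset[OF q]) auto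
  have aJ: "a r = J r / r ^ (m + 1)" if r: "0 < r" for r
  proof -
    have "((\<lambda>s. s ^ m * q s) has_integral J r) {0..r}"
      unfolding J_def by (intro integrable_integral integrable_continuous_real cont)
    from has_integral_stretch_real[OF this, of r]
    have "((\<lambda>t. (r * t) ^ m * q (r * t)) has_integral (1 / r) * J r) ((\<lambda>x. x / r) ` {0..r})" using r by simp
    moreover have "(\<lambda>x. x / r) ` {0..r} = {0..1}"
      using r by (auto simp: image_iff field_simps intro!: bexI[of _ "_ * r"])
    ultimately have "((\<lambda>t. (1 / r ^ m) * ((r * t) ^ m * q (r * t))) has_integral (1 / r ^ m) * ((1 / r) * J r)) {0..1}"
      by (intro has_integral_mult_right) simp
    moreover have "(\<lambda>t. (1 / r ^ m) * ((r * t) ^ m * q (r * t))) = (\<lambda>t. t ^ m * q (t * r))"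
      using r by (auto simp: power_mult_distrib mult.commute)
    ultimately show ?thesis by (simp add: a_def integral_unique mult.commute)
  qed
  assume r: "0 < r"
  have "(J has_real_derivative r ^ m * q r) (at r within {0..r+1})"
    unfolding J_def by (rule integral_has_real_derivative[OF cont]) (use r in auto)
  then have dJ: "(J has_real_derivative r ^ m * q r) (at r)"
    using r by (subst (asm) at_within_Icc_at) auto
  have "((\<lambda>r. J r / r ^ (m + 1)) has_real_derivative ((r ^ m * q r) * r ^ (m + 1) - J r * (real (m + 1) * r ^ m)) / (r ^ (m + 1) * r ^ (m + 1))) (at r)"
    using DERIV_divide[OF dJ DERIV_pow[of "m + 1"]] r by simp
  also have "((r ^ m * q r) * r ^ (m + 1) - J r * (real (m + 1) * r ^ m)) / (r ^ (m + 1) * r ^ (m + 1)) = (q r - (real m + 1) * a r) / r"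
    using r by (simp add: aJ field_simps)
  finally show "(a has_real_derivative (q r - (real m + 1) * a r) / r) (at r)"
    by (rule has_field_derivative_transform_within_open[of _ _ _ "{0<..}"]) (use r aJ in auto)
qed

section \<open>The radial field\<close>

lemma C1_fun_shift:
  assumes "C1_fun f df"
  shows "C1_fun (\<lambda>x. f (x - x0)) (\<lambda>x. df (x - x0))"
proof -
  have "((\<lambda>x. f (x - x0)) has_derivative (\<lambda>h. df (x - x0) \<bullet> h)) (at x)" for x
  proof -
    have 1: "((\<lambda>x. x - x0) has_derivative (\<lambda>h. h)) (at x)" by (auto intro!: derivative_eq_intros)
    have 2: "(f has_derivative (\<lambda>h. df (x - x0) \<bullet> h)) (at (x - x0))" using assms by (simp add: C1_fun_def)
    show ?thesis using has_derivative_compose[OF 1 2] .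
  qed
  moreover have "continuous_on UNIV (\<lambda>x. df (x - x0))"
    by (rule continuous_on_compose2[OF C1_fun_continuous_grad[OF assms, of UNIV]]) (auto intro!: continuous_intros)
  ultimately show ?thesis by (simp add: C1_fun_def)
qed

lemma abs_powr_has_derivative:
  fixes p t :: real
  assumes p: "1 < p"
  shows "((\<lambda>t. \<bar>t\<bar> powr p) has_real_derivative p * \<bar>t\<bar> powr (p - 1) * sgn t) (at t)"
proof (cases t "0::real" rule: linorder_cases)
  case greater
  have "((\<lambda>t. t powr p) has_real_derivative p * \<bar>t\<bar> powr (p - 1) * sgn t) (at t)"
    using greater by (auto intro!: derivative_eq_intros)
  then show ?thesis
    by (rule has_field_derivative_transform_within_open[of _ _ _ "{0<..}"]) (use greater in auto)
next
  case less
  have "((\<lambda>t. (- t) powr p) has_real_derivative p * \<bar>t\<bar> powr (p - 1) * sgn t) (at t)"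
    using less by (auto intro!: derivative_eq_intros)
  then show ?thesis
    by (rule has_field_derivative_transform_within_open[of _ _ _ "{..<0}"]) (use less in auto)
next
  case equal
  have "((\<lambda>h. (\<bar>0 + h\<bar> powr p - \<bar>0\<bar> powr p) / h) \<longlongrightarrow> 0) (at 0)"
  proof (rule Lim_null_comparison)
    show "\<forall>\<^sub>F h in at 0. norm ((\<bar>0 + h\<bar> powr p - \<bar>0\<bar> powr p) / h) \<le> \<bar>h\<bar> powr (p - 1)"
      by (intro always_eventually allI) (auto simp: powr_diff)
    have "((\<lambda>h::real. \<bar>h\<bar> powr (p - 1)) \<longlongrightarrow> \<bar>0\<bar> powr (p - 1)) (at 0)"
      using p by (intro tendsto_intros) auto
    then show "((\<lambda>h::real. \<bar>h\<bar> powr (p - 1)) \<longlongrightarrow> 0) (at 0)" by simp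
  qed
  then show ?thesis using equal by (simp add: DERIV_def)
qed

lemma continuous_abs_powr_derivative:
  fixes p :: real
  assumes p: "1 < p"
  shows "continuous_on UNIV (\<lambda>t. p * \<bar>t\<bar> powr (p - 1) * sgn t)"
proof (intro continuous_at_imp_continuous_on ballI)
  fix t :: real
  show "isCont (\<lambda>t. p * \<bar>t\<bar> powr (p - 1) * sgn t) t"
  proof (cases "t = 0")
    case True
    have "((\<lambda>t. p * \<bar>t\<bar> powr (p - 1) * sgn t) \<longlongrightarrow> 0) (at 0)"
    proof (rule Lim_null_comparison)
      show "\<forall>\<^sub>F h in at 0. norm (p * \<bar>h\<bar> powr (p - 1) * sgn h) \<le> p * \<bar>h\<bar> powr (p - 1)"
        using p by (intro always_eventually allI) (auto simp: abs_mult sgn_if)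
      have "((\<lambda>h::real. p * \<bar>h\<bar> powr (p - 1)) \<longlongrightarrow> p * \<bar>0\<bar> powr (p - 1)) (at 0)"
        using p by (intro tendsto_intros) auto
      then show "((\<lambda>h::real. p * \<bar>h\<bar> powr (p - 1)) \<longlongrightarrow> 0) (at 0)" by simp
    qed
    then show ?thesis using True by (simp add: isCont_def)
  next
    case False
    have "((\<lambda>t. p * \<bar>t\<bar> powr (p - 1) * sgn t) \<longlongrightarrow> p * \<bar>t\<bar> powr (p - 1) * sgn t) (at t)"
      using False p by (intro tendsto_intros) auto
    then show ?thesis by (simp add: isCont_def)
  qed
qed

lemma C1_fun_abs_powr:
  assumes "C1_fun u du" "1 < p"
  shows "C1_fun (\<lambda>x. \<bar>u x\<bar> powr p) (\<lambda>x. (p * \<bar>u x\<bar> powr (p - 1) * sgn (u x)) *\<^sub>R du x)"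
  by (rule C1_fun_compose[OF assms(1) abs_powr_has_derivative[OF assms(2)] continuous_abs_powr_derivative[OF assms(2)]])

text \<open>Whichever of b and \<open>\<tau> * a\<close> is larger dominates the sum. The factor of
  a tends to 1 with \<tau>, which lets error terms vanish without loss in the main term.\<close>

lemma add_powr_le:
  fixes a b p \<tau> :: real
  assumes "0 \<le> a" "0 \<le> b" "0 < \<tau>" "0 \<le> p"
  shows "(a + b) powr p \<le> (1 + \<tau>) powr p * a powr p + (1 + 1 / \<tau>) powr p * b powr p"
proof (cases "b \<le> \<tau> * a")
  case True
  then have "(a + b) powr p \<le> ((1 + \<tau>) * a) powr p" using assms by (intro powr_mono2) (auto simp: algebra_simps)
  also have "\<dots> = (1 + \<tau>) powr p * a powr p" using assms by (simp add: powr_mult)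
  finally show ?thesis by (simp add: add_increasing2)
next
  case False
  then have "a + b \<le> (1 + 1 / \<tau>) * b" using assms by (simp add: field_simps)
  then have "(a + b) powr p \<le> ((1 + 1 / \<tau>) * b) powr p" using assms by (intro powr_mono2) auto
  also have "\<dots> = (1 + 1 / \<tau>) powr p * b powr p" using assms by (simp add: powr_mult)
  finally show ?thesis by (simp add: add_increasing)
qed

context finsler
begin

lemma gradN_bounded: "\<exists>K>0. \<forall>v. norm (gradN v) \<le> K"
proof -
  obtain a b where a: "0 < a" "\<And>\<xi>. a * norm \<xi> \<le> F \<xi>" using F_bounds by blast
  have "norm (gradN v) \<le> 1 / a" for v using a(1) a(2)[of "gradN v"] F_gradN[of v] by (simp add: field_simps)
  then show ?thesis using a(1) by (intro exI[of _ "1 / a"]) auto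
qed

lemma polar_tendsto_zero: "(N \<longlongrightarrow> 0) (at 0)"
  using continuous_on_tendsto_compose[OF polar_continuous[of UNIV], of "\<lambda>x. x" 0 "at 0"] by (simp add: tendsto_ident_at)

text \<open>At the origin, where \<open>N\<close> is not differentiable, smoothness comes from \<open>\<rho>' 0 = 0\<close>.\<close>

lemma C1_fun_radial:
  assumes d\<rho>: "\<And>r. 0 \<le> r \<Longrightarrow> (\<rho> has_real_derivative \<rho>' r) (at r)"
    and c: "continuous_on UNIV \<rho>'" and 0: "\<rho>' 0 = 0"
  shows "C1_fun (\<lambda>x. \<rho> (N x)) (\<lambda>x. \<rho>' (N x) *\<^sub>R gradN x)"
  unfolding C1_fun_def
proof (intro conjI allI)
  fix x
  show "((\<lambda>x. \<rho> (N x)) has_derivative (\<lambda>h. (\<rho>' (N x) *\<^sub>R gradN x) \<bullet> h)) (at x)"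
  proof (cases "x = 0")
    case False
    have "(\<lambda>h. (\<rho>' (N x) *\<^sub>R gradN x) \<bullet> h) = (\<lambda>h. (gradN x \<bullet> h) * \<rho>' (N x))" by (auto simp: mult.commute)
    then show ?thesis
      using DERIV_compose_FDERIV[OF d\<rho>[OF polar_nonneg] polar_has_derivative[OF False]] by simp
  next
    case True
    obtain a where a: "0 < a" "\<And>v. a * N v \<le> norm v" using polar_bounds by blast
    have "((\<lambda>h. (\<rho> (0 + h) - \<rho> 0) / h) \<longlongrightarrow> \<rho>' 0) (at 0)" using d\<rho>[of 0] by (simp add: DERIV_def)
    then have "((\<lambda>h. (\<rho> h - \<rho> 0) / h) \<longlongrightarrow> 0) (at 0)" by (simp add: 0)
    moreover have "filterlim N (at 0) (at 0)"
      unfolding filterlim_at using polar_tendsto_zero polar_pos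
      by (auto simp: eventually_at intro!: exI[of _ 1]) (metis less_irrefl)
    ultimately have "((\<lambda>x. (\<rho> (N x) - \<rho> 0) / N x) \<longlongrightarrow> 0) (at 0)" by (rule filterlim_compose)
    then have "((\<lambda>x. norm ((\<rho> (N x) - \<rho> 0) / N x) * (1 / a)) \<longlongrightarrow> norm (0::real) * (1 / a)) (at 0)"
      by (intro tendsto_intros)
    then have lim: "((\<lambda>x. norm ((\<rho> (N x) - \<rho> 0) / N x) * (1 / a)) \<longlongrightarrow> 0) (at 0)" by simp
    have "((\<lambda>x. \<rho> (N x)) has_derivative (\<lambda>h. 0)) (at 0)"
      unfolding has_derivative_iff_norm
    proof (intro conjI bounded_linear_zero)
      show "((\<lambda>y. norm (\<rho> (N y) - \<rho> (N 0) - 0) / norm (y - 0)) \<longlongrightarrow> 0) (at 0)"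
      proof (rule Lim_null_comparison[OF _ lim], intro always_eventually allI)
        fix y
        show "norm (norm (\<rho> (N y) - \<rho> (N 0) - 0) / norm (y - 0)) \<le> norm ((\<rho> (N y) - \<rho> 0) / N y) * (1 / a)"
        proof (cases "y = 0")
          case False
          have "norm (\<rho> (N y) - \<rho> 0) / norm y \<le> norm (\<rho> (N y) - \<rho> 0) / (a * N y)"
            using a polar_pos[OF False] False by (intro divide_left_mono) auto
          then show ?thesis using polar_pos[OF False] by (simp add: mult.commute)
        qed simp
      qed
    qed
    then show ?thesis using True by (simp add: 0)
  qed
next
  show "continuous_on UNIV (\<lambda>x. \<rho>' (N x) *\<^sub>R gradN x)"
  proof (intro continuous_at_imp_continuous_on ballI)
    fix x
    have cN: "((\<lambda>x. \<rho>' (N x)) \<longlongrightarrow> \<rho>' (N x)) (at x)" for x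
      using continuous_on_compose2[OF c polar_continuous[of UNIV]] by (auto simp: continuous_on_def)
    show "isCont (\<lambda>x. \<rho>' (N x) *\<^sub>R gradN x) x"
    proof (cases "x = 0")
      case False
      then show ?thesis unfolding isCont_def
        by (intro tendsto_scaleR cN) (use isCont_gradN[OF False] in \<open>simp add: isCont_def\<close>)
    next
      case True
      obtain K where K: "\<And>v. norm (gradN v) \<le> K" using gradN_bounded by blast
      have "((\<lambda>x. norm (\<rho>' (N x)) * K) \<longlongrightarrow> norm (\<rho>' (N 0)) * K) (at 0)"
        by (intro tendsto_intros cN)
      then have lim: "((\<lambda>x. norm (\<rho>' (N x)) * K) \<longlongrightarrow> 0) (at 0)" by (simp add: 0)
      have "((\<lambda>x. \<rho>' (N x) *\<^sub>R gradN x) \<longlongrightarrow> 0) (at 0)"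
        by (rule Lim_null_comparison[OF _ lim], intro always_eventually allI) (auto intro!: mult_left_mono K)
      then show ?thesis using True by (simp add: isCont_def 0)
    qed
  qed
qed

text \<open>A component of the field a(N x) x. At the origin the factor 1 / N is balanced by x
  \<bullet> b, and q - n a tends to 0 because a 0 = q 0 / n, so the gradient is continuous there.
  The divergence is n a + N a' by Euler's relation, and this is q.\<close>

lemma C1_fun_radial_field:
  fixes q :: "real \<Rightarrow> real"
  defines "a \<equiv> \<lambda>r. integral {0..1} (\<lambda>t. t ^ (DIM('a) - 1) * q (t * r))"
  defines "g \<equiv> \<lambda>b x. a (N x) *\<^sub>R b + ((q (N x) - real DIM('a) * a (N x)) / N x * (x \<bullet> b)) *\<^sub>R gradN x"
  assumes q: "continuous_on UNIV q"
  shows "C1_fun (\<lambda>x. a (N x) * (x \<bullet> b)) (g b)"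
    and "(\<Sum>b\<in>Basis. g b x \<bullet> b) = q (N x)"
proof -
  define n where "n = real DIM('a)"
  have n: "real (DIM('a) - 1) + 1 = n" "0 < n" by (simp_all add: n_def)
  have rm: "continuous_on UNIV a" "\<And>r. 0 < r \<Longrightarrow> (a has_real_derivative (q r - n * a r) / r) (at r)" "a 0 = q 0 / n"
    using radial_mean[where m="DIM('a) - 1", OF q] unfolding a_def n by auto
  have g: "g b x = a (N x) *\<^sub>R b + ((q (N x) - n * a (N x)) / N x * (x \<bullet> b)) *\<^sub>R gradN x" for b x by (simp add: g_def n_def)
  have aN: "((\<lambda>x. a (N x)) \<longlongrightarrow> a (N x)) (at x)" for x
    using continuous_on_compose2[OF rm(1) polar_continuous[of UNIV]] by (auto simp: continuous_on_def)
  have qN: "((\<lambda>x. q (N x)) \<longlongrightarrow> q (N x)) (at x)" for x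
    using continuous_on_compose2[OF q polar_continuous[of UNIV]] by (auto simp: continuous_on_def)
  have NN: "(N \<longlongrightarrow> N x) (at x)" for x
    using polar_continuous[of UNIV] by (auto simp: continuous_on_def)
  show "C1_fun (\<lambda>x. a (N x) * (x \<bullet> b)) (g b)"
    unfolding C1_fun_def
  proof (intro conjI allI)
    fix x
    show "((\<lambda>x. a (N x) * (x \<bullet> b)) has_derivative (\<lambda>h. g b x \<bullet> h)) (at x)"
    proof (cases "x = 0")
      case False
      have d1: "((\<lambda>x. a (N x)) has_derivative (\<lambda>h. (gradN x \<bullet> h) * ((q (N x) - n * a (N x)) / N x))) (at x)"
        using DERIV_compose_FDERIV[OF rm(2)[OF polar_pos[OF False]] polar_has_derivative[OF False]] .
      have d2: "((\<lambda>x. x \<bullet> b) has_derivative (\<lambda>h. h \<bullet> b)) (at x)"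
        by (auto intro!: derivative_eq_intros)
      have "(\<lambda>h. g b x \<bullet> h) = (\<lambda>h. a (N x) * (h \<bullet> b) + ((gradN x \<bullet> h) * ((q (N x) - n * a (N x)) / N x)) * (x \<bullet> b))"
        by (rule ext) (simp add: g inner_add_left inner_commute[of _ b] mult_ac)
      then show ?thesis using has_derivative_mult[OF d1 d2] by simp
    next
      case True
      have "((\<lambda>x. norm (a (N x) - a 0) * norm b) \<longlongrightarrow> norm (a (N 0) - a 0) * norm b) (at 0)"
        by (intro tendsto_intros aN)
      then have lim: "((\<lambda>x. norm (a (N x) - a 0) * norm b) \<longlongrightarrow> 0) (at 0)" by simp
      have "((\<lambda>x. a (N x) * (x \<bullet> b)) has_derivative (\<lambda>h. (a 0 *\<^sub>R b) \<bullet> h)) (at 0)"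
        unfolding has_derivative_iff_norm
      proof (intro conjI bounded_linear_inner_right)
        show "((\<lambda>y. norm (a (N y) * (y \<bullet> b) - a (N 0) * (0 \<bullet> b) - (a 0 *\<^sub>R b) \<bullet> (y - 0)) / norm (y - 0)) \<longlongrightarrow> 0) (at 0)"
        proof (rule Lim_null_comparison[OF _ lim], intro always_eventually allI)
          fix y
          have "a (N y) * (y \<bullet> b) - a (N 0) * (0 \<bullet> b) - (a 0 *\<^sub>R b) \<bullet> (y - 0) = (a (N y) - a 0) * (y \<bullet> b)"
            by (simp add: inner_commute algebra_simps)
          moreover have "\<bar>(a (N y) - a 0) * (y \<bullet> b)\<bar> \<le> \<bar>a (N y) - a 0\<bar> * (norm y * norm b)"
            unfolding abs_mult by (intro mult_left_mono Cauchy_Schwarz_ineq2) auto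
          ultimately show "norm (norm (a (N y) * (y \<bullet> b) - a (N 0) * (0 \<bullet> b) - (a 0 *\<^sub>R b) \<bullet> (y - 0)) / norm (y - 0)) \<le> norm (a (N y) - a 0) * norm b"
            by (cases "y = 0") (auto simp: divide_le_eq mult_ac)
        qed
      qed
      then show ?thesis using True by (simp add: g)
    qed
  next
    show "continuous_on UNIV (g b)"
    proof (intro continuous_at_imp_continuous_on ballI)
      fix x
      show "isCont (g b) x"
      proof (cases "x = 0")
        case False
        have "((\<lambda>x. a (N x) *\<^sub>R b + ((q (N x) - n * a (N x)) / N x * (x \<bullet> b)) *\<^sub>R gradN x) \<longlongrightarrow>
            a (N x) *\<^sub>R b + ((q (N x) - n * a (N x)) / N x * (x \<bullet> b)) *\<^sub>R gradN x) (at x)"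
          using polar_pos[OF False] isCont_gradN[OF False]
          by (intro tendsto_intros aN qN NN) (auto simp: isCont_def)
        then show ?thesis by (simp add: isCont_def g[abs_def])
      next
        case True
        obtain K where K: "0 < K" "\<And>v. norm (gradN v) \<le> K" using gradN_bounded by blast
        obtain d where d: "0 < d" "\<And>v. norm v \<le> d * N v" using polar_bounds by blast
        have "((\<lambda>x. \<bar>a (N x) - a 0\<bar> * norm b + \<bar>q (N x) - n * a (N x)\<bar> * (d * norm b) * K) \<longlongrightarrow>
           \<bar>a (N 0) - a 0\<bar> * norm b + \<bar>q (N 0) - n * a (N 0)\<bar> * (d * norm b) * K) (at 0)"
          by (intro tendsto_intros aN qN)
        then have lim: "((\<lambda>x. \<bar>a (N x) - a 0\<bar> * norm b + \<bar>q (N x) - n * a (N x)\<bar> * (d * norm b) * K) \<longlongrightarrow> 0) (at 0)"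
          using n(2) by (simp add: rm(3))
        have "((\<lambda>x. g b x - a 0 *\<^sub>R b) \<longlongrightarrow> 0) (at 0)"
        proof (rule Lim_null_comparison[OF _ lim], intro always_eventually allI)
          fix y
          have 1: "\<bar>(q (N y) - n * a (N y)) / N y * (y \<bullet> b)\<bar> \<le> \<bar>q (N y) - n * a (N y)\<bar> * (d * norm b)"
          proof (cases "y = 0")
            case False
            have "\<bar>y \<bullet> b\<bar> \<le> (d * N y) * norm b"
              using Cauchy_Schwarz_ineq2[of y b] mult_right_mono[OF d(2)[of y], of "norm b"] by simp
            then have "\<bar>q (N y) - n * a (N y)\<bar> / N y * \<bar>y \<bullet> b\<bar> \<le> \<bar>q (N y) - n * a (N y)\<bar> / N y * ((d * N y) * norm b)"
              using polar_nonneg by (intro mult_left_mono) auto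
            then show ?thesis using polar_pos[OF False] by (simp add: abs_mult)
          qed (use d(1) in simp)
          have "norm (g b y - a 0 *\<^sub>R b) = norm ((a (N y) - a 0) *\<^sub>R b + ((q (N y) - n * a (N y)) / N y * (y \<bullet> b)) *\<^sub>R gradN y)"
            by (simp add: g algebra_simps)
          also have "\<dots> \<le> \<bar>a (N y) - a 0\<bar> * norm b + \<bar>(q (N y) - n * a (N y)) / N y * (y \<bullet> b)\<bar> * norm (gradN y)"
            by (rule order_trans[OF norm_triangle_ineq]) (simp only: norm_scaleR order_refl)
          also have "\<dots> \<le> \<bar>a (N y) - a 0\<bar> * norm b + (\<bar>q (N y) - n * a (N y)\<bar> * (d * norm b)) * K"
            using 1 K d(1) by (intro add_left_mono mult_mono) auto
          finally show "norm (g b y - a 0 *\<^sub>R b) \<le> \<bar>a (N y) - a 0\<bar> * norm b + \<bar>q (N y) - n * a (N y)\<bar> * (d * norm b) * K" .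
        qed
        then have "(g b \<longlongrightarrow> a 0 *\<^sub>R b) (at 0)" by (simp only: LIM_zero_iff)
        moreover have "g b 0 = a 0 *\<^sub>R b" by (simp add: g)
        ultimately show ?thesis using True by (simp only: isCont_def)
      qed
    qed
  qed
  have "(\<Sum>b\<in>Basis. g b x \<bullet> b) = (\<Sum>b\<in>Basis. a (N x) + (q (N x) - n * a (N x)) / N x * ((x \<bullet> b) * (gradN x \<bullet> b)))"
    by (intro sum.cong) (auto simp: g inner_add_left mult_ac)
  also have "\<dots> = n * a (N x) + (q (N x) - n * a (N x)) / N x * (\<Sum>b\<in>Basis. (x \<bullet> b) * (gradN x \<bullet> b))"
    by (simp add: sum.distrib sum_distrib_left n_def)
  also have "(\<Sum>b\<in>Basis. (x \<bullet> b) * (gradN x \<bullet> b)) = N x"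
    by (subst euclidean_inner[symmetric]) (rule trans[OF inner_commute gradN_inner])
  also have "n * a (N x) + (q (N x) - n * a (N x)) / N x * N x = q (N x)"
    using polar_pos[of x] rm(3) n(2) by (cases "x = 0") auto
  finally show "(\<Sum>b\<in>Basis. g b x \<bullet> b) = q (N x)" .
qed

end

section \<open>The Robin inequality\<close>

lemma set_nn_integral_lebesgue_lborel:
  fixes f :: "'a::euclidean_space \<Rightarrow> real"
  assumes "integrable lborel (\<lambda>x. indicator D x * f x)" "\<And>x. 0 \<le> f x"
  shows "set_nn_integral lebesgue D (\<lambda>x. ennreal (f x)) = ennreal (\<integral>x. indicator D x * f x \<partial>lborel)"
proof -
  have m: "(\<lambda>x. ennreal (indicator D x * f x)) \<in> borel_measurable lborel"
    using borel_measurable_integrable[OF assms(1)] by simp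
  have "set_nn_integral lebesgue D (\<lambda>x. ennreal (f x)) = (\<integral>\<^sup>+x. ennreal (indicator D x * f x) \<partial>lebesgue)"
    by (intro nn_integral_cong) (auto split: split_indicator)
  also have "\<dots> = (\<integral>\<^sup>+x. ennreal (indicator D x * f x) \<partial>lborel)" by (rule nn_integral_completion)
  also have "\<dots> = ennreal (\<integral>x. indicator D x * f x \<partial>lborel)"
    by (rule nn_integral_eq_integral[OF assms(1)]) (use assms(2) in auto)
  finally show ?thesis .
qed

lemma set_nn_integral_hausdorff_frontier:
  fixes D :: "'a::euclidean_space set"
  shows "set_nn_integral (hausdorff_measure (real (DIM('a) - 1))) (frontier D) f = (\<integral>\<^sup>+x. f x \<partial>surface_measure D)"
  unfolding surface_measure_def
  by (subst nn_integral_restrict_space) auto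

lemma Young_powr:
  fixes p A b :: real
  assumes p: "1 < p" and "0 \<le> A" "0 \<le> b"
  shows "p * (A * b) \<le> A powr p + (p - 1) * b powr (p / (p - 1))"
proof -
  have "1 / p + 1 / (p / (p - 1)) = 1" using p by (simp add: field_simps)
  then have "A * b \<le> A powr p / p + b powr (p / (p - 1)) / (p / (p - 1))"
    using assms by (intro Youngs_inequality) (auto simp: field_simps)
  then have "p * (A * b) \<le> p * (A powr p / p + b powr (p / (p - 1)) / (p / (p - 1)))"
    using p by (intro mult_left_mono) auto
  also have "\<dots> = A powr p + (p - 1) * b powr (p / (p - 1))" using p by (simp add: field_simps)
  finally show ?thesis .
qed

context finsler
begin

text \<open>The quotient h(r) / r, in a form that makes sense at r = 0.\<close>

definition radial_coeff :: "(real \<Rightarrow> real) \<Rightarrow> real \<Rightarrow> real" where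
  "radial_coeff q r = integral {0..1} (\<lambda>t. t ^ (DIM('a) - 1) * q (t * r))"

lemma radial_coeff_continuous: "continuous_on UNIV q \<Longrightarrow> continuous_on UNIV (radial_coeff q)"
  using radial_mean(1)[where m="DIM('a) - 1" and q=q] by (simp add: radial_coeff_def[abs_def])

lemma radial_coeff_nonneg: "continuous_on UNIV q \<Longrightarrow> (\<And>r. 0 \<le> q r) \<Longrightarrow> 0 \<le> radial_coeff q r"
  unfolding radial_coeff_def
proof (rule integral_nonneg)
  assume q: "continuous_on UNIV q"
  show "(\<lambda>t. t ^ (DIM('a) - 1) * q (t * r)) integrable_on {0..1}"
    by (intro integrable_continuous_real continuous_on_mult continuous_on_power continuous_on_id continuous_on_compose2[OF q])
       (auto intro!: continuous_intros)
qed auto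

text \<open>The gradient form of the divergence theorem is applied to P times each coordinate of the
  radial field; pairing with the matching basis vector and summing gives the form with a
  divergence.\<close>

lemma divergence_radial:
  fixes D :: "'a set"
  assumes D: "open D" "bounded D" "C1_domain D"
    and c: "0 < c" "\<And>e :: 'a. norm e = 1 \<Longrightarrow> swept_measure e = density lborel (\<lambda>_. ennreal c)"
    and q: "continuous_on UNIV q" and P: "C1_fun P dP"
  shows "c * (\<integral>x. indicator D x * (radial_coeff q (N (x - x0)) * (dP x \<bullet> (x - x0)) + P x * q (N (x - x0))) \<partial>lborel)
     = (\<integral>x. P x * (radial_coeff q (N (x - x0)) * ((x - x0) \<bullet> outer_normal D x)) \<partial>surface_measure D)" (is "c * ?L = ?R")
    and "integrable lborel (\<lambda>x. indicator D x * (radial_coeff q (N (x - x0)) * (dP x \<bullet> (x - x0)) + P x * q (N (x - x0))))"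
proof -
  let ?a = "radial_coeff q"
  define g where "g b x = ?a (N x) *\<^sub>R b + ((q (N x) - real DIM('a) * ?a (N x)) / N x * (x \<bullet> b)) *\<^sub>R gradN x" for b x
  have g: "C1_fun (\<lambda>x. ?a (N x) * (x \<bullet> b)) (g b)" "(\<Sum>b\<in>Basis. g b x \<bullet> b) = q (N x)" for b x
    unfolding g_def radial_coeff_def using C1_fun_radial_field[OF q] by auto
  have gs: "C1_fun (\<lambda>x. ?a (N (x - x0)) * ((x - x0) \<bullet> b)) (\<lambda>x. g b (x - x0))" for b
    by (rule C1_fun_shift[OF g(1)])
  define f where "f b x = P x * (?a (N (x - x0)) * ((x - x0) \<bullet> b))" for b x
  define df where "df b x = (?a (N (x - x0)) * ((x - x0) \<bullet> b)) *\<^sub>R dP x + P x *\<^sub>R g b (x - x0)" for b x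
  have f: "C1_fun (f b) (df b)" for b unfolding f_def[abs_def] df_def[abs_def] by (rule C1_fun_mult[OF P gs])
  have int1: "integrable lborel (\<lambda>x. indicator D x *\<^sub>R df b x)" for b
    by (rule integrable_continuous_domain[OF D(1,2) C1_fun_continuous_grad[OF f]])
  have int2: "integrable (surface_measure D) (\<lambda>x. f b x *\<^sub>R outer_normal D x)" for b
    by (rule integrable_continuous_surface[OF D continuous_on_scaleR[OF C1_fun_continuous[OF f] continuous_on_outer_normal[OF D(3)]]])
  have sum1: "(\<Sum>b\<in>Basis. (indicator D x *\<^sub>R df b x) \<bullet> b) = indicator D x * (?a (N (x - x0)) * (dP x \<bullet> (x - x0)) + P x * q (N (x - x0)))" for x
  proof -
    have "(\<Sum>b\<in>Basis. df b x \<bullet> b) = ?a (N (x - x0)) * (\<Sum>b\<in>Basis. ((x - x0) \<bullet> b) * (dP x \<bullet> b)) + P x * (\<Sum>b\<in>Basis. g b (x - x0) \<bullet> b)"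
      by (simp add: df_def inner_add_left sum.distrib sum_distrib_left mult_ac)
    also have "(\<Sum>b\<in>Basis. ((x - x0) \<bullet> b) * (dP x \<bullet> b)) = dP x \<bullet> (x - x0)"
      by (subst euclidean_inner[symmetric]) (simp add: inner_commute)
    finally show ?thesis by (simp add: g(2) flip: sum_distrib_left)
  qed
  have sum2: "(\<Sum>b\<in>Basis. (f b x *\<^sub>R outer_normal D x) \<bullet> b) = P x * (?a (N (x - x0)) * ((x - x0) \<bullet> outer_normal D x))" for x
  proof -
    have "(\<Sum>b\<in>Basis. (f b x *\<^sub>R outer_normal D x) \<bullet> b) = P x * (?a (N (x - x0)) * (\<Sum>b\<in>Basis. ((x - x0) \<bullet> b) * (outer_normal D x \<bullet> b)))"
      by (simp add: f_def sum_distrib_left mult_ac)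
    then show ?thesis by (simp only: euclidean_inner[symmetric])
  qed
  have "integrable lborel (\<lambda>x. \<Sum>b\<in>Basis. (indicator D x *\<^sub>R df b x) \<bullet> b)"
    by (intro Bochner_Integration.integrable_sum integrable_inner_left int1)
  then show "integrable lborel (\<lambda>x. indicator D x * (?a (N (x - x0)) * (dP x \<bullet> (x - x0)) + P x * q (N (x - x0))))"
    unfolding sum1 .
  have "?L = (\<integral>x. (\<Sum>b\<in>Basis. (indicator D x *\<^sub>R df b x) \<bullet> b) \<partial>lborel)" unfolding sum1 ..
  also have "\<dots> = (\<Sum>b\<in>Basis. (\<integral>x. (indicator D x *\<^sub>R df b x) \<bullet> b \<partial>lborel))"
    by (rule Bochner_Integration.integral_sum) (intro integrable_inner_left int1)
  also have "\<dots> = (\<Sum>b\<in>Basis. (\<integral>x. indicator D x *\<^sub>R df b x \<partial>lborel) \<bullet> b)"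
    by (intro sum.cong refl integral_inner_left int1)
  finally have "c * ?L = (\<Sum>b\<in>Basis. (c *\<^sub>R (\<integral>x. indicator D x *\<^sub>R df b x \<partial>lborel)) \<bullet> b)"
    by (simp only: inner_scaleR_left sum_distrib_left)
  also have "\<dots> = (\<Sum>b\<in>Basis. (\<integral>x. f b x *\<^sub>R outer_normal D x \<partial>surface_measure D) \<bullet> b)"
    by (simp only: divergence_theorem[OF D c f])
  also have "\<dots> = (\<Sum>b\<in>Basis. (\<integral>x. (f b x *\<^sub>R outer_normal D x) \<bullet> b \<partial>surface_measure D))"
    by (intro sum.cong refl integral_inner_left[symmetric] int2)
  also have "\<dots> = (\<integral>x. (\<Sum>b\<in>Basis. (f b x *\<^sub>R outer_normal D x) \<bullet> b) \<partial>surface_measure D)"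
    by (rule Bochner_Integration.integral_sum[symmetric]) (intro integrable_inner_left int2)
  also have "\<dots> = ?R" unfolding sum2 ..
  finally show "c * ?L = ?R" .
qed

lemma F_continuous_compose:
  assumes f: "continuous_on S f"
  shows "continuous_on S (\<lambda>x. F (f x) powr p)"
proof -
  have "continuous_on S (\<lambda>x. F (f x))" by (rule continuous_on_compose2[OF F_continuous[of UNIV] f]) simp
  then show ?thesis by (rule continuous_on_powr'[OF _ continuous_on_const]) (use p F_nonneg in auto)
qed

lemma abs_powr_continuous:
  assumes f: "continuous_on S f"
  shows "continuous_on S (\<lambda>x. \<bar>f x :: real\<bar> powr p)"
  by (rule continuous_on_powr'[OF continuous_on_rabs[OF f] continuous_on_const]) (use p in auto)

lemma F_outer_normal_continuous: "C1_domain D \<Longrightarrow> continuous_on (frontier D) (\<lambda>x. F (outer_normal D x))"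
  by (rule continuous_on_compose2[OF F_continuous[of UNIV] continuous_on_outer_normal]) simp_all

section \<open>The Robin functional of a C1 function\<close>

context
  fixes D :: "'a set" and u :: "'a \<Rightarrow> real" and du :: "'a \<Rightarrow> 'a"
  assumes D: "open D" "bounded D" "C1_domain D" and u: "C1_fun u du"
begin

lemma robin_integrable:
  shows "integrable lborel (\<lambda>x. indicator D x * \<bar>u x\<bar> powr p)"
    and "integrable lborel (\<lambda>x. indicator D x * F (du x) powr p)"
    and "integrable (surface_measure D) (\<lambda>x. \<bar>u x\<bar> powr p * F (outer_normal D x))"
proof -
  show "integrable lborel (\<lambda>x. indicator D x * \<bar>u x\<bar> powr p)"
    using integrable_continuous_domain[OF D(1,2) abs_powr_continuous[OF C1_fun_continuous[OF u]]] by simp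
  show "integrable lborel (\<lambda>x. indicator D x * F (du x) powr p)"
    using integrable_continuous_domain[OF D(1,2) F_continuous_compose[OF C1_fun_continuous_grad[OF u]]] by simp
  show "integrable (surface_measure D) (\<lambda>x. \<bar>u x\<bar> powr p * F (outer_normal D x))"
    by (rule integrable_continuous_surface[OF D continuous_on_mult[OF abs_powr_continuous[OF C1_fun_continuous[OF u]] F_outer_normal_continuous[OF D(3)]]])
qed

definition "mass = (\<integral>x. indicator D x * \<bar>u x\<bar> powr p \<partial>lborel)"
definition "energy = (\<integral>x. indicator D x * F (du x) powr p \<partial>lborel)"
definition "bdry = (\<integral>x. \<bar>u x\<bar> powr p * F (outer_normal D x) \<partial>surface_measure D)"

lemma mass_nonneg: "0 \<le> mass" and energy_nonneg: "0 \<le> energy" and bdry_nonneg: "0 \<le> bdry"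
  unfolding mass_def energy_def bdry_def
  by (auto intro!: Bochner_Integration.integral_nonneg mult_nonneg_nonneg F_nonneg)

lemma robin_nn_integrals:
  shows "set_nn_integral lebesgue D (\<lambda>x. ennreal (\<bar>u x\<bar> powr p)) = ennreal mass"
    and "set_nn_integral lebesgue D (\<lambda>x. ennreal (F (du x) powr p)) = ennreal energy"
    and "set_nn_integral (hausdorff_measure (real (DIM('a) - 1))) (frontier D) (\<lambda>x. ennreal (\<bar>u x\<bar> powr p * F (outer_normal D x))) = ennreal bdry"
proof -
  show "set_nn_integral lebesgue D (\<lambda>x. ennreal (\<bar>u x\<bar> powr p)) = ennreal mass"
    unfolding mass_def by (rule set_nn_integral_lebesgue_lborel[OF robin_integrable(1)]) simp
  show "set_nn_integral lebesgue D (\<lambda>x. ennreal (F (du x) powr p)) = ennreal energy"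
    unfolding energy_def by (rule set_nn_integral_lebesgue_lborel[OF robin_integrable(2)]) simp
  show "set_nn_integral (hausdorff_measure (real (DIM('a) - 1))) (frontier D) (\<lambda>x. ennreal (\<bar>u x\<bar> powr p * F (outer_normal D x))) = ennreal bdry"
    unfolding bdry_def set_nn_integral_hausdorff_frontier
    by (rule nn_integral_eq_integral[OF robin_integrable(3)]) (intro AE_I2 mult_nonneg_nonneg F_nonneg powr_ge_zero)
qed

text \<open>The flux identity is weighted with \<bar>u\<bar>^p. Young's inequality bounds the
  gradient term by F(du)^p and a power of h, and the equation for q cancels that power exactly,
  leaving l \<bar>u\<bar>^p. On the boundary, duality and the bound B on h are used. The second
  conclusion is the same computation with both pointwise estimates sharp.\<close>

lemma robin_flux:
  fixes c l B :: real
  assumes c: "0 < c" "\<And>e :: 'a. norm e = 1 \<Longrightarrow> swept_measure e = density lborel (\<lambda>_. ennreal c)"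
    and q: "continuous_on UNIV q" and q0: "\<And>r. 0 \<le> q r"
    and DR: "\<And>x. x \<in> closure D \<Longrightarrow> N (x - x0) \<in> {0..R}"
    and B: "\<And>r. r \<in> {0..R} \<Longrightarrow> r * radial_coeff q r \<le> B"
    and ode: "\<And>r. r \<in> {0..R} \<Longrightarrow> q r = l + (p - 1) * (r * radial_coeff q r) powr (p / (p - 1))"
  shows robin_flux_le: "c * (l * mass - energy) \<le> B * bdry"
    and robin_flux_eq: "(\<And>x. x \<in> D \<Longrightarrow> radial_coeff q (N (x - x0)) * (((p * \<bar>u x\<bar> powr (p - 1) * sgn (u x)) *\<^sub>R du x) \<bullet> (x - x0)) + \<bar>u x\<bar> powr p * q (N (x - x0)) = l * \<bar>u x\<bar> powr p - F (du x) powr p) \<Longrightarrow>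
      (\<And>x. x \<in> frontier D \<Longrightarrow> radial_coeff q (N (x - x0)) * ((x - x0) \<bullet> outer_normal D x) = B * F (outer_normal D x)) \<Longrightarrow>
      c * (l * mass - energy) = B * bdry"
proof -
  let ?a = "\<lambda>x. radial_coeff q (N (x - x0))"
  define P where "P x = \<bar>u x\<bar> powr p" for x
  define dP where "dP x = (p * \<bar>u x\<bar> powr (p - 1) * sgn (u x)) *\<^sub>R du x" for x
  have P: "C1_fun P dP" unfolding P_def[abs_def] dP_def[abs_def] by (rule C1_fun_abs_powr[OF u p])
  note dr = divergence_radial[OF D c q P, of x0]
  have int: "integrable lborel (\<lambda>x. indicator D x * (l * \<bar>u x\<bar> powr p - F (du x) powr p))"
    using Bochner_Integration.integrable_diff[OF integrable_mult_right[OF robin_integrable(1), of l] robin_integrable(2)]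
    by (simp add: algebra_simps)
  have lhs: "(\<integral>x. indicator D x * (l * \<bar>u x\<bar> powr p - F (du x) powr p) \<partial>lborel) = l * mass - energy"
    using Bochner_Integration.integral_diff[OF integrable_mult_right[OF robin_integrable(1), of l] robin_integrable(2)]
    by (simp add: mass_def energy_def algebra_simps)
  have a0: "0 \<le> radial_coeff q r" for r by (rule radial_coeff_nonneg[OF q q0])
  have pw: "l * \<bar>u x\<bar> powr p - F (du x) powr p \<le> ?a x * (dP x \<bullet> (x - x0)) + P x * q (N (x - x0))" if x: "x \<in> D" for x
  proof -
    have Nx: "N (x - x0) \<in> {0..R}" using DR closure_subset x by blast
    define h where "h = N (x - x0) * ?a x"
    have h0: "0 \<le> h" unfolding h_def by (intro mult_nonneg_nonneg polar_nonneg a0)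
    \<comment> \<open>The second factor in Young's inequality, chosen so that its conjugate power is
      \<bar>u\<bar>^p times the power of h occurring in the equation for q.\<close>
    define b where "b = \<bar>u x\<bar> powr (p - 1) * h"
    have b0: "0 \<le> b" using h0 by (simp add: b_def)
    have bp: "b powr (p / (p - 1)) = \<bar>u x\<bar> powr p * h powr (p / (p - 1))"
      using p h0 by (simp add: b_def powr_mult powr_powr)
    have "\<bar>?a x * (dP x \<bullet> (x - x0))\<bar> \<le> p * (F (du x) * b)"
    proof -
      have "\<bar>dP x \<bullet> (x - x0)\<bar> = p * \<bar>u x\<bar> powr (p - 1) * \<bar>sgn (u x)\<bar> * \<bar>du x \<bullet> (x - x0)\<bar>"
        using p by (simp add: dP_def abs_mult)
      also have "\<dots> \<le> p * \<bar>u x\<bar> powr (p - 1) * 1 * (F (du x) * N (x - x0))"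
        using p by (intro mult_mono abs_inner_le_polar mult_nonneg_nonneg) (auto simp: abs_sgn_eq)
      finally have "?a x * \<bar>dP x \<bullet> (x - x0)\<bar> \<le> ?a x * (p * \<bar>u x\<bar> powr (p - 1) * 1 * (F (du x) * N (x - x0)))"
        using a0 by (intro mult_left_mono) auto
      then show ?thesis using a0[of "N (x - x0)"] by (simp add: abs_mult b_def h_def mult_ac)
    qed
    also have "\<dots> \<le> F (du x) powr p + (p - 1) * b powr (p / (p - 1))"
      by (rule Young_powr[OF p F_nonneg b0])
    finally have "- (F (du x) powr p + (p - 1) * (\<bar>u x\<bar> powr p * h powr (p / (p - 1)))) \<le> ?a x * (dP x \<bullet> (x - x0))"
      unfolding bp by linarith
    moreover have "P x * q (N (x - x0)) = l * \<bar>u x\<bar> powr p + (p - 1) * (\<bar>u x\<bar> powr p * h powr (p / (p - 1)))"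
      unfolding ode[OF Nx] P_def h_def by (simp add: algebra_simps)
    ultimately show ?thesis by linarith
  qed
  have int2: "integrable (surface_measure D) (\<lambda>x. P x * (?a x * ((x - x0) \<bullet> outer_normal D x)))"
  proof (rule integrable_continuous_surface[OF D])
    have "continuous_on (frontier D) ?a"
      by (intro continuous_on_compose2[OF radial_coeff_continuous[OF q]] continuous_on_compose2[OF polar_continuous[of UNIV]] continuous_intros) auto
    then show "continuous_on (frontier D) (\<lambda>x. P x * (?a x * ((x - x0) \<bullet> outer_normal D x)))"
      by (intro continuous_intros C1_fun_continuous[OF P] continuous_on_outer_normal D)
  qed
  have bd: "P x * (?a x * ((x - x0) \<bullet> outer_normal D x)) \<le> B * (\<bar>u x\<bar> powr p * F (outer_normal D x))" if x: "x \<in> frontier D" for x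
  proof -
    have Nx: "N (x - x0) \<in> {0..R}" using DR x by (auto simp: frontier_def)
    have "?a x * ((x - x0) \<bullet> outer_normal D x) \<le> ?a x * (F (outer_normal D x) * N (x - x0))"
      using inner_le_polar[of "outer_normal D x" "x - x0"] by (intro mult_left_mono a0) (simp add: inner_commute)
    also have "\<dots> = (N (x - x0) * ?a x) * F (outer_normal D x)" by simp
    also have "\<dots> \<le> B * F (outer_normal D x)" by (intro mult_right_mono B Nx F_nonneg)
    finally have "P x * (?a x * ((x - x0) \<bullet> outer_normal D x)) \<le> P x * (B * F (outer_normal D x))"
      by (intro mult_left_mono) (auto simp: P_def)
    then show ?thesis by (simp add: P_def mult_ac)
  qed
  have "c * (l * mass - energy) \<le> c * (\<integral>x. indicator D x * (?a x * (dP x \<bullet> (x - x0)) + P x * q (N (x - x0))) \<partial>lborel)"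
  proof -
    have "indicator D x * (l * \<bar>u x\<bar> powr p - F (du x) powr p) \<le> indicator D x * (?a x * (dP x \<bullet> (x - x0)) + P x * q (N (x - x0)))" for x
      using pw[of x] by (cases "x \<in> D") auto
    from Bochner_Integration.integral_mono[OF int dr(2) this] show ?thesis
      unfolding lhs[symmetric] using c(1) by (intro mult_left_mono) auto
  qed
  also have "\<dots> = (\<integral>x. P x * (?a x * ((x - x0) \<bullet> outer_normal D x)) \<partial>surface_measure D)" by (rule dr(1))
  also have "\<dots> \<le> (\<integral>x. B * (\<bar>u x\<bar> powr p * F (outer_normal D x)) \<partial>surface_measure D)"
    by (intro Bochner_Integration.integral_mono[OF int2 integrable_mult_right[OF robin_integrable(3)]]) (auto intro: bd)
  also have "\<dots> = B * bdry" by (simp add: bdry_def)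
  finally show "c * (l * mass - energy) \<le> B * bdry" .
  {
    assume e1: "\<And>x. x \<in> D \<Longrightarrow> ?a x * (((p * \<bar>u x\<bar> powr (p - 1) * sgn (u x)) *\<^sub>R du x) \<bullet> (x - x0)) + \<bar>u x\<bar> powr p * q (N (x - x0)) = l * \<bar>u x\<bar> powr p - F (du x) powr p"
      and e2: "\<And>x. x \<in> frontier D \<Longrightarrow> ?a x * ((x - x0) \<bullet> outer_normal D x) = B * F (outer_normal D x)"
    have "(\<lambda>x. indicator D x * (l * \<bar>u x\<bar> powr p - F (du x) powr p)) = (\<lambda>x. indicator D x * (?a x * (dP x \<bullet> (x - x0)) + P x * q (N (x - x0))))"
      using e1 by (auto simp: P_def dP_def split: split_indicator)
    then have "c * (l * mass - energy) = c * (\<integral>x. indicator D x * (?a x * (dP x \<bullet> (x - x0)) + P x * q (N (x - x0))) \<partial>lborel)"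
      unfolding lhs[symmetric] by (simp only:)
    also have "\<dots> = (\<integral>x. P x * (?a x * ((x - x0) \<bullet> outer_normal D x)) \<partial>surface_measure D)" by (rule dr(1))
    also have "\<dots> = (\<integral>x. B * (\<bar>u x\<bar> powr p * F (outer_normal D x)) \<partial>surface_measure D)"
      by (intro Bochner_Integration.integral_cong refl) (simp add: e2 P_def)
    also have "\<dots> = B * bdry" by (simp add: bdry_def)
    finally show "c * (l * mass - energy) = B * bdry" .
  }
qed

end

end

section \<open>From C1 functions to Sobolev functions\<close>

context finsler
begin

lemma F_powr_perturb:
  assumes "0 < \<tau>" "\<And>\<xi>. F \<xi> \<le> b * norm \<xi>" "0 < b"
  shows "F \<eta> powr p \<le> (1 + \<tau>) powr p * F \<xi> powr p + ((1 + 1 / \<tau>) powr p * b powr p) * norm (\<eta> - \<xi>) powr p"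
proof -
  have "F \<eta> \<le> F \<xi> + F (\<eta> - \<xi>)" using F_triangle[of \<xi> "\<eta> - \<xi>"] by simp
  also have "\<dots> \<le> F \<xi> + b * norm (\<eta> - \<xi>)" using assms(2) by simp
  finally have "F \<eta> powr p \<le> (F \<xi> + b * norm (\<eta> - \<xi>)) powr p" using F_nonneg p by (intro powr_mono2) auto
  also have "\<dots> \<le> (1 + \<tau>) powr p * F \<xi> powr p + (1 + 1 / \<tau>) powr p * (b * norm (\<eta> - \<xi>)) powr p"
    using assms F_nonneg p by (intro add_powr_le) auto
  finally show ?thesis using assms(3) by (simp add: powr_mult mult.assoc)
qed

text \<open>The C1 inequality is used for the approximants from the definition of the trace. For
  fixed \<tau> the approximation errors carry finite constants and vanish as k grows; only
  afterwards \<tau> tends to 0. This order avoids subtraction of extended reals.\<close>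

lemma robin_lower_bound_extend:
  fixes D :: "'a set" and l \<beta> :: real
  assumes D: "open D" "bounded D" "C1_domain D" and l: "0 \<le> l" and \<beta>: "0 \<le> \<beta>"
    and C1: "\<And>u du. C1_fun u du \<Longrightarrow>
      ennreal l * set_nn_integral lebesgue D (\<lambda>x. ennreal (\<bar>u x\<bar> powr p))
        \<le> set_nn_integral lebesgue D (\<lambda>x. ennreal (F (du x) powr p))
          + ennreal \<beta> * set_nn_integral (hausdorff_measure (real (DIM('a) - 1))) (frontier D) (\<lambda>x. ennreal (\<bar>u x\<bar> powr p * F (outer_normal D x)))"
    and v: "sobolev_W1p p D v G" "sobolev_trace p D v G w"
  shows "ennreal l * set_nn_integral lebesgue D (\<lambda>x. ennreal (\<bar>v x\<bar> powr p))
        \<le> set_nn_integral lebesgue D (\<lambda>x. ennreal (F (G x) powr p))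
          + ennreal \<beta> * set_nn_integral (hausdorff_measure (real (DIM('a) - 1))) (frontier D) (\<lambda>x. ennreal (\<bar>w x\<bar> powr p * F (outer_normal D x)))"
proof -
  let ?L = "lebesgue_on D" and ?\<sigma> = "surface_measure D"
  have Dm: "D \<in> sets lebesgue" using D(1) by simp
  have convL: "set_nn_integral lebesgue D f = (\<integral>\<^sup>+x. f x \<partial>?L)" for f
    using Dm by (subst nn_integral_restrict_space) auto
  obtain b where b: "0 < b" "\<And>\<xi>. F \<xi> \<le> b * norm \<xi>"
    using F_bounds by (meson less_le_trans)
  have vm[measurable]: "v \<in> borel_measurable ?L" and Gm[measurable]: "G \<in> borel_measurable ?L"
    using v(1) by (auto simp: sobolev_W1p_def)
  obtain u du where wm: "w \<in> borel_measurable borel"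
    and u': "\<forall>k x. (u k has_derivative (\<lambda>h. du k x \<bullet> h)) (at x)" "\<forall>k. continuous_on UNIV (du k)"
    and lim1: "(\<lambda>k. set_nn_integral lebesgue D (\<lambda>x. ennreal (\<bar>u k x - v x\<bar> powr p))) \<longlonglongrightarrow> 0"
    and lim2: "(\<lambda>k. set_nn_integral lebesgue D (\<lambda>x. ennreal (norm (du k x - G x) powr p))) \<longlonglongrightarrow> 0"
    and lim3: "(\<lambda>k. set_nn_integral (hausdorff_measure (real (DIM('a) - 1))) (frontier D) (\<lambda>x. ennreal (\<bar>u k x - w x\<bar> powr p))) \<longlonglongrightarrow> 0"
    using v(2) unfolding sobolev_trace_def by (elim conjE exE) (rule that)
  have u: "C1_fun (u k) (du k)" for k using u' by (simp add: C1_fun_def)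
  have bL: "f \<in> borel_measurable borel \<Longrightarrow> f \<in> borel_measurable ?L" for f :: "'a \<Rightarrow> 'c::topological_space"
    by (intro measurable_restrict_space1 measurable_completion) simp
  have um[measurable]: "u k \<in> borel_measurable ?L" "du k \<in> borel_measurable ?L" for k
    using u by (auto intro!: bL C1_fun_measurable C1_fun_measurable_grad)
  have um'[measurable]: "u k \<in> borel_measurable ?\<sigma>" "w \<in> borel_measurable ?\<sigma>" for k
    using u wm by (auto intro!: borel_measurable_surface_measure C1_fun_measurable)
  have num[measurable]: "(\<lambda>x. F (outer_normal D x)) \<in> borel_measurable ?\<sigma>"
    by (intro continuous_on_borel_measurable_surface_measure F_outer_normal_continuous D)
  define I where "I = (\<integral>\<^sup>+x. ennreal (\<bar>v x\<bar> powr p) \<partial>?L)"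
  define E where "E = (\<integral>\<^sup>+x. ennreal (F (G x) powr p) \<partial>?L)"
  define T where "T = (\<integral>\<^sup>+x. ennreal (\<bar>w x\<bar> powr p * F (outer_normal D x)) \<partial>?\<sigma>)"
  define e1 where "e1 k = (\<integral>\<^sup>+x. ennreal (\<bar>u k x - v x\<bar> powr p) \<partial>?L)" for k
  define e2 where "e2 k = (\<integral>\<^sup>+x. ennreal (norm (du k x - G x) powr p) \<partial>?L)" for k
  define e3 where "e3 k = (\<integral>\<^sup>+x. ennreal (\<bar>u k x - w x\<bar> powr p) \<partial>?\<sigma>)" for k
  have lims: "e1 \<longlonglongrightarrow> 0" "e2 \<longlonglongrightarrow> 0" "e3 \<longlonglongrightarrow> 0"
    using lim1 lim2 lim3 unfolding e1_def[abs_def] e2_def[abs_def] e3_def[abs_def] convL set_nn_integral_hausdorff_frontier .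
  \<comment> \<open>One factor (1 + \<tau>)^p arises from replacing v by an approximant in the mass,
    the other from replacing the approximant by G and w in the energy and the boundary term.\<close>
  have main: "ennreal l * I \<le> ennreal ((1 + \<tau>) powr p) * (ennreal ((1 + \<tau>) powr p) * (E + ennreal \<beta> * T))" if \<tau>: "0 < \<tau>" for \<tau>
  proof -
    define \<kappa> where "\<kappa> = (1 + \<tau>) powr p"
    define C where "C = (1 + 1 / \<tau>) powr p"
    have k0: "0 \<le> \<kappa>" "0 \<le> C" by (simp_all add: \<kappa>_def C_def)
    have abs_perturb: "\<bar>s\<bar> powr p \<le> \<kappa> * \<bar>t\<bar> powr p + C * \<bar>t - s\<bar> powr p" for s t :: real
    proof -
      have "\<bar>s\<bar> powr p \<le> (\<bar>t\<bar> + \<bar>t - s\<bar>) powr p" using p by (intro powr_mono2) auto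
      also have "\<dots> \<le> \<kappa> * \<bar>t\<bar> powr p + C * \<bar>t - s\<bar> powr p"
        unfolding \<kappa>_def C_def using \<tau> p by (intro add_powr_le) auto
      finally show ?thesis .
    qed
    have 1: "I \<le> ennreal \<kappa> * (\<integral>\<^sup>+x. ennreal (\<bar>u k x\<bar> powr p) \<partial>?L) + ennreal C * e1 k" for k
    proof -
      have "I \<le> (\<integral>\<^sup>+x. ennreal \<kappa> * ennreal (\<bar>u k x\<bar> powr p) + ennreal C * ennreal (\<bar>u k x - v x\<bar> powr p) \<partial>?L)"
        unfolding I_def using k0 abs_perturb by (intro nn_integral_mono) (simp add: ennreal_mult[symmetric] ennreal_plus[symmetric] del: ennreal_plus)
      also have "\<dots> = ennreal \<kappa> * (\<integral>\<^sup>+x. ennreal (\<bar>u k x\<bar> powr p) \<partial>?L) + ennreal C * e1 k"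
        unfolding e1_def by (subst nn_integral_add) (auto simp: nn_integral_cmult)
      finally show ?thesis .
    qed
    have 2: "(\<integral>\<^sup>+x. ennreal (F (du k x) powr p) \<partial>?L) \<le> ennreal \<kappa> * E + ennreal (C * b powr p) * e2 k" for k
    proof -
      have "(\<integral>\<^sup>+x. ennreal (F (du k x) powr p) \<partial>?L) \<le> (\<integral>\<^sup>+x. ennreal \<kappa> * ennreal (F (G x) powr p) + ennreal (C * b powr p) * ennreal (norm (du k x - G x) powr p) \<partial>?L)"
        using k0 F_powr_perturb[OF \<tau> b(2,1)] unfolding \<kappa>_def[symmetric] C_def[symmetric]
        by (intro nn_integral_mono) (simp add: ennreal_mult[symmetric] ennreal_plus[symmetric] del: ennreal_plus)
      also have "\<dots> = ennreal \<kappa> * E + ennreal (C * b powr p) * e2 k"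
        unfolding e2_def E_def by (subst nn_integral_add) (auto simp: nn_integral_cmult)
      finally show ?thesis .
    qed
    have 3: "(\<integral>\<^sup>+x. ennreal (\<bar>u k x\<bar> powr p * F (outer_normal D x)) \<partial>?\<sigma>) \<le> ennreal \<kappa> * T + ennreal (C * b) * e3 k" for k
    proof -
      have "(\<integral>\<^sup>+x. ennreal (\<bar>u k x\<bar> powr p * F (outer_normal D x)) \<partial>?\<sigma>)
        \<le> (\<integral>\<^sup>+x. ennreal \<kappa> * ennreal (\<bar>w x\<bar> powr p * F (outer_normal D x)) + ennreal (C * b) * ennreal (\<bar>u k x - w x\<bar> powr p) \<partial>?\<sigma>)"
      proof (rule nn_integral_mono)
        fix x assume "x \<in> space ?\<sigma>"
        then have n1: "norm (outer_normal D x) = 1" by (intro norm_outer_normal[OF D(3)]) simp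
        have "\<bar>u k x\<bar> powr p * F (outer_normal D x) \<le> (\<kappa> * \<bar>w x\<bar> powr p + C * \<bar>w x - u k x\<bar> powr p) * F (outer_normal D x)"
          by (intro mult_right_mono abs_perturb F_nonneg)
        also have "\<dots> = \<kappa> * (\<bar>w x\<bar> powr p * F (outer_normal D x)) + C * \<bar>w x - u k x\<bar> powr p * F (outer_normal D x)"
          by (simp add: algebra_simps)
        also have "\<dots> \<le> \<kappa> * (\<bar>w x\<bar> powr p * F (outer_normal D x)) + C * \<bar>w x - u k x\<bar> powr p * b"
          using b(2)[of "outer_normal D x"] n1 k0 by (intro add_left_mono mult_left_mono) auto
        finally have "\<bar>u k x\<bar> powr p * F (outer_normal D x) \<le> \<kappa> * (\<bar>w x\<bar> powr p * F (outer_normal D x)) + (C * b) * \<bar>u k x - w x\<bar> powr p"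
          by (simp add: mult_ac abs_minus_commute)
        then show "ennreal (\<bar>u k x\<bar> powr p * F (outer_normal D x)) \<le> ennreal \<kappa> * ennreal (\<bar>w x\<bar> powr p * F (outer_normal D x)) + ennreal (C * b) * ennreal (\<bar>u k x - w x\<bar> powr p)"
          using k0 b(1) F_nonneg by (simp add: ennreal_mult[symmetric] ennreal_plus[symmetric] del: ennreal_plus)
      qed
      also have "\<dots> = ennreal \<kappa> * T + ennreal (C * b) * e3 k"
        unfolding e3_def T_def by (subst nn_integral_add) (auto simp: nn_integral_cmult)
      finally show ?thesis .
    qed
    have step: "ennreal l * I \<le> ennreal \<kappa> * ((ennreal \<kappa> * E + ennreal (C * b powr p) * e2 k) + ennreal \<beta> * (ennreal \<kappa> * T + ennreal (C * b) * e3 k)) + ennreal l * (ennreal C * e1 k)" for k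
    proof -
      have "ennreal l * I \<le> ennreal l * (ennreal \<kappa> * (\<integral>\<^sup>+x. ennreal (\<bar>u k x\<bar> powr p) \<partial>?L) + ennreal C * e1 k)"
        by (intro mult_left_mono 1) simp
      also have "\<dots> = ennreal \<kappa> * (ennreal l * (\<integral>\<^sup>+x. ennreal (\<bar>u k x\<bar> powr p) \<partial>?L)) + ennreal l * (ennreal C * e1 k)"
        by (simp add: distrib_left mult_ac)
      also have "\<dots> \<le> ennreal \<kappa> * ((\<integral>\<^sup>+x. ennreal (F (du k x) powr p) \<partial>?L) + ennreal \<beta> * (\<integral>\<^sup>+x. ennreal (\<bar>u k x\<bar> powr p * F (outer_normal D x)) \<partial>?\<sigma>)) + ennreal l * (ennreal C * e1 k)"
        using C1[OF u[of k]] unfolding convL set_nn_integral_hausdorff_frontier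
        by (intro add_right_mono mult_left_mono) auto
      also have "\<dots> \<le> ennreal \<kappa> * ((ennreal \<kappa> * E + ennreal (C * b powr p) * e2 k) + ennreal \<beta> * (ennreal \<kappa> * T + ennreal (C * b) * e3 k)) + ennreal l * (ennreal C * e1 k)"
        by (intro add_right_mono mult_left_mono add_mono 2 3) auto
      finally show ?thesis .
    qed
    have zero: "(\<lambda>k. ennreal r * e k) \<longlonglongrightarrow> 0" if "e \<longlonglongrightarrow> 0" for e r
      using ennreal_tendsto_cmult[OF _ that, of "ennreal r"] by simp
    have "(\<lambda>k. ennreal \<kappa> * ((ennreal \<kappa> * E + ennreal (C * b powr p) * e2 k) + ennreal \<beta> * (ennreal \<kappa> * T + ennreal (C * b) * e3 k)) + ennreal l * (ennreal C * e1 k))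
       \<longlonglongrightarrow> ennreal \<kappa> * ((ennreal \<kappa> * E + 0) + ennreal \<beta> * (ennreal \<kappa> * T + 0)) + 0"
      by (intro tendsto_add ennreal_tendsto_cmult tendsto_const zero lims) auto
    then have "ennreal l * I \<le> ennreal \<kappa> * ((ennreal \<kappa> * E + 0) + ennreal \<beta> * (ennreal \<kappa> * T + 0)) + 0"
      by (rule LIMSEQ_le_const) (use step in auto)
    then show ?thesis unfolding \<kappa>_def[symmetric] by (simp add: distrib_left mult_ac)
  qed
  have "((\<lambda>\<tau>::real. (1 + \<tau>) powr p) \<longlongrightarrow> (1 + 0) powr p) (at_right 0)" by (intro tendsto_intros) auto
  then have k1: "((\<lambda>\<tau>. ennreal ((1 + \<tau>) powr p)) \<longlongrightarrow> ennreal 1) (at_right 0)"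
    by (intro tendsto_ennrealI) simp
  have "((\<lambda>\<tau>. ennreal ((1 + \<tau>) powr p) * (ennreal ((1 + \<tau>) powr p) * (E + ennreal \<beta> * T))) \<longlongrightarrow> ennreal 1 * (ennreal 1 * (E + ennreal \<beta> * T))) (at_right 0)"
    by (intro tendsto_mult_ennreal k1 tendsto_const) auto
  then have "((\<lambda>\<tau>. ennreal ((1 + \<tau>) powr p) * (ennreal ((1 + \<tau>) powr p) * (E + ennreal \<beta> * T))) \<longlongrightarrow> E + ennreal \<beta> * T) (at_right 0)"
    by simp
  then have "ennreal l * I \<le> E + ennreal \<beta> * T"
    by (rule tendsto_lowerbound) (auto simp: eventually_at_right_field intro!: exI[of _ 1] main)
  then show ?thesis
    unfolding I_def E_def T_def convL set_nn_integral_hausdorff_frontier .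
qed

text \<open>The exponential of minus a primitive of g. The primitive starts at -1 so that two-sided
  differentiability holds at r = 0; nothing is claimed about derivatives at negative r, hence the
  \<open>max\<close> in the continuity statement.\<close>

lemma radial_profile_exp:
  fixes g :: "real \<Rightarrow> real"
  assumes g: "continuous_on UNIV g"
  obtains \<rho> where "\<And>r. 0 \<le> r \<Longrightarrow> (\<rho> has_real_derivative - \<rho> r * g r) (at r)" "\<And>r. 0 < \<rho> r" "continuous_on UNIV (\<lambda>r. \<rho> (max 0 r))"
proof -
  define J where "J r = integral {-1..r} g" for r
  have dJ: "(J has_real_derivative g r) (at r)" if "0 \<le> r" for r
  proof -
    have "(J has_real_derivative g r) (at r within {-1..r+1})"
      unfolding J_def by (rule integral_has_real_derivative) (use that continuous_on_subset[OF g] in auto)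
    then show ?thesis using that by (subst (asm) at_within_Icc_at) auto
  qed
  have d: "((\<lambda>r. exp (- J r)) has_real_derivative - exp (- J r) * g r) (at r)" if "0 \<le> r" for r
    using dJ[OF that] by (auto intro!: derivative_eq_intros)
  have "continuous_on {0..} (\<lambda>r. exp (- J r))"
    using d by (intro continuous_at_imp_continuous_on ballI DERIV_isCont) auto
  then have "continuous_on UNIV (\<lambda>r. exp (- J (max 0 r)))"
    by (rule continuous_on_compose2) (auto intro!: continuous_intros)
  then show ?thesis using d that[of "\<lambda>r. exp (- J r)"] by simp
qed

end

section \<open>The two bounds for the eigenvalues\<close>

context finsler
begin

lemma wulff_shape_not_null:
  assumes "0 < R"
  shows "\<not> (AE x in lebesgue_on (wulff_shape F x0 R). False)"
proof
  let ?W = "wulff_shape F x0 R"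
  assume "AE x in lebesgue_on ?W. False"
  moreover have Wm: "?W \<in> sets lebesgue" using open_wulff_shape[OF assms] by simp
  ultimately have "AE x in lebesgue. x \<notin> ?W" by (subst (asm) AE_restrict_space_iff) auto
  then have "?W \<in> null_sets lebesgue" using Wm by (simp add: AE_iff_null_sets)
  then have "negligible ?W" by (simp add: negligible_iff_null_sets)
  moreover have "x0 \<in> ?W" using assms by (simp add: wulff_shape_def)
  ultimately show False using open_not_negligible[OF open_wulff_shape[OF assms]] by blast
qed

text \<open>The weak gradient identity is the divergence theorem for V \<phi>, whose boundary term
  vanishes because the support of \<phi> lies in D. The trace is witnessed by a constant
  sequence.\<close>

lemma C1_fun_sobolev:
  fixes D :: "'a set"
  assumes D: "open D" "bounded D" "C1_domain D" and V: "C1_fun V dV"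
    and c: "0 < c" "\<And>e :: 'a. norm e = 1 \<Longrightarrow> swept_measure e = density lborel (\<lambda>_. ennreal c)"
  shows "sobolev_W1p p D V dV" "sobolev_trace p D V dV V"
proof -
  have bL: "f \<in> borel_measurable borel \<Longrightarrow> f \<in> borel_measurable (lebesgue_on D)" for f :: "'a \<Rightarrow> 'c::topological_space"
    by (intro measurable_restrict_space1 measurable_completion) simp
  have "integrable lborel (\<lambda>x. indicator D x *\<^sub>R (norm (dV x) powr p))"
    using p by (intro integrable_continuous_domain D(1,2) continuous_on_powr' continuous_on_norm
        C1_fun_continuous_grad[OF V] continuous_on_const) auto
  then have fin2: "set_nn_integral lebesgue D (\<lambda>x. ennreal (norm (dV x) powr p)) < \<infinity>"
    by (subst set_nn_integral_lebesgue_lborel) auto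
  have test: "set_lebesgue_integral lebesgue D (\<lambda>x. V x *\<^sub>R d\<phi> x) = - set_lebesgue_integral lebesgue D (\<lambda>x. \<phi> x *\<^sub>R dV x)"
    if t: "C1c_test D \<phi> d\<phi>" for \<phi> d\<phi>
  proof -
    have \<phi>: "C1_fun \<phi> d\<phi>" using t by (simp add: C1c_test_def C1_fun_def)
    have conv: "set_lebesgue_integral lebesgue D f = (\<integral>x. indicator D x *\<^sub>R f x \<partial>lborel)"
      if "integrable lborel (\<lambda>x. indicator D x *\<^sub>R f x)" for f :: "'a \<Rightarrow> 'a"
      unfolding set_lebesgue_integral_def using that by (intro integral_completion) auto
    have i1: "integrable lborel (\<lambda>x. indicator D x *\<^sub>R (V x *\<^sub>R d\<phi> x))"
      by (rule integrable_continuous_domain[OF D(1,2) continuous_on_scaleR[OF C1_fun_continuous[OF V] C1_fun_continuous_grad[OF \<phi>]]])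
    have i2: "integrable lborel (\<lambda>x. indicator D x *\<^sub>R (\<phi> x *\<^sub>R dV x))"
      by (rule integrable_continuous_domain[OF D(1,2) continuous_on_scaleR[OF C1_fun_continuous[OF \<phi>] C1_fun_continuous_grad[OF V]]])
    have zero: "V x * \<phi> x = 0" if x: "x \<in> frontier D" for x
    proof -
      have "x \<notin> D" using x D(1) by (simp add: frontier_def interior_open)
      moreover have "x \<in> D" if "\<phi> x \<noteq> 0" using t that closure_subset[of "{x. \<phi> x \<noteq> 0}"] unfolding C1c_test_def by blast
      ultimately show ?thesis by auto
    qed
    have "c *\<^sub>R (\<integral>x. indicator D x *\<^sub>R (\<phi> x *\<^sub>R dV x + V x *\<^sub>R d\<phi> x) \<partial>lborel) = (\<integral>x. (V x * \<phi> x) *\<^sub>R outer_normal D x \<partial>surface_measure D)"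
      by (rule divergence_theorem[OF D c C1_fun_mult[OF V \<phi>]])
    also have "\<dots> = (\<integral>x. 0 \<partial>surface_measure D)"
      by (intro Bochner_Integration.integral_cong refl) (use zero in auto)
    finally have "(\<integral>x. indicator D x *\<^sub>R (\<phi> x *\<^sub>R dV x) + indicator D x *\<^sub>R (V x *\<^sub>R d\<phi> x) \<partial>lborel) = 0"
      using c(1) by (simp only: scaleR_add_right) simp
    then have "(\<integral>x. indicator D x *\<^sub>R (\<phi> x *\<^sub>R dV x) \<partial>lborel) + (\<integral>x. indicator D x *\<^sub>R (V x *\<^sub>R d\<phi> x) \<partial>lborel) = 0"
      by (simp only: Bochner_Integration.integral_add[OF i2 i1])
    then show ?thesis unfolding conv[OF i1] conv[OF i2] by (simp add: eq_neg_iff_add_eq_0 add.commute)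
  qed
  show "sobolev_W1p p D V dV"
    unfolding sobolev_W1p_def
    using test fin2 robin_nn_integrals(1)[OF D V]
    by (auto intro!: bL C1_fun_measurable[OF V] C1_fun_measurable_grad[OF V])
  show "sobolev_trace p D V dV V"
    unfolding sobolev_trace_def using V
    by (intro conjI exI[of _ "\<lambda>_. V"] exI[of _ "\<lambda>_. dV"]) (auto simp: C1_fun_def C1_fun_measurable[OF V])
qed

text \<open>The trial function V is the radial solution of \<rho>' = - \<rho> h^(1/(p-1)), so that
  (F(dV) / V)^(p-1) = h. For it the Young and duality estimates are equalities, and its Robin
  quotient is exactly l.\<close>

lemma robin_eig_wulff_shape_le:
  fixes x0 :: 'a and c l \<beta> R :: real
  assumes R: "0 < R" and \<beta>: "0 < \<beta>"
    and c: "0 < c" "\<And>e :: 'a. norm e = 1 \<Longrightarrow> swept_measure e = density lborel (\<lambda>_. ennreal c)"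
    and q: "continuous_on UNIV q" and q0: "\<And>r. 0 \<le> q r"
    and B: "\<And>r. r \<in> {0..R} \<Longrightarrow> r * radial_coeff q r \<le> c * \<beta>" and BR: "R * radial_coeff q R = c * \<beta>"
    and ode: "\<And>r. r \<in> {0..R} \<Longrightarrow> q r = l + (p - 1) * (r * radial_coeff q r) powr (p / (p - 1))"
  shows "robin_eig F p \<beta> (wulff_shape F x0 R) \<le> ennreal l"
proof -
  let ?W = "wulff_shape F x0 R"
  note W = open_wulff_shape[OF R, of x0] bounded_wulff_shape[OF R, of x0] C1_domain_wulff_shape[OF R, of x0]
  \<comment> \<open>This is h^(1/(p-1)), cut off below so as to be continuous on the whole line. It
    vanishes at r = 0, which is what makes the trial function C1 at the centre.\<close>
  define g where "g r = (max 0 (r * radial_coeff q r)) powr (1 / (p - 1))" for r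
  have gc: "continuous_on UNIV g"
    unfolding g_def using p
    by (intro continuous_on_powr' continuous_on_max continuous_on_mult continuous_on_const continuous_on_id radial_coeff_continuous[OF q]) auto
  obtain \<rho> where \<rho>: "\<And>r. 0 \<le> r \<Longrightarrow> (\<rho> has_real_derivative - \<rho> r * g r) (at r)" "\<And>r. 0 < \<rho> r" "continuous_on UNIV (\<lambda>r. \<rho> (max 0 r))"
    using radial_profile_exp[OF gc] by blast
  have "C1_fun (\<lambda>x. \<rho> (N x)) (\<lambda>x. (- \<rho> (max 0 (N x)) * g (N x)) *\<^sub>R gradN x)"
  proof (rule C1_fun_radial)
    show "(\<rho> has_real_derivative - \<rho> (max 0 r) * g r) (at r)" if "0 \<le> r" for r using \<rho>(1)[OF that] that by simp
    show "continuous_on UNIV (\<lambda>r. - \<rho> (max 0 r) * g r)" by (intro continuous_intros \<rho>(3) gc)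
  qed (simp add: g_def)
  then have V0: "C1_fun (\<lambda>x. \<rho> (N x)) (\<lambda>x. (- \<rho> (N x) * g (N x)) *\<^sub>R gradN x)" by (simp add: polar_nonneg max_absorb2)
  define V where "V x = \<rho> (N (x - x0))" for x
  define dV where "dV x = (- \<rho> (N (x - x0)) * g (N (x - x0))) *\<^sub>R gradN (x - x0)" for x
  have V: "C1_fun V dV" unfolding V_def[abs_def] dV_def[abs_def] by (rule C1_fun_shift[OF V0])
  have Vpos: "0 < V x" for x by (simp add: V_def \<rho>(2))
  have DR: "N (x - x0) \<in> {0..R}" if "x \<in> closure ?W" for x
    using closure_wulff_shape_le[OF R that] polar_nonneg by simp
  \<comment> \<open>Equality in Young's inequality, as F(dV) = V h^(1/(p-1)): the gradient term is
    -p V^p h^(p/(p-1)), and p - 1 of these p units are compensated by the power term in q.\<close>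
  have e1: "radial_coeff q (N (x - x0)) * (((p * \<bar>V x\<bar> powr (p - 1) * sgn (V x)) *\<^sub>R dV x) \<bullet> (x - x0)) + \<bar>V x\<bar> powr p * q (N (x - x0)) = l * \<bar>V x\<bar> powr p - F (dV x) powr p"
    if x: "x \<in> ?W" for x
  proof -
    define r where "r = N (x - x0)"
    define h where "h = r * radial_coeff q r"
    have r: "r \<in> {0..R}" unfolding r_def using DR x closure_subset by blast
    have h0: "0 \<le> h" unfolding h_def using r radial_coeff_nonneg[OF q q0] by (intro mult_nonneg_nonneg) auto
    have gh: "g r = h powr (1 / (p - 1))" using h0 by (simp add: g_def h_def max_absorb2)
    have "1 / (p - 1) + 1 = p / (p - 1)" using p by (simp add: field_simps)
    then have ghh: "g r * h = h powr (p / (p - 1))"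
      unfolding gh using h0 powr_add[of h "1 / (p - 1)" 1] by (cases "h = 0") auto
    have Vp: "V x powr (p - 1) * V x = V x powr p" using Vpos[of x] powr_add[of "V x" "p - 1" 1] by simp
    have "dV x \<bullet> (x - x0) = - (V x * g r) * r" by (simp add: dV_def V_def r_def gradN_inner)
    then have "radial_coeff q r * (((p * \<bar>V x\<bar> powr (p - 1) * sgn (V x)) *\<^sub>R dV x) \<bullet> (x - x0)) = - (p * (V x powr (p - 1) * V x) * (g r * h))"
      using Vpos[of x] by (simp add: h_def mult_ac)
    also have "\<dots> = - (p * V x powr p * h powr (p / (p - 1)))" by (simp only: Vp ghh)
    finally have 1: "radial_coeff q r * (((p * \<bar>V x\<bar> powr (p - 1) * sgn (V x)) *\<^sub>R dV x) \<bullet> (x - x0)) = - (p * V x powr p * h powr (p / (p - 1)))" .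
    have 2: "q r = l + (p - 1) * h powr (p / (p - 1))" unfolding h_def by (rule ode[OF r])
    have "F (dV x) = V x * g r"
      using Vpos[of x] by (simp add: dV_def V_def r_def F_minus F_scale F_gradN abs_mult g_def)
    then have 3: "F (dV x) powr p = V x powr p * h powr (p / (p - 1))"
      using Vpos[of x] h0 p by (simp add: gh powr_mult powr_powr)
    have "- (p * V x powr p * h powr (p / (p - 1))) + V x powr p * (l + (p - 1) * h powr (p / (p - 1))) = l * V x powr p - V x powr p * h powr (p / (p - 1))"
      by (simp add: algebra_simps)
    moreover have "\<bar>V x\<bar> = V x" using Vpos[of x] by simp
    ultimately show ?thesis unfolding r_def[symmetric] 1 2 3 by (simp only:)
  qed
  \<comment> \<open>Boundary equality: N equals R on the frontier, the end value of h is
    \<open>c * \<beta>\<close>, and the normal attains the duality bound.\<close>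
  have e2: "radial_coeff q (N (x - x0)) * ((x - x0) \<bullet> outer_normal ?W x) = c * \<beta> * F (outer_normal ?W x)" if x: "x \<in> frontier ?W" for x
    unfolding frontier_wulff_shape[OF R x] inner_outer_normal_wulff_shape[OF R x] BR[symmetric] by simp
  have "c * (l * mass ?W V - energy ?W dV) = c * \<beta> * bdry ?W V"
    by (rule robin_flux_eq[OF W V c q q0 DR B ode e1 e2])
  then have id: "l * mass ?W V = energy ?W dV + \<beta> * bdry ?W V" using c(1) by (simp add: mult.assoc)
  note nn = robin_nn_integrals[OF W V]
  have nz: "\<not> (AE x in lebesgue_on ?W. V x = 0)"
    using wulff_shape_not_null[OF R, of x0] Vpos by (simp add: less_imp_neq[THEN not_sym])
  have mass: "0 < mass ?W V"
  proof (rule ccontr)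
    assume "\<not> 0 < mass ?W V"
    then have "mass ?W V = 0" using mass_nonneg[OF W V] by simp
    then have "set_nn_integral lebesgue ?W (\<lambda>x. ennreal (\<bar>V x\<bar> powr p)) = 0" by (simp add: nn(1))
    then have "(\<integral>\<^sup>+x. ennreal (\<bar>V x\<bar> powr p) \<partial>lebesgue_on ?W) = 0"
      using W(1) by (subst nn_integral_restrict_space) auto
    moreover have "V \<in> borel_measurable (lebesgue_on ?W)"
      using C1_fun_sobolev(1)[OF W V c] by (simp add: sobolev_W1p_def)
    ultimately have "AE x in lebesgue_on ?W. ennreal (\<bar>V x\<bar> powr p) = 0" by (subst (asm) nn_integral_0_iff_AE) auto
    then show False using nz Vpos p by (auto simp: powr_eq_0_iff elim!: AE_mp)
  qed
  have "robin_eig F p \<beta> ?W \<le> (ennreal (energy ?W dV) + ennreal \<beta> * ennreal (bdry ?W V)) / ennreal (mass ?W V)"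
    unfolding robin_eig_def nn[symmetric]
    by (intro Inf_lower CollectI exI[of _ V] exI[of _ dV] conjI refl C1_fun_sobolev[OF W V c] nz)
  also have "ennreal (energy ?W dV) + ennreal \<beta> * ennreal (bdry ?W V) = ennreal (l * mass ?W V)"
    unfolding id using \<beta> energy_nonneg[OF W V] bdry_nonneg[OF W V] by (simp add: ennreal_mult)
  also have "ennreal (l * mass ?W V) / ennreal (mass ?W V) = ennreal l"
  proof -
    have "0 \<le> l * mass ?W V" unfolding id using \<beta> energy_nonneg[OF W V] bdry_nonneg[OF W V] by simp
    then show ?thesis using mass by (subst divide_ennreal) auto
  qed
  finally show ?thesis .
qed

text \<open>Inclusion in the Wulff shape confines \<open>N (x - x0)\<close> to [0, R] on the closure
  of D. There the equation for the profile and the bound \<open>c * \<beta>\<close> on h are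
  available, and the extension to Sobolev functions does the rest.\<close>

lemma robin_eig_ge:
  fixes D :: "'a set" and x0 :: 'a and c l \<beta> R :: real
  assumes D: "open D" "bounded D" "C1_domain D" "D \<subseteq> wulff_shape F x0 R"
    and R: "0 < R" and \<beta>: "0 < \<beta>" and l: "0 \<le> l"
    and c: "0 < c" "\<And>e :: 'a. norm e = 1 \<Longrightarrow> swept_measure e = density lborel (\<lambda>_. ennreal c)"
    and q: "continuous_on UNIV q" and q0: "\<And>r. 0 \<le> q r"
    and B: "\<And>r. r \<in> {0..R} \<Longrightarrow> r * radial_coeff q r \<le> c * \<beta>"
    and ode: "\<And>r. r \<in> {0..R} \<Longrightarrow> q r = l + (p - 1) * (r * radial_coeff q r) powr (p / (p - 1))"
  shows "ennreal l \<le> robin_eig F p \<beta> D"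
  unfolding robin_eig_def
proof (rule Inf_greatest)
  have DR: "N (x - x0) \<in> {0..R}" if "x \<in> closure D" for x
    using closure_wulff_shape_le[OF R, of x x0] closure_mono[OF D(4)] that polar_nonneg by auto
  have C1: "ennreal l * set_nn_integral lebesgue D (\<lambda>x. ennreal (\<bar>u x\<bar> powr p))
        \<le> set_nn_integral lebesgue D (\<lambda>x. ennreal (F (du x) powr p))
          + ennreal \<beta> * set_nn_integral (hausdorff_measure (real (DIM('a) - 1))) (frontier D) (\<lambda>x. ennreal (\<bar>u x\<bar> powr p * F (outer_normal D x)))"
    if u: "C1_fun u du" for u du
  proof -
    note DD = D(1-3) u
    have "c * (l * mass D u - energy D du) \<le> c * \<beta> * bdry D u"
      by (rule robin_flux_le[OF DD c q q0 DR B ode])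
    then have "l * mass D u - energy D du \<le> \<beta> * bdry D u" using c(1) by (simp add: mult.assoc)
    then have "ennreal (l * mass D u) \<le> ennreal (energy D du + \<beta> * bdry D u)" by (intro ennreal_leI) simp
    then show ?thesis unfolding robin_nn_integrals[OF DD]
      using l \<beta> mass_nonneg[OF DD] energy_nonneg[OF DD] bdry_nonneg[OF DD] by (simp add: ennreal_mult)
  qed
  fix z assume "z \<in> {(set_nn_integral lebesgue D (\<lambda>x. ennreal (F (G x) powr p))
           + ennreal \<beta> * set_nn_integral (hausdorff_measure (real (DIM('a) - 1))) (frontier D)
               (\<lambda>x. ennreal (\<bar>w x\<bar> powr p * F (outer_normal D x))))
          / set_nn_integral lebesgue D (\<lambda>x. ennreal (\<bar>v x\<bar> powr p))
        | v G w. sobolev_W1p p D v G \<and> sobolev_trace p D v G w \<and> \<not> (AE x in lebesgue_on D. v x = 0)}"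
  then obtain v G w where z: "z = (set_nn_integral lebesgue D (\<lambda>x. ennreal (F (G x) powr p))
           + ennreal \<beta> * set_nn_integral (hausdorff_measure (real (DIM('a) - 1))) (frontier D)
               (\<lambda>x. ennreal (\<bar>w x\<bar> powr p * F (outer_normal D x))))
          / set_nn_integral lebesgue D (\<lambda>x. ennreal (\<bar>v x\<bar> powr p))"
    and v: "sobolev_W1p p D v G" "sobolev_trace p D v G w" "\<not> (AE x in lebesgue_on D. v x = 0)" by blast
  let ?I = "set_nn_integral lebesgue D (\<lambda>x. ennreal (\<bar>v x\<bar> powr p))"
  have "?I \<noteq> top" using v(1) by (auto simp: sobolev_W1p_def less_top)
  moreover have "?I \<noteq> 0"
  proof
    assume "?I = 0"
    then have "(\<integral>\<^sup>+x. ennreal (\<bar>v x\<bar> powr p) \<partial>lebesgue_on D) = 0"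
      using D(1) by (subst nn_integral_restrict_space) auto
    moreover have "v \<in> borel_measurable (lebesgue_on D)" using v(1) by (simp add: sobolev_W1p_def)
    ultimately have "AE x in lebesgue_on D. ennreal (\<bar>v x\<bar> powr p) = 0" by (subst (asm) nn_integral_0_iff_AE) auto
    then have "AE x in lebesgue_on D. v x = 0" by eventually_elim auto
    then show False using v(3) by simp
  qed
  ultimately have "ennreal l = (ennreal l * ?I) / ?I" by (simp add: mult_divide_eq_ennreal)
  also have "\<dots> \<le> z" unfolding z
    by (intro divide_right_mono_ennreal robin_lower_bound_extend[OF D(1-3) l less_imp_le[OF \<beta>] C1 v(1,2)])
  finally show "ennreal l \<le> z" .
qed

end

theorem theorem5p1:
  fixes F :: "'a::euclidean_space \<Rightarrow> real"
    and p \<alpha> \<beta> R :: real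
    and \<Omega> :: "'a set"
    and x0 :: 'a
  assumes "DIM('a) \<ge> 2"
    and "1 < p"
    and "finsler_norm p F"
    and "bounded \<Omega>" and "open \<Omega>"
    and "0 < \<alpha>" and "\<alpha> < 1"
    and "C1alpha_boundary \<alpha> \<Omega>"
    and "0 < R"
    and "\<Omega> \<subseteq> wulff_shape F x0 R"
    and "0 < \<beta>"
  shows "robin_eig F p \<beta> (wulff_shape F x0 R) \<le> robin_eig F p \<beta> \<Omega>"
proof -
  interpret finsler F p by unfold_locales fact+
  obtain c where c: "0 < c" "\<And>e :: 'a. norm e = 1 \<Longrightarrow> swept_measure e = density lborel (\<lambda>_. ennreal c)"
    using swept_measure_eq[OF assms(1)] by blast
  \<comment> \<open>The profile is solved with end value \<open>c * \<beta>\<close>, which offsets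
    the factor c in the divergence theorem. The same l then bounds both eigenvalues, from above and
    from below.\<close>
  have B: "0 < c * \<beta>" using c(1) \<open>0 < \<beta>\<close> by simp
  obtain l q where lq: "0 \<le> l" "continuous_on UNIV q" "\<And>r. 0 \<le> q r"
    "R * radial_coeff q R = c * \<beta>"
    "\<And>r. r \<in> {0..R} \<Longrightarrow> r * radial_coeff q r \<le> c * \<beta>"
    "\<And>r. r \<in> {0..R} \<Longrightarrow> q r = l + (p - 1) * (r * radial_coeff q r) powr (p / (p - 1))"
    using radial_profile_exists[OF \<open>1 < p\<close> B \<open>0 < R\<close>, of "DIM('a) - 1"] unfolding radial_coeff_def by blast
  have "robin_eig F p \<beta> (wulff_shape F x0 R) \<le> ennreal l"
    by (rule robin_eig_wulff_shape_le[OF \<open>0 < R\<close> \<open>0 < \<beta>\<close> c lq(2,3,5,4,6)])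
  also have "\<dots> \<le> robin_eig F p \<beta> \<Omega>"
    by (rule robin_eig_ge[OF \<open>open \<Omega>\<close> \<open>bounded \<Omega>\<close> C1alpha_boundary_imp_C1_domain[OF \<open>open \<Omega>\<close> \<open>C1alpha_boundary \<alpha> \<Omega>\<close> \<open>0 < \<alpha>\<close>]
        \<open>\<Omega> \<subseteq> wulff_shape F x0 R\<close> \<open>0 < R\<close> \<open>0 < \<beta>\<close> lq(1) c lq(2,3,5,6)])
  finally show ?thesis .
qed

end
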